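(* Let $p$ be a prime and let $a_1,a_2,a_3,b\in\mathbb{Z}_p$ with $a_1a_2a_3\neq 0$ and $a_i\neq a_j$ for some $i,j\in\{1,2,3\}$. Every $3$-coloring of $\mathbb{Z}_p$ with nonempty color classes contains a rainbow solution of $a_1x+a_2y+a_3z=b$ if and only if one of the following holds: (i) $a_1+a_2+a_3=0\neq b$; (ii) $|\langle d_1,d_2,\dots,d_6\rangle|=p-1$, where $d_1=-a_3a_1^{-1}$, $d_2=-a_2a_1^{-1}$, $d_3=-a_1a_2^{-1}$, $d_4=-a_3a_2^{-1}$, $d_5=-a_1a_3^{-1}$, $d_6=-a_2a_3^{-1}$.
   Context: A $3$-coloring of $\mathbb{Z}_p$ is a partition $\mathbb{Z}_p=A\cup B\cup C$ into three nonempty color classes. A set $\{s_1,s_2,s_3\}\subseteq\mathbb{Z}_p$ is a solution of $a_1x+a_2y+a_3z=b$ if $a_1s_i+a_2s_j+a_3s_k=b$ for some choice of $\{i,j,k\}=\{1,2,3\}$. A solution is rainbow if its elements belong pairwise to distinct color classes. $\langle d_1,\dots,d_6\rangle$ denotes the subgroup of the multiplicative group $\mathbb{Z}_p^{\ast}=\mathbb{Z}_p\setminus\{0\}$ generated by $d_1,\dots,d_6$. *)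

theory Defs
  imports
    "HOL-Number_Theory.Residues"
    "HOL-Algebra.Generated_Groups"
    "HOL-Algebra.Multiplicative_Group"
    "HOL-Library.Disjoint_Sets"
begin

text \<open>The field $Z_p$ is \<^const>\<open>residue_ring\<close> \<open>(int p)\<close>, with carrier \<open>{0..p-1}\<close>.
  The definitions below are stated over an arbitrary ring.\<close>

text \<open>\<^const>\<open>partition_on\<close> already requires every class to be nonempty.\<close>

definition three_coloring :: "('a, 'm) ring_scheme \<Rightarrow> 'a set set \<Rightarrow> bool" where
  "three_coloring R P \<longleftrightarrow> partition_on (carrier R) P \<and> card P = 3"

text \<open>A solution is an unordered set \<open>S\<close>. The choice of the order in which its elements are
  substituted for the unknowns is the choice of the enumeration \<open>x, y, z\<close> of \<open>S\<close>.\<close>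

definition is_solution ::
  "('a, 'm) ring_scheme \<Rightarrow> 'a \<Rightarrow> 'a \<Rightarrow> 'a \<Rightarrow> 'a \<Rightarrow> 'a set \<Rightarrow> bool" where
  "is_solution R a1 a2 a3 b S \<longleftrightarrow>
     (\<exists>x\<in>carrier R. \<exists>y\<in>carrier R. \<exists>z\<in>carrier R. S = {x, y, z} \<and>
        a1 \<otimes>\<^bsub>R\<^esub> x \<oplus>\<^bsub>R\<^esub> a2 \<otimes>\<^bsub>R\<^esub> y \<oplus>\<^bsub>R\<^esub> a3 \<otimes>\<^bsub>R\<^esub> z = b)"

definition rainbow :: "'a set set \<Rightarrow> 'a set \<Rightarrow> bool" where
  "rainbow P S \<longleftrightarrow>
     (\<exists>s1 s2 s3. S = {s1, s2, s3} \<and>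
        (\<exists>X\<in>P. \<exists>Y\<in>P. \<exists>Z\<in>P. s1 \<in> X \<and> s2 \<in> Y \<and> s3 \<in> Z \<and> X \<noteq> Y \<and> X \<noteq> Z \<and> Y \<noteq> Z))"

end

theory Submission
  imports Defs
begin

text \<open>Suppose that the classes \<open>A, B, C\<close> form a coloring without a rainbow solution. For every
  assignment of the coefficients, the dilates \<open>a i * A\<close>, \<open>a j * B\<close> and \<open>b - a k * C\<close> then violate the
  Cauchy--Davenport bound by at most one, and Vosper-type arguments apply. Count the points of a
  set that leave it under translation by \<open>d\<close>. A singleton class is handled by the affine maps
  that send a residue to the one completing a solution with the singleton. Otherwise the largest class
  has at most two exits in all directions \<open>(a i / a j) * d\<close> for some \<open>d\<close>, the only exception being
  two classes that are three-element sets with translated dilates, which first moments exclude. A set with at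
  least five elements in it and in its complement, and with at most two exits in two directions, is a union
  of two arcs with respect to either, which forces the ratio of the directions to be \<open>\<plusminus>1\<close>, \<open>\<plusminus>2\<close> or
  \<open>\<plusminus>1/2\<close>; applied to a ratio of coefficients and to its square this makes all \<open>(a i) ^ 4\<close> equal,
  contrary to (i) and to (ii). Sets with four elements and the field with seven elements need separate
  arguments.\<close>

section \<open>Periodic sets of integers\<close>

text \<open>The sizes of the classes add up to \<open>p\<close>, one short of the Cauchy-Davenport
  bound \<open>p + 1\<close>. Vosper's theorem describes equality only, and one step below equality
  the sets need no longer be progressions. The proof therefore never classifies them. It follows
  numbers of exits, which \<open>exits_step\<close> carries from one set to another at the price of
  the slack. The special cases are real. For every l the set {0, 1, l, l + 1} has at most two exits
  in the directions 1 and l, so a single ratio of directions says nothing about four-element sets.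
  Modulo 7 the set {0, 1, 3} has two exits in every nonzero direction. Equal fourth powers are the
  target because they absorb every ratio whose square is 1 or -1. They contradict both hypotheses
  for the same arithmetic reason: the fourth roots of unity are stable under the negated ratios but
  omit 2, since \<open>2 ^ 4 - 1 = 15\<close> has no prime factor above 5, and a vanishing sum of
  coefficients with equal fourth powers again forces a factor of 15 to vanish.\<close>

text \<open>A subset of \<open>Z_p\<close> is represented by its preimage in the integers; \<open>sz\<close> is the
  cardinality of the subset and \<open>exits W d\<close> counts the points of \<open>W\<close> that leave \<open>W\<close> under
  translation by \<open>d\<close>. A set with \<open>exits W d \<le> 1\<close> is an arithmetic progression.\<close>

locale prime_modulus =
  fixes p :: nat
  assumes prime: "prime p"
begin

definition periodic :: "int set \<Rightarrow> bool" where
  "periodic W \<longleftrightarrow> (\<forall>x y. [x = y] (mod int p) \<longrightarrow> x \<in> W \<longrightarrow> y \<in> W)"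

definition sz :: "int set \<Rightarrow> nat" where
  "sz W = card (W \<inter> {0..<int p})"

definition exits :: "int set \<Rightarrow> int \<Rightarrow> nat" where
  "exits W d = sz {x \<in> W. x + d \<notin> W}"

lemma p_ge_2: "2 \<le> p"
  using prime prime_ge_2_nat by blast

lemma prime_int: "prime (int p)"
  using prime by simp

lemma periodicD: "periodic W \<Longrightarrow> [x = y] (mod int p) \<Longrightarrow> x \<in> W \<longleftrightarrow> y \<in> W"
  unfolding periodic_def by (meson cong_sym)

lemma periodicD_dvd: "periodic W \<Longrightarrow> int p dvd x - y \<Longrightarrow> x \<in> W \<longleftrightarrow> y \<in> W"
  by (rule periodicD) (auto simp: cong_iff_dvd_diff)

lemma periodicI: "(\<And>x y. [x = y] (mod int p) \<Longrightarrow> x \<in> W \<Longrightarrow> y \<in> W) \<Longrightarrow> periodic W"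
  unfolding periodic_def by blast

lemma periodic_Compl [simp]: "periodic W \<Longrightarrow> periodic (- W)"
  by (rule periodicI) (auto dest: periodicD)

lemma periodic_Int [simp]: "periodic V \<Longrightarrow> periodic W \<Longrightarrow> periodic (V \<inter> W)"
  by (auto simp: periodic_def)

lemma periodic_Un [simp]: "periodic V \<Longrightarrow> periodic W \<Longrightarrow> periodic (V \<union> W)"
  by (auto simp: periodic_def)

lemma periodic_affine [simp]: "periodic W \<Longrightarrow> periodic {x. m * x + c \<in> W}"
proof (rule periodicI)
  fix x y assume "periodic W" "[x = y] (mod int p)" "x \<in> {x. m * x + c \<in> W}"
  moreover from this have "[m * x + c = m * y + c] (mod int p)"
    by (intro cong_add cong_mult cong_refl)
  ultimately show "y \<in> {x. m * x + c \<in> W}"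
    by (auto dest: periodicD)
qed

lemma periodic_shift [simp]: "periodic W \<Longrightarrow> periodic {x. x + c \<in> W}"
  using periodic_affine[of W 1 c] by simp

lemma periodic_shift_left [simp]: "periodic W \<Longrightarrow> periodic {x. x - c \<in> W}"
  using periodic_affine[of W 1 "- c"] by simp

lemma periodic_mult [simp]: "periodic W \<Longrightarrow> periodic {x. m * x \<in> W}"
  using periodic_affine[of W m 0] by simp

lemma periodic_reflect [simp]: "periodic W \<Longrightarrow> periodic {x. c - x \<in> W}"
  using periodic_affine[of W "- 1" c] by simp

lemma periodic_Collect_conj [simp]:
  "periodic {x. P x} \<Longrightarrow> periodic {x. Q x} \<Longrightarrow> periodic {x. P x \<and> Q x}"
  unfolding periodic_def by blast

lemma periodic_Collect_not [simp]: "periodic {x. P x} \<Longrightarrow> periodic {x. \<not> P x}"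
  unfolding periodic_def by (metis cong_sym mem_Collect_eq)

lemma periodic_mem [simp]: "periodic W \<Longrightarrow> periodic {x. x \<in> W}"
  by simp

section \<open>Counting residues in periodic sets\<close>

lemma sz_le_of_inj:
  assumes V: "periodic V" and f: "\<And>x. x \<in> W \<Longrightarrow> f x \<in> V"
    and inj: "\<And>x y. x \<in> W \<Longrightarrow> y \<in> W \<Longrightarrow> [f x = f y] (mod int p) \<Longrightarrow> [x = y] (mod int p)"
  shows "sz W \<le> sz V"
  unfolding sz_def
proof (rule card_inj_on_le)
  show "inj_on (\<lambda>x. f x mod int p) (W \<inter> {0..<int p})"
  proof (rule inj_onI)
    fix x y assume *: "x \<in> W \<inter> {0..<int p}" "y \<in> W \<inter> {0..<int p}" "f x mod int p = f y mod int p"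
    then have "[x = y] (mod int p)"
      using inj[of x y] unfolding cong_def by blast
    then show "x = y"
      using * by (auto intro: cong_less_imp_eq_int)
  qed
  show "(\<lambda>x. f x mod int p) ` (W \<inter> {0..<int p}) \<subseteq> V \<inter> {0..<int p}"
  proof safe
    fix x assume "x \<in> W"
    then show "f x mod int p \<in> V"
      using f periodicD[OF V, of "f x mod int p" "f x"] by (auto simp: cong_def)
  qed (use p_ge_2 in auto)
qed auto

lemma sz_mono: "periodic V \<Longrightarrow> W \<subseteq> V \<Longrightarrow> sz W \<le> sz V"
  unfolding sz_def by (rule card_mono) auto

lemma unit_inverse:
  assumes "\<not> int p dvd m"
  obtains n where "[m * n = 1] (mod int p)"
  using assms prime_int by (metis cong_solve_coprime_int coprime_commute prime_imp_coprime)

lemma sz_affine: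
  assumes "periodic W" "\<not> int p dvd m"
  shows "sz {x. m * x + c \<in> W} = sz W"
proof (rule antisym)
  obtain n where n: "[m * n = 1] (mod int p)"
    using unit_inverse assms(2) .
  have inv: "[m * (n * y) = y] (mod int p)" for y
    using cong_scalar_right[OF n, of y] by (simp add: algebra_simps)
  show "sz {x. m * x + c \<in> W} \<le> sz W"
  proof (rule sz_le_of_inj)
    fix x y assume "[m * x + c = m * y + c] (mod int p)"
    then have "int p dvd m * (x - y)"
      by (simp add: cong_iff_dvd_diff algebra_simps)
    then show "[x = y] (mod int p)"
      using assms(2) prime_int by (simp add: prime_dvd_mult_iff cong_iff_dvd_diff)
  qed (use assms in auto)
  show "sz W \<le> sz {x. m * x + c \<in> W}"
  proof (rule sz_le_of_inj[where f = "\<lambda>x. n * (x - c)"])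
    fix x assume "x \<in> W"
    moreover have "[m * (n * (x - c)) + c = (x - c) + c] (mod int p)"
      by (intro cong_add inv cong_refl)
    ultimately show "n * (x - c) \<in> {x. m * x + c \<in> W}"
      using periodicD[OF assms(1)] by simp
  next
    fix x y assume "[n * (x - c) = n * (y - c)] (mod int p)"
    then have "[m * (n * (x - c)) = m * (n * (y - c))] (mod int p)"
      by (rule cong_scalar_left)
    then have "[x - c = y - c] (mod int p)"
      using inv by (meson cong_sym cong_trans)
    then show "[x = y] (mod int p)"
      by (simp add: cong_iff_dvd_diff)
  qed (use assms in auto)
qed

lemma sz_mult: "periodic W \<Longrightarrow> \<not> int p dvd m \<Longrightarrow> sz {x. m * x \<in> W} = sz W"
  using sz_affine[of W m 0] by simp

lemma not_p_dvd_1: "\<not> int p dvd 1"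
  using p_ge_2 by auto

lemma sz_shift: "periodic W \<Longrightarrow> sz {x. x + c \<in> W} = sz W"
  using sz_affine[of W 1 c] not_p_dvd_1 by simp

lemma sz_shift_left: "periodic W \<Longrightarrow> sz {x. x - c \<in> W} = sz W"
  using sz_shift[of W "- c"] by simp

lemma sz_reflect: "periodic W \<Longrightarrow> sz {x. c - x \<in> W} = sz W"
  using sz_affine[of W "- 1" c] not_p_dvd_1 by simp

lemma sz_Un_Int: "sz (V \<union> W) + sz (V \<inter> W) = sz V + sz W"
proof -
  have "(V \<union> W) \<inter> {0..<int p} = (V \<inter> {0..<int p}) \<union> (W \<inter> {0..<int p})"
    and "(V \<inter> W) \<inter> {0..<int p} = (V \<inter> {0..<int p}) \<inter> (W \<inter> {0..<int p})"
    by auto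
  then show ?thesis
    unfolding sz_def using card_Un_Int[of "V \<inter> {0..<int p}" "W \<inter> {0..<int p}"] by simp
qed

lemma sz_UNIV [simp]: "sz UNIV = p" and sz_empty [simp]: "sz {} = 0"
  by (auto simp: sz_def)

lemma sz_disjoint: "V \<inter> W = {} \<Longrightarrow> sz (V \<union> W) = sz V + sz W"
  using sz_Un_Int[of V W] by simp

lemma sz_Compl: "sz W + sz (- W) = p"
  using sz_disjoint[of W "- W"] by simp

lemma sz_split: "sz W = sz {x \<in> W. P x} + sz {x \<in> W. \<not> P x}"
proof -
  have "W = {x \<in> W. P x} \<union> {x \<in> W. \<not> P x}"
    by auto
  then show ?thesis
    by (metis (mono_tags, lifting) sz_disjoint disjoint_iff mem_Collect_eq)
qed

lemma sz_pos_iff: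
  assumes "periodic W"
  shows "0 < sz W \<longleftrightarrow> W \<noteq> {}"
proof
  assume "W \<noteq> {}"
  then obtain x where "x \<in> W" by auto
  then have "x mod int p \<in> W \<inter> {0..<int p}"
    using periodicD[OF assms, of "x mod int p" x] p_ge_2 by (auto simp: cong_def)
  then show "0 < sz W"
    unfolding sz_def by (subst card_gt_0_iff) blast
qed (auto simp: sz_def)

lemma sz_less_iff: "periodic W \<Longrightarrow> sz W < p \<longleftrightarrow> W \<noteq> UNIV"
  using sz_Compl[of W] sz_pos_iff[of "- W"] by auto

lemma sz_psubset:
  assumes "periodic V" "periodic W" "W \<subset> V"
  shows "sz W < sz V"
proof -
  have "V = W \<union> (V \<inter> - W)" "W \<inter> (V \<inter> - W) = {}"
    using assms(3) by auto
  then have "sz V = sz W + sz (V \<inter> - W)"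
    by (metis sz_disjoint)
  moreover have "0 < sz (V \<inter> - W)"
    using assms by (subst sz_pos_iff) auto
  ultimately show ?thesis by simp
qed

definition res_class :: "int \<Rightarrow> int set" where
  "res_class x = {y. [x = y] (mod int p)}"

lemma periodic_res_class [simp]: "periodic (res_class x)"
  unfolding res_class_def by (rule periodicI) (auto intro: cong_trans)

lemma res_class_self [simp]: "x \<in> res_class x"
  by (simp add: res_class_def)

lemma res_class_mem: "y \<in> res_class x \<longleftrightarrow> int p dvd y - x"
  by (simp add: res_class_def cong_iff_dvd_diff dvd_diff_commute)

lemma res_class_subset: "periodic W \<Longrightarrow> x \<in> W \<Longrightarrow> res_class x \<subseteq> W"
  by (auto simp: res_class_def periodicD)

lemma sz_res_class [simp]: "sz (res_class x) = 1"
proof -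
  have "res_class x \<inter> {0..<int p} = {x mod int p}"
    using p_ge_2 by (auto simp: res_class_def cong_def)
  then show ?thesis
    by (simp add: sz_def)
qed

lemma sz_eq_1D:
  assumes "periodic W" "sz W = 1"
  obtains x where "W = res_class x"
proof -
  obtain x where x: "x \<in> W"
    using sz_pos_iff[OF assms(1)] assms(2) by auto
  have "\<not> res_class x \<subset> W"
    using sz_psubset[OF assms(1), of "res_class x"] assms(2) by auto
  then have "W = res_class x"
    using res_class_subset[OF assms(1) x] by auto
  then show ?thesis
    using that by blast
qed

lemma sz_ge_2D:
  assumes "periodic W" "2 \<le> sz W"
  obtains x y where "x \<in> W" "y \<in> W" "\<not> int p dvd y - x"
proof -
  obtain x where x: "x \<in> W"
    using sz_pos_iff[OF assms(1)] assms(2) by auto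
  then have "res_class x \<noteq> W"
    using assms(2) by auto
  then obtain y where "y \<in> W" "y \<notin> res_class x"
    using res_class_subset[OF assms(1) x] by auto
  then show ?thesis
    using that x by (auto simp: res_class_mem)
qed

lemma sz_ge_card:
  assumes "periodic W" "finite F" "F \<subseteq> W" "\<And>x y. x \<in> F \<Longrightarrow> y \<in> F \<Longrightarrow> [x = y] (mod int p) \<Longrightarrow> x = y"
  shows "card F \<le> sz W"
  unfolding sz_def
proof (rule card_inj_on_le)
  show "inj_on (\<lambda>x. x mod int p) F"
    using assms(4) by (auto simp: inj_on_def cong_def)
  show "(\<lambda>x. x mod int p) ` F \<subseteq> W \<inter> {0..<int p}"
  proof safe
    fix x assume "x \<in> F"
    then show "x mod int p \<in> W"
      using assms(3) periodicD[OF assms(1), of "x mod int p" x] by (auto simp: cong_def)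
  qed (use p_ge_2 in auto)
qed auto

lemma dvd_mult_cancel_unit: "\<not> int p dvd m \<Longrightarrow> int p dvd m * x \<longleftrightarrow> int p dvd x"
  using prime_int by (simp add: prime_dvd_mult_iff)

text \<open>Modulo a prime the multiples of a nonzero \<open>d\<close> exhaust the residues, so one
  orbit is everything. In the induction for Cauchy-Davenport this supplies the exit that makes the
  transform proper.\<close>

lemma invariant_shift_trivial:
  assumes W: "periodic W" and d: "\<not> int p dvd d" and step: "\<And>x. x \<in> W \<Longrightarrow> x + d \<in> W"
  shows "W = {} \<or> W = UNIV"
proof (rule ccontr)
  assume "\<not> (W = {} \<or> W = UNIV)"
  then obtain x y where x: "x \<in> W" and y: "y \<notin> W" by auto
  have iter: "x + int n * d \<in> W" for n
  proof (induction n)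
    case (Suc n)
    then show ?case
      using step[of "x + int n * d"] by (simp add: algebra_simps)
  qed (use x in simp)
  obtain e where e: "[d * e = 1] (mod int p)"
    using unit_inverse d .
  \<comment> \<open>A natural number congruent to \<open>(y - x) / d\<close>, so that the orbit of
    \<open>x\<close> arrives at \<open>y\<close>.\<close>
  define n where "n = nat ((e * (y - x)) mod int p)"
  have "[int n = e * (y - x)] (mod int p)"
    using p_ge_2 by (simp add: n_def cong_def)
  then have "[x + int n * d = x + (e * (y - x)) * d] (mod int p)"
    by (intro cong_add cong_mult cong_refl)
  moreover have "[x + (e * (y - x)) * d = x + 1 * (y - x)] (mod int p)"
    using cong_add[OF cong_refl[of x] cong_scalar_right[OF e, of "y - x"]] by (simp add: algebra_simps)
  ultimately have "[x + int n * d = y] (mod int p)"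
    using cong_trans by fastforce
  then show False
    using iter[of n] y periodicD[OF W] by blast
qed

section \<open>Exits under translation\<close>

lemma periodic_exits [simp]: "periodic W \<Longrightarrow> periodic {x \<in> W. x + d \<notin> W}"
  by simp

lemma sz_stay: "sz {x \<in> W. x + d \<in> W} + exits W d = sz W"
  unfolding exits_def using sz_split[of W "\<lambda>x. x + d \<in> W"] by simp

text \<open>Translation by \<open>d\<close> maps the points that stay under \<open>d\<close> onto
  those that stay under \<open>- d\<close>. Directions therefore matter only up to sign.\<close>

lemma exits_uminus: "periodic W \<Longrightarrow> exits W (- d) = exits W d"
proof -
  assume W: "periodic W"
  have "{x. x + - d \<in> {x \<in> W. x + d \<in> W}} = {x \<in> W. x + - d \<in> W}"
    by auto
  then have "sz {x \<in> W. x + - d \<in> W} = sz {x \<in> W. x + d \<in> W}"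
    using sz_shift[of "{x \<in> W. x + d \<in> W}" "- d"] W by simp
  then show ?thesis
    using sz_stay[of W d] sz_stay[of W "- d"] by simp
qed

lemma exits_cong: "periodic W \<Longrightarrow> [d = e] (mod int p) \<Longrightarrow> exits W d = exits W e"
proof -
  assume W: "periodic W" and *: "[d = e] (mod int p)"
  have "x + d \<in> W \<longleftrightarrow> x + e \<in> W" for x
    using * by (intro periodicD[OF W] cong_add cong_refl)
  then show ?thesis
    by (simp add: exits_def)
qed

text \<open>A translation permutes the residues, so it enters \<open>W\<close> as often as it leaves
  it. This permits passing to the smaller of a set and its complement.\<close>

lemma exits_Compl: "periodic W \<Longrightarrow> exits (- W) d = exits W d"
proof -
  assume W: "periodic W"
  have "sz {x. x + d \<in> W} = sz W"
    using W by (rule sz_shift)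
  moreover have "sz {x. x + d \<in> W} = sz {x \<in> W. x + d \<in> W} + sz {x \<in> - W. x + d \<in> W}"
    using sz_split[of "{x. x + d \<in> W}" "\<lambda>x. x \<in> W"] by (simp add: conj_commute)
  ultimately show ?thesis
    using sz_stay[of W d] by (simp add: exits_def)
qed

lemma exits_mult: "periodic W \<Longrightarrow> \<not> int p dvd m \<Longrightarrow> exits {x. m * x \<in> W} d = exits W (m * d)"
  unfolding exits_def using sz_mult[of "{x \<in> W. x + m * d \<notin> W}" m]
  by (simp add: algebra_simps)

lemma exits_shift: "periodic W \<Longrightarrow> exits {x. x + c \<in> W} d = exits W d"
  unfolding exits_def using sz_shift[of "{x \<in> W. x + d \<notin> W}" c]
  by (simp add: algebra_simps)

lemma exits_reflect: "periodic W \<Longrightarrow> exits {x. c - x \<in> W} d = exits W d"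
proof -
  assume W: "periodic W"
  have "exits {x. c - x \<in> W} d = exits W (- d)"
    unfolding exits_def using sz_reflect[of "{x \<in> W. x + - d \<notin> W}" c] W
    by (simp add: algebra_simps)
  then show ?thesis
    using exits_uminus[OF W] by simp
qed

section \<open>Triples of sets without a zero sum\<close>

text \<open>Avoiding zero is symmetric in the three sets, unlike a bound on the sumset of two, so
  the roles can be exchanged. Periodicity makes the condition over the integers equivalent to the
  one modulo \<open>p\<close>.\<close>

definition sum_free :: "int set \<Rightarrow> int set \<Rightarrow> int set \<Rightarrow> bool" where
  "sum_free X Y Z \<longleftrightarrow> periodic X \<and> periodic Y \<and> periodic Z \<and> (\<forall>x\<in>X. \<forall>y\<in>Y. \<forall>z\<in>Z. x + y + z \<noteq> 0)"

lemma sum_free_commute: "sum_free X Y Z \<Longrightarrow> sum_free Y X Z"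
  unfolding sum_free_def by (metis add.commute)

lemma sum_free_rotate: "sum_free X Y Z \<Longrightarrow> sum_free Y Z X"
  unfolding sum_free_def by (metis add.commute add.assoc)

text \<open>Dyson's \<open>e\<close>-transform.\<close>

lemma sum_free_transform:
  assumes "sum_free X Y Z"
  shows "sum_free {x \<in> X. x + e \<in> Y} (Y \<union> {y. y - e \<in> X}) Z"
  unfolding sum_free_def
proof (intro conjI ballI)
  fix x y z assume *: "x \<in> {x \<in> X. x + e \<in> Y}" "y \<in> Y \<union> {y. y - e \<in> X}" "z \<in> Z"
  then consider "y \<in> Y" | "y - e \<in> X" by auto
  then show "x + y + z \<noteq> 0"
  proof cases
    case 1 then show ?thesis using assms * unfolding sum_free_def by auto
  next
    case 2
    then have "(y - e) + (x + e) + z \<noteq> 0"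
      using assms * unfolding sum_free_def by blast
    then show ?thesis by simp
  qed
qed (use assms in \<open>auto simp: sum_free_def\<close>)

lemma sz_transform:
  assumes "periodic X" "periodic Y"
  shows "sz {x \<in> X. x + e \<in> Y} + sz (Y \<union> {y. y - e \<in> X}) = sz X + sz Y"
proof -
  have "{x. x + e \<in> Y \<inter> {y. y - e \<in> X}} = {x \<in> X. x + e \<in> Y}"
    by auto
  then have "sz {x \<in> X. x + e \<in> Y} = sz (Y \<inter> {y. y - e \<in> X})"
    using sz_shift[of "Y \<inter> {y. y - e \<in> X}" e] assms by simp
  moreover have "sz {y. y - e \<in> X} = sz X"
    using sz_shift_left assms(1) .
  ultimately show ?thesis
    using sz_Un_Int[of Y "{y. y - e \<in> X}"] by simp
qed

text \<open>A single \<open>x\<close> in \<open>X\<close> makes the reflected copy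
  \<open>- x - Y\<close> disjoint from \<open>Z\<close>.\<close>

lemma sum_free_less:
  assumes "sum_free X Y Z" "X \<noteq> {}" "Z \<noteq> {}"
  shows "sz Y + sz Z \<le> p"
proof -
  obtain x where x: "x \<in> X" using assms by auto
  have "Z \<subseteq> - {z. - x - z \<in> Y}"
    using assms(1) x unfolding sum_free_def by fastforce
  then have "sz Z \<le> sz (- {z. - x - z \<in> Y})"
    using assms(1) by (intro sz_mono) (auto simp: sum_free_def)
  moreover have "sz {z. - x - z \<in> Y} = sz Y"
    using assms(1) by (intro sz_reflect) (auto simp: sum_free_def)
  ultimately show ?thesis
    using sz_Compl[of "{z. - x - z \<in> Y}"] by simp
qed

text \<open>With \<open>Z\<close> the negated complement of the sumset this is the usual bound
  \<open>sz X + sz Y - 1\<close>. The transform keeps the total size while moving points from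
  \<open>X\<close> to \<open>Y\<close>, until \<open>X\<close> is a single point.\<close>

theorem cauchy_davenport:
  assumes "sum_free X Y Z" "X \<noteq> {}" "Y \<noteq> {}" "Z \<noteq> {}"
  shows "sz X + sz Y + sz Z \<le> p + 1"
  using assms
proof (induction "sz X" arbitrary: X Y rule: less_induct)
  case less
  have per: "periodic X" "periodic Y" "periodic Z"
    using less.prems(1) by (auto simp: sum_free_def)
  show ?case
  proof (cases "2 \<le> sz X")
    case False
    then show ?thesis
      using sum_free_less[OF less.prems(1,2,4)] by simp
  next
    case True
    then obtain x1 x2 where x: "x1 \<in> X" "x2 \<in> X" "\<not> int p dvd x2 - x1"
      using sz_ge_2D per(1) by blast
    have "0 < sz Z"
      using sz_pos_iff[OF per(3)] less.prems(4) by simp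
    then have "sz Y < p"
      using sum_free_less[OF less.prems(1,2,4)] by linarith
    then obtain y where y: "y \<in> Y" "y + (x2 - x1) \<notin> Y"
      using invariant_shift_trivial[OF per(2) x(3)] less.prems(3) sz_less_iff[OF per(2)] by blast
    \<comment> \<open>Placing \<open>x1\<close> on an exit of \<open>Y\<close> under
      \<open>x2 - x1\<close> keeps \<open>x1\<close> in the transformed set and throws
      \<open>x2\<close> out, so the set shrinks without becoming empty.\<close>
    define e where "e = y - x1"
    define X' where "X' = {x \<in> X. x + e \<in> Y}"
    define Y' where "Y' = Y \<union> {y. y - e \<in> X}"
    have free: "sum_free X' Y' Z"
      unfolding X'_def Y'_def using less.prems(1) by (rule sum_free_transform)
    have "x1 \<in> X'" "x2 \<notin> X'"
      using x y by (auto simp: X'_def e_def algebra_simps)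
    then have "X' \<subset> X" "X' \<noteq> {}"
      using x by (auto simp: X'_def)
    moreover have "periodic X'"
      using free by (simp add: sum_free_def)
    ultimately have "sz X' + sz Y' + sz Z \<le> p + 1"
      using less.prems free sz_psubset[OF per(1)] by (intro less.hyps) (auto simp: Y'_def)
    then show ?thesis
      using sz_transform[OF per(1,2), of e] by (simp add: X'_def Y'_def)
  qed
qed

end

section \<open>Nearly extremal triples\<close>

context prime_modulus
begin

text \<open>A sum with \<open>z - t\<close> in \<open>Z\<close> does not change when
  \<open>t\<close> is moved from \<open>z\<close> to \<open>x\<close>, and \<open>x + t\<close> is
  still in \<open>X\<close> by the restriction. \<open>X\<close> loses its exits under
  \<open>t\<close> while \<open>Z\<close> gains as many points as it has exits.\<close>

lemma sum_free_lattice: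
  assumes "sum_free X Y Z"
  shows "sum_free {x \<in> X. x + t \<in> X} Y (Z \<union> {z. z - t \<in> Z})"
  unfolding sum_free_def
proof (intro conjI ballI)
  fix x y z assume *: "x \<in> {x \<in> X. x + t \<in> X}" "y \<in> Y" "z \<in> Z \<union> {z. z - t \<in> Z}"
  have "x + y + z \<noteq> 0" if "z \<in> Z"
    using * that assms by (auto simp: sum_free_def)
  moreover have "(x + t) + y + (z - t) \<noteq> 0" if "z - t \<in> Z"
    using * that assms unfolding sum_free_def by blast
  ultimately show "x + y + z \<noteq> 0"
    using * by auto
qed (use assms in \<open>auto simp: sum_free_def\<close>)

lemma sz_Un_shift: "periodic Z \<Longrightarrow> sz (Z \<union> {z. z - t \<in> Z}) = sz Z + exits Z t"
  using sz_transform[of Z Z t] sz_stay[of Z t] by simp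

text \<open>Cauchy-Davenport after \<open>sum_free_lattice\<close>: the exits of \<open>Z\<close>
  exceed those of \<open>X\<close> at most by the distance of the total size from
  \<open>p + 1\<close>. The strict inequality keeps the shrunken \<open>X\<close> nonempty.\<close>

lemma exits_step:
  assumes "sum_free X Y Z" "exits X t < sz X" "Y \<noteq> {}" "Z \<noteq> {}"
  shows "exits Z t + (sz X + sz Y + sz Z) \<le> exits X t + p + 1"
proof -
  have per: "periodic X" "periodic Y" "periodic Z"
    using assms by (auto simp: sum_free_def)
  have "0 < sz {x \<in> X. x + t \<in> X}"
    using sz_stay[of X t] assms(2) by simp
  then have "{x \<in> X. x + t \<in> X} \<noteq> {}"
    by (metis sz_empty less_irrefl)
  then have "sz {x \<in> X. x + t \<in> X} + sz Y + sz (Z \<union> {z. z - t \<in> Z}) \<le> p + 1"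
    using cauchy_davenport[OF sum_free_lattice[OF assms(1)]] assms(3,4) by blast
  then show ?thesis
    using sz_stay[of X t] sz_Un_shift[OF per(3), of t] by simp
qed

lemma sz_2_exits:
  assumes "periodic X" "sz X = 2"
  obtains d where "\<not> int p dvd d" "exits X d \<le> 1"
proof -
  obtain x y where x: "x \<in> X" "y \<in> X" "\<not> int p dvd y - x"
    using sz_ge_2D assms by (metis order_refl)
  then have "x \<in> {u \<in> X. u + (y - x) \<in> X}"
    by simp
  then have "0 < sz {u \<in> X. u + (y - x) \<in> X}"
    using assms(1) by (subst sz_pos_iff) auto
  then have "exits X (y - x) \<le> 1"
    using sz_stay[of X "y - x"] assms(2) by simp
  then show ?thesis
    using that x(3) by blast
qed

text \<open>Transforms shrink \<open>X\<close> to a pair, whose difference is the direction sought. They get stuck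
  only if every translate of \<open>X\<close> lies in \<open>Y\<close> or meets it in at most one point. Then the points \<open>y\<close> of
  \<open>Y\<close> for which the translate of \<open>X\<close> taking \<open>x0\<close> to \<open>y\<close> meets \<open>Y\<close> only in \<open>y\<close> number at least
  \<open>sz X - 1\<close> and at most \<open>1 + k\<close>, which leaves \<open>sz X = 3\<close>.\<close>

lemma few_exits_aux:
  assumes "sum_free X Y Z" "Z \<noteq> {}" "2 \<le> sz X" "sz X \<le> sz Y"
    and "sz X + sz Y + sz Z + k = p + 1" "k \<le> 1"
  shows "(\<exists>d. \<not> int p dvd d \<and> exits Z d \<le> 1 + k) \<or>
    k = 1 \<and> (\<exists>X' Y' F c. sum_free X' Y' Z \<and> sz X' = 3 \<and> sz X' + sz Y' = sz X + sz Y \<and>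
      sz F + 2 = sz Y' \<and> sum_free X' F {n. c - n \<in> - Y'})"
  using assms
proof (induction "sz X" arbitrary: X Y rule: less_induct)
  case less
  note free = less.prems(1)
  have per: "periodic X" "periodic Y" "periodic Z"
    using free by (auto simp: sum_free_def)
  have nonempty: "X \<noteq> {}" "Y \<noteq> {}"
    using less.prems(3,4) sz_empty by fastforce+
  have Zpos: "0 < sz Z"
    using less.prems(2) sz_pos_iff[OF per(3)] by simp
  consider "sz X = 2" | "3 \<le> sz X"
      "\<exists>e. 2 \<le> sz {x \<in> X. x + e \<in> Y} \<and> sz {x \<in> X. x + e \<in> Y} < sz X"
    | "3 \<le> sz X" "\<And>e. sz {x \<in> X. x + e \<in> Y} \<le> 1 \<or> sz X \<le> sz {x \<in> X. x + e \<in> Y}"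
  proof (cases "sz X = 2")
    case False
    then have "3 \<le> sz X" using less.prems(3) by simp
    moreover have "a \<le> 1 \<or> b \<le> a" if "\<not> (2 \<le> a \<and> a < b)" for a b :: nat
      using that by linarith
    ultimately show thesis
      using that(2,3) by blast
  qed (use that in simp)
  then show ?case
  proof cases
    case 1
    then obtain d where d: "\<not> int p dvd d" "exits X d \<le> 1"
      using sz_2_exits per(1) by blast
    then have "exits Z d + (sz X + sz Y + sz Z) \<le> exits X d + p + 1"
      using 1 less.prems nonempty by (intro exits_step) auto
    then have "exits Z d \<le> 1 + k"
      using d less.prems(5) by linarith
    then show ?thesis
      using d(1) by blast
  next
    case 2
    then obtain e where e: "2 \<le> sz {x \<in> X. x + e \<in> Y}" "sz {x \<in> X. x + e \<in> Y} < sz X"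
      by blast
    let ?X = "{x \<in> X. x + e \<in> Y}" and ?Y = "Y \<union> {y. y - e \<in> X}"
    have sum: "sz ?X + sz ?Y = sz X + sz Y"
      by (rule sz_transform[OF per(1,2)])
    have "sz Y \<le> sz ?Y"
      using per by (intro sz_mono) auto
    then show ?thesis
      using less.hyps[OF e(2) sum_free_transform[OF free] less.prems(2) e(1)] sum e less.prems(4-6)
      by simp
  next
    case 3
    obtain x0 where x0: "x0 \<in> X" using nonempty by auto
    define F where "F = {y \<in> Y. \<forall>x\<in>X. x + (y - x0) \<in> Y}"
    define E where "E = {y \<in> Y. \<not> (\<forall>x\<in>X. x + (y - x0) \<in> Y)}"
    define X1 where "X1 = X \<inter> - res_class x0"
    have "periodic {y. \<forall>x\<in>X. x + (y - x0) \<in> Y}"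
    proof (rule periodicI, safe)
      fix y y' x assume *: "[y = y'] (mod int p)" "\<forall>x\<in>X. x + (y - x0) \<in> Y" "x \<in> X"
      have "[x + (y - x0) = x + (y' - x0)] (mod int p)"
        using *(1) by (intro cong_add cong_diff cong_refl)
      then show "x + (y' - x0) \<in> Y"
        using * periodicD[OF per(2)] by blast
    qed
    then have perEF: "periodic E" "periodic F" "periodic X1"
      unfolding E_def F_def X1_def using per
      by (simp_all only: periodic_Collect_conj periodic_Collect_not periodic_mem periodic_Int
        periodic_Compl periodic_res_class)
    have EF: "sz E + sz F = sz Y"
      using sz_split[of Y "\<lambda>y. \<forall>x\<in>X. x + (y - x0) \<in> Y"] by (simp add: E_def F_def)
    have "X = X1 \<union> res_class x0" "X1 \<inter> res_class x0 = {}"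
      using res_class_subset[OF per(1) x0] by (auto simp: X1_def)
    then have X1: "sz X = sz X1 + 1"
      using sz_disjoint sz_res_class by metis
    have outside: "x + (y - x0) \<notin> Y" if yE: "y \<in> E" and xX: "x \<in> X1" for x y
    proof
      assume *: "x + (y - x0) \<in> Y"
      let ?X = "{x \<in> X. x + (y - x0) \<in> Y}"
      have perX: "periodic ?X"
        using per by simp
      obtain u where "u \<in> X" "u + (y - x0) \<notin> Y"
        using yE by (auto simp: E_def)
      then have "?X \<subset> X"
        by auto
      then have "sz ?X < sz X"
        using sz_psubset[OF per(1) perX] by simp
      then have "sz ?X \<le> 1"
        using 3(2)[of "y - x0"] by simp
      moreover have "x0 \<in> ?X" "x \<in> ?X" "x \<notin> res_class x0"
        using yE xX x0 * by (auto simp: X1_def E_def)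
      then have "res_class x0 \<subset> ?X"
        using res_class_subset[OF perX] by blast
      then have "1 < sz ?X"
        using sz_psubset[OF perX, of "res_class x0"] by simp
      ultimately show False by simp
    qed
    \<comment> \<open>\<open>X + F\<close> lies in \<open>Y + x0\<close>, and \<open>?N\<close> is
      the negated complement of that translate. Cauchy-Davenport bounds \<open>F\<close> from above
      and thereby \<open>E\<close> from below.\<close>
    let ?N = "{n. (- x0) - n \<in> - Y}"
    have freeN: "sum_free X F ?N"
      unfolding sum_free_def
    proof (intro conjI ballI)
      fix x y n assume *: "x \<in> X" "y \<in> F" "n \<in> ?N"
      then have "x + (y - x0) \<in> Y" "- x0 - n \<notin> Y"
        by (auto simp: F_def)
      then have "x + (y - x0) \<noteq> - x0 - n" by metis
      then show "x + y + n \<noteq> 0" by linarith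
    qed (use per perEF in auto)
    have szN: "sz ?N + sz Y = p"
      using sz_reflect[of "- Y" "- x0"] per(2) sz_Compl[of Y] by simp
    have "sz Y < p"
      using less.prems Zpos by linarith
    then have "?N \<noteq> {}"
      using szN sz_empty by fastforce
    have E_large: "sz X \<le> sz E + 1"
    proof (cases "F = {}")
      case True
      then show ?thesis using EF less.prems(4) by simp
    next
      case False
      then have "sz X + sz F + sz ?N \<le> p + 1"
        using cauchy_davenport[OF freeN nonempty(1)] \<open>?N \<noteq> {}\<close> by blast
      then show ?thesis
        using EF szN by linarith
    qed
    \<comment> \<open>Up to translation by \<open>x0\<close>, the sums of \<open>X\<close> and
      \<open>Y\<close> lie in \<open>?S\<close>, which includes \<open>Y\<close>, and the sums of
      \<open>X1\<close> and \<open>E\<close> avoid \<open>Y\<close>. The small room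
      \<open>?S - Y\<close> bounds \<open>E\<close> by \<open>1 + k\<close>.\<close>
    let ?S = "{s. (- x0) - s \<in> - Z}"
    let ?M = "{n. (- x0) - n \<in> - (?S \<inter> - Y)}"
    have perS: "periodic ?S" and perM: "periodic ?M"
      by (intro periodic_reflect periodic_Compl periodic_Int per)+
    have szS: "sz ?S + sz Z = p"
      using sz_reflect[of "- Z" "- x0"] per(3) sz_Compl[of Z] by simp
    have "Y \<subseteq> ?S"
    proof
      fix y assume "y \<in> Y"
      have "- x0 - y \<notin> Z"
      proof
        assume "- x0 - y \<in> Z"
        then have "x0 + y + (- x0 - y) \<noteq> 0"
          using free x0 \<open>y \<in> Y\<close> unfolding sum_free_def by blast
        then show False by simp
      qed
      then show "y \<in> ?S" by simp
    qed
    then have "sz Y + sz (?S \<inter> - Y) = sz ?S"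
      using sz_disjoint[of Y "?S \<inter> - Y"] by (simp add: Un_absorb1 Int_absorb1 sup_inf_distrib1)
    moreover have "sz ?M + sz (?S \<inter> - Y) = p"
      using sz_reflect[of "- (?S \<inter> - Y)" "- x0"] per sz_Compl[of "?S \<inter> - Y"] by simp
    ultimately have szM: "sz ?M = sz Z + sz Y"
      using szS by linarith
    have freeM: "sum_free X1 E ?M"
      unfolding sum_free_def
    proof (intro conjI ballI)
      fix x y n assume *: "x \<in> X1" "y \<in> E" "n \<in> ?M"
      have "- x0 - (x + (y - x0)) \<notin> Z"
      proof
        assume "- x0 - (x + (y - x0)) \<in> Z"
        then have "x + y + (- x0 - (x + (y - x0))) \<noteq> 0"
          using free * unfolding sum_free_def X1_def E_def by blast
        then show False by simp
      qed
      then have "x + (y - x0) \<in> ?S \<inter> - Y"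
        using outside[OF *(2,1)] by simp
      moreover have "- x0 - n \<notin> ?S \<inter> - Y"
        using *(3) by blast
      ultimately have "x + (y - x0) \<noteq> - x0 - n" by metis
      then show "x + y + n \<noteq> 0" by linarith
    qed (use perEF perM in auto)
    have "0 < sz X1" "0 < sz E" "0 < sz ?M"
      using X1 E_large 3(1) szM Zpos by linarith+
    then have "X1 \<noteq> {}" "E \<noteq> {}" "?M \<noteq> {}"
      using sz_pos_iff perEF perM by simp_all
    then have "sz X1 + sz E + sz ?M \<le> p + 1"
      using cauchy_davenport[OF freeM] by blast
    then have "sz E \<le> 1 + k"
      using X1 szM less.prems(5) by linarith
    \<comment> \<open>The chain \<open>2 \<le> sz X - 1 \<le> sz E \<le> 1 + k \<le> 2\<close>
      consists of equalities.\<close>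
    then have "sz X = 3" "sz E = 2" "k = 1"
      using E_large 3(1) less.prems(6) by linarith+
    moreover have "sz F + 2 = sz Y"
      using EF \<open>sz E = 2\<close> by linarith
    ultimately show ?thesis
      using free freeN by blast
  qed
qed

text \<open>Equality in Cauchy-Davenport is \<open>k = 0\<close>, where the stuck alternative does
  not exist. This is the part of Vosper's theorem that is used.\<close>

lemma few_exits_critical:
  assumes "sum_free X Y Z" "Z \<noteq> {}" "2 \<le> sz X" "2 \<le> sz Y" "sz X + sz Y + sz Z = p + 1"
  shows "\<exists>d. \<not> int p dvd d \<and> exits Z d \<le> 1"
proof (cases "sz X \<le> sz Y")
  case True
  then show ?thesis
    using few_exits_aux[of X Y Z 0] assms by simp
next
  case False
  then show ?thesis
    using few_exits_aux[of Y X Z 0] sum_free_commute[OF assms(1)] assms by simp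
qed

text \<open>In the stuck case the sizes 3, \<open>sz Y' - 2\<close> and \<open>p - sz Y'\<close> of
  \<open>X'\<close>, \<open>F\<close> and the reflected complement of \<open>Y'\<close> add up to
  \<open>p + 1\<close>. So \<open>Y'\<close> has at most one exit in some direction, and slack one
  turns this into two exits of \<open>Z\<close>. The bound 7 gives \<open>Y'\<close> four elements
  and hence \<open>F\<close> two.\<close>

lemma few_exits:
  assumes "sum_free X Y Z" "Z \<noteq> {}" "2 \<le> sz X" "2 \<le> sz Y" "sz X + sz Y + sz Z = p" "7 \<le> sz X + sz Y"
  shows "\<exists>d. \<not> int p dvd d \<and> exits Z d \<le> 2"
proof -
  have aux: "(\<exists>d. \<not> int p dvd d \<and> exits Z d \<le> 2) \<or>
    (\<exists>X' Y' F c. sum_free X' Y' Z \<and> sz X' = 3 \<and> sz X' + sz Y' = sz X + sz Y \<and>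
      sz F + 2 = sz Y' \<and> sum_free X' F {n. c - n \<in> - Y'})"
  proof (cases "sz X \<le> sz Y")
    case True
    then show ?thesis
      using few_exits_aux[of X Y Z 1] assms by auto
  next
    case False
    then show ?thesis
      using few_exits_aux[of Y X Z 1] sum_free_commute[OF assms(1)] assms
      by (auto simp: add.commute)
  qed
  then show ?thesis
  proof
    assume "\<exists>X' Y' F c. sum_free X' Y' Z \<and> sz X' = 3 \<and> sz X' + sz Y' = sz X + sz Y \<and>
      sz F + 2 = sz Y' \<and> sum_free X' F {n. c - n \<in> - Y'}"
    then obtain X' Y' F c where *: "sum_free X' Y' Z" "sz X' = 3" "sz X' + sz Y' = sz X + sz Y"
      "sz F + 2 = sz Y'" "sum_free X' F {n. c - n \<in> - Y'}" by blast
    have per: "periodic Y'" "periodic Z"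
      using *(1) by (auto simp: sum_free_def)
    have "0 < sz Z"
      using sz_pos_iff[OF per(2)] assms(2) by simp
    have sz: "sz {n. c - n \<in> - Y'} + sz Y' = p"
      using sz_reflect[of "- Y'" c] per(1) sz_Compl[of Y'] by simp
    have "0 < sz {n. c - n \<in> - Y'}"
      using sz *(2,3) assms(5) \<open>0 < sz Z\<close> by linarith
    then have "{n. c - n \<in> - Y'} \<noteq> {}"
      by (metis less_irrefl sz_empty)
    then obtain d where d: "\<not> int p dvd d" "exits {n. c - n \<in> - Y'} d \<le> 1"
      using few_exits_critical[OF *(5)] * sz assms(6) by auto
    then have "exits Y' d \<le> 1"
      using exits_reflect[of "- Y'" c d] exits_Compl per(1) by simp
    moreover have "4 \<le> sz Y'"
      using *(2,3) assms(6) by linarith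
    moreover have "sum_free Y' X' Z" "X' \<noteq> {}"
      using * sum_free_commute sz_empty by fastforce+
    ultimately have "exits Z d + (sz Y' + sz X' + sz Z) \<le> exits Y' d + p + 1"
      using assms(2) by (intro exits_step) auto
    then have "exits Z d \<le> 2"
      using \<open>exits Y' d \<le> 1\<close> * assms(5) by linarith
    then show ?thesis
      using d(1) by blast
  qed
qed

end

section \<open>Directions with few exits\<close>

text \<open>The number of points that stay in the union of the arcs \<open>[0, L1)\<close> and \<open>[s, s + L2)\<close> of
  \<open>Z_p\<close> under translation by \<open>l\<close>; the last summand counts the points that wrap around.\<close>

definition arcs_stay :: "int \<Rightarrow> int \<Rightarrow> int \<Rightarrow> int \<Rightarrow> int \<Rightarrow> int" where
  "arcs_stay p L1 L2 s l = max 0 (L1 - l) + max 0 (L2 - l)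
     + max 0 (min L1 (s + L2 - l) - max 0 (s - l))
     + max 0 (min (s + L2) (p + L1 - l) - max s (p - l))"

text \<open>The lengths left out really occur: an interval loses two points under 2, and if
  \<open>2 * l = p - 1\<close>, then 0, l, -1, l - 1, -2 form two arcs that lose one point under
  \<open>l\<close>.\<close>

lemma arcs_stay_small:
  fixes p L1 L2 s l :: int
  assumes "0 < L1" "L1 \<le> s" "0 \<le> L2" "s + L2 < p" "5 \<le> L1 + L2" "2 * (L1 + L2) < p"
    and "3 \<le> l" "2 * l + 3 \<le> p"
  shows "arcs_stay p L1 L2 s l + 2 < L1 + L2"
  unfolding arcs_stay_def using assms by (smt (verit))

text \<open>One further length besides 1 is always possible for suitable arcs, so only a second one
  can be excluded. The bound 9 rules out 7, where the complement of {0, 1, 3} keeps two points under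
  every translation.\<close>

lemma arcs_stay_four:
  fixes p L1 L2 s l m :: int
  assumes "0 < L1" "L1 \<le> s" "0 \<le> L2" "s + L2 < p" "L1 + L2 = 4" "9 \<le> p"
    and "1 < l" "2 * l < p" "l < m" "2 * m < p"
  shows "arcs_stay p L1 L2 s l < 2 \<or> arcs_stay p L1 L2 s m < 2"
  unfolding arcs_stay_def using assms by (smt (verit))

section \<open>Unions of two arcs\<close>

context prime_modulus
begin

text \<open>A standard position for sets with at most two exits under 1: one arc starts at 0 and
  \<open>p - 1\<close> is outside, so that no arc crosses the origin. \<open>L2 = 0\<close> is the
  case of a single arc.\<close>

definition arcs :: "int set \<Rightarrow> int \<Rightarrow> int \<Rightarrow> int \<Rightarrow> bool" where
  "arcs V L1 L2 s \<longleftrightarrow> 0 < L1 \<and> L1 \<le> s \<and> 0 \<le> L2 \<and> s + L2 < int p \<and>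
     (\<forall>x. 0 \<le> x \<longrightarrow> x < int p \<longrightarrow> (x \<in> V \<longleftrightarrow> x < L1 \<or> s \<le> x \<and> x < s + L2))"

lemma exit_between:
  assumes "x \<in> V" "x + int n \<notin> V"
  shows "\<exists>y. x \<le> y \<and> y < x + int n \<and> y \<in> V \<and> y + 1 \<notin> V"
  using assms(2)
proof (induction n)
  case (Suc n)
  show ?case
  proof (cases "x + int n \<in> V")
    case True
    then show ?thesis
      using Suc.prems by (intro exI[of _ "x + int n"]) (auto simp: algebra_simps)
  next
    case False
    then show ?thesis
      using Suc.IH by force
  qed
qed (use assms(1) in simp)

text \<open>Exits under 1 are the ends of maximal runs of consecutive residues, so two exits allow
  at most two runs.\<close>

lemma arcs_exist:
  assumes W: "periodic W" "W \<noteq> {}" "W \<noteq> UNIV" and e: "exits W 1 \<le> 2"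
  obtains c L1 L2 s where "arcs {x. x + c \<in> W} L1 L2 s"
proof -
  have "\<not> int p dvd - 1"
    using not_p_dvd_1 by simp
  \<comment> \<open>A point whose predecessor is outside \<open>W\<close>. Taken as the origin it
    starts a run and leaves \<open>p - 1\<close> outside.\<close>
  then obtain c where c: "c \<in> W" "c + - 1 \<notin> W"
    using invariant_shift_trivial[OF W(1), of "- 1"] W by blast
  define V where "V = {x. x + c \<in> W}"
  have perV: "periodic V"
    using W by (simp add: V_def)
  have V0: "0 \<in> V"
    using c by (simp add: V_def)
  have Vp: "int p - 1 \<notin> V"
  proof -
    have "- 1 \<notin> V" using c by (simp add: V_def)
    then show ?thesis
      using periodicD_dvd[OF perV, of "int p - 1" "- 1"] by simp
  qed
  have eV: "exits V 1 \<le> 2"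
    using exits_shift[OF W(1)] e by (simp add: V_def)
  define l where "l = (LEAST n. int n \<notin> V)"
  have Vp': "int (p - 1) \<notin> V"
    using Vp p_ge_2 by (simp add: of_nat_diff)
  have l: "int l \<notin> V" "l \<le> p - 1" "\<And>n. n < l \<Longrightarrow> int n \<in> V"
    unfolding l_def using LeastI[of "\<lambda>n. int n \<notin> V" "p - 1"] Least_le[of "\<lambda>n. int n \<notin> V" "p - 1"]
      not_less_Least[of _ "\<lambda>n. int n \<notin> V"] Vp' by blast+
  have l0: "0 < l"
    using l(1) V0 by (cases l) auto
  show thesis
  proof (cases "\<exists>n\<ge>l. n < p \<and> int n \<in> V")
    case False
    have "x \<in> V \<longleftrightarrow> x < int l" if "0 \<le> x" "x < int p" for x
    proof -
      define n where "n = nat x"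
      have n: "x = int n" using that by (simp add: n_def)
      show ?thesis
        using False l(3)[of n] that(2) unfolding n by (meson linorder_not_less of_nat_less_iff)
    qed
    moreover have "int l < int p"
      using l(2) p_ge_2 by linarith
    ultimately have "arcs V (int l) 0 (int l)"
      using l0 by (auto simp: arcs_def)
    then show thesis using that by (simp add: V_def)
  next
    case True
    define s where "s = (LEAST n. l \<le> n \<and> int n \<in> V)"
    have "l \<le> s \<and> int s \<in> V"
      unfolding s_def using True LeastI[of "\<lambda>n. l \<le> n \<and> int n \<in> V"] by blast
    then have s: "l \<le> s" "int s \<in> V" "\<And>n. n < s \<Longrightarrow> l \<le> n \<Longrightarrow> int n \<notin> V"
      unfolding s_def using not_less_Least[of _ "\<lambda>n. l \<le> n \<and> int n \<in> V"] by blast+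
    have sp: "s < p - 1"
    proof -
      obtain n where "l \<le> n" "n < p" "int n \<in> V" using True by blast
      then have "s \<le> n" unfolding s_def by (auto intro: Least_le)
      then show ?thesis
        using \<open>n < p\<close> s(2) Vp' by (cases "s = p - 1") auto
    qed
    define e where "e = (LEAST n. s \<le> n \<and> int n \<notin> V)"
    have "s \<le> p - 1 \<and> int (p - 1) \<notin> V"
      using sp Vp' by simp
    then have "s \<le> e \<and> int e \<notin> V" and ep: "e \<le> p - 1"
      unfolding e_def by (rule LeastI, rule Least_le)
    then have e: "s \<le> e" "int e \<notin> V" "\<And>n. n < e \<Longrightarrow> s \<le> n \<Longrightarrow> int n \<in> V"
      unfolding e_def using not_less_Least[of _ "\<lambda>n. s \<le> n \<and> int n \<notin> V"] by blast+
    have se: "s < e" using e s(2) by (cases "s = e") auto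
    have ls: "l < s" using l(1) s(1,2) by (cases "l = s") auto
    \<comment> \<open>A point beyond the second run would lead to a third exit before
      \<open>p - 1\<close>, besides the ends \<open>l - 1\<close> and \<open>e - 1\<close>.\<close>
    have out: "int u \<notin> V" if "e \<le> u" "u < p" for u
    proof
      assume u: "int u \<in> V"
      have "int u + int (p - 1 - u) \<notin> V"
        using Vp' that by (simp add: of_nat_diff)
      then obtain y where y: "int u \<le> y" "y < int u + int (p - 1 - u)" "y \<in> V" "y + 1 \<notin> V"
        using exit_between[OF u] by blast
      have "int (l - 1) \<in> V" "int (e - 1) \<in> V"
        using l(3)[of "l - 1"] l0 e(3)[of "e - 1"] se by linarith+
      moreover have "int (l - 1) + 1 = int l" "int (e - 1) + 1 = int e"
        using l0 se by auto
      ultimately have sub: "{int (l - 1), int (e - 1), y} \<subseteq> {x \<in> V. x + 1 \<notin> V}"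
        using l(1) e(2) y by auto
      have "card {int (l - 1), int (e - 1), y} = 3"
        using l0 se ls that y(1) by auto
      moreover have "card {int (l - 1), int (e - 1), y} \<le> exits V 1"
        unfolding exits_def
      proof (rule sz_ge_card[OF _ _ sub])
        fix a b assume "a \<in> {int (l - 1), int (e - 1), y}" "b \<in> {int (l - 1), int (e - 1), y}"
        then have "0 \<le> a" "a < int p" "0 \<le> b" "b < int p"
          using l(2) ep y that p_ge_2 by auto
        moreover assume "[a = b] (mod int p)"
        ultimately show "a = b"
          using cong_less_imp_eq_int by blast
      qed (use perV in auto)
      ultimately show False
        using eV by simp
    qed
    have "x \<in> V \<longleftrightarrow> x < int l \<or> int s \<le> x \<and> x < int s + int (e - s)" if "0 \<le> x" "x < int p" for x
    proof -
      define n where "n = nat x"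
      have n: "x = int n" using that by (simp add: n_def)
      have "n < l \<or> l \<le> n \<and> n < s \<or> s \<le> n \<and> n < e \<or> e \<le> n"
        by linarith
      then show ?thesis
        using l(3)[of n] s(3)[of n] e(3)[of n] out[of n] that n se ls by auto
    qed
    moreover have "int s + int (e - s) < int p"
      using se ep p_ge_2 by linarith
    ultimately have "arcs V (int l) (int (e - s)) (int s)"
      using l0 s(1) by (auto simp: arcs_def)
    then show thesis using that by (simp add: V_def)
  qed
qed

lemma arcs_sz:
  assumes "arcs V L1 L2 s"
  shows "int (sz V) = L1 + L2"
proof -
  have "V \<inter> {0..<int p} = {0..<L1} \<union> {s..<s + L2}"
    using assms unfolding arcs_def by auto
  moreover have "{0..<L1} \<inter> {s..<s + L2} = {}"
    using assms by (auto simp: arcs_def)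
  ultimately show ?thesis
    using assms by (simp add: sz_def card_Un_disjoint arcs_def)
qed

lemma card_interval: "int (card {a..<b::int}) = max 0 (b - a)"
  by (simp add: max_def)

text \<open>The hypotheses \<open>small\<close> stop an arc from reaching itself around the circle.
  What remains are the overlaps of each arc with itself, of the first with the second, and of the
  second with the first across \<open>p\<close>.\<close>

lemma arcs_stay_bound:
  assumes V: "periodic V" and arcs: "arcs V L1 L2 s" and l: "0 < l" "l < int p"
    and small: "L1 + l \<le> int p" "L2 + l \<le> int p"
  shows "int (sz {x \<in> V. x + l \<in> V}) \<le> arcs_stay (int p) L1 L2 s l"
proof -
  have bounds: "0 < L1" "L1 \<le> s" "0 \<le> L2" "s + L2 < int p"
    and mem: "\<And>x. 0 \<le> x \<Longrightarrow> x < int p \<Longrightarrow> x \<in> V \<longleftrightarrow> x < L1 \<or> s \<le> x \<and> x < s + L2"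
    using arcs by (auto simp: arcs_def)
  let ?A = "{0..<L1 - l}" and ?B = "{s..<s + L2 - l}"
  let ?C = "{max 0 (s - l)..<min L1 (s + L2 - l)}"
  let ?D = "{max s (int p - l)..<min (s + L2) (int p + L1 - l)}"
  have "{x \<in> V. x + l \<in> V} \<inter> {0..<int p} \<subseteq> ?A \<union> ?B \<union> ?C \<union> ?D"
  proof
    fix x assume x: "x \<in> {x \<in> V. x + l \<in> V} \<inter> {0..<int p}"
    then have 1: "x < L1 \<or> s \<le> x \<and> x < s + L2" "0 \<le> x" "x < int p"
      using mem by auto
    show "x \<in> ?A \<union> ?B \<union> ?C \<union> ?D"
    proof (cases "x + l < int p")
      case True
      then have "x + l < L1 \<or> s \<le> x + l \<and> x + l < s + L2"
        using mem[of "x + l"] x l by auto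
      then show ?thesis
        using 1 bounds l by auto
    next
      case False
      have "x + l - int p \<in> V"
        using x periodicD_dvd[OF V, of "x + l" "x + l - int p"] by auto
      then have "x + l - int p < L1 \<or> s \<le> x + l - int p \<and> x + l - int p < s + L2"
        using mem[of "x + l - int p"] False 1 l by auto
      then show ?thesis
        using 1 bounds l small False by auto
    qed
  qed
  then have "card ({x \<in> V. x + l \<in> V} \<inter> {0..<int p}) \<le> card (?A \<union> ?B \<union> ?C \<union> ?D)"
    by (intro card_mono) auto
  also have "\<dots> \<le> card ?A + card ?B + card ?C + card ?D"
    by (meson card_Un_le add_le_mono1 le_trans order_refl)
  finally have "int (sz {x \<in> V. x + l \<in> V}) \<le>
      int (card ?A) + int (card ?B) + int (card ?C) + int (card ?D)"
    unfolding sz_def by linarith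
  moreover have "L1 - l - 0 = L1 - l" "s + L2 - l - s = L2 - l"
    by simp_all
  ultimately show ?thesis
    unfolding card_interval arcs_stay_def by (simp only:)
qed

text \<open>Exits do not distinguish \<open>e\<close> from \<open>- e\<close>, so the ratio of
  \<open>e\<close> to \<open>d\<close> can be taken in the lower half of the residues, where
  \<open>arcs_stay\<close> is estimated.\<close>

lemma small_representative:
  assumes "odd p" "\<not> int p dvd d" "\<not> int p dvd e"
  obtains l where "0 < l" "2 * l < int p" "int p dvd d * l - e \<or> int p dvd d * l + e"
proof -
  obtain n where n: "[d * n = 1] (mod int p)"
    using unit_inverse assms(2) .
  define r where "r = (n * e) mod int p"
  have r: "0 \<le> r" "r < int p"
    using p_ge_2 by (simp_all add: r_def)
  have "[d * r = d * (n * e)] (mod int p)"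
    by (intro cong_mult cong_refl) (simp add: r_def)
  moreover have "[d * (n * e) = e] (mod int p)"
    using cong_scalar_right[OF n, of e] by (simp add: algebra_simps)
  ultimately have dr: "int p dvd d * r - e"
    by (metis cong_iff_dvd_diff cong_trans)
  have "r \<noteq> 0"
    using dr assms(3) by auto
  have "2 * r \<noteq> int p"
    using assms(1) by (metis dvd_triv_left even_of_nat_iff)
  show thesis
  proof (cases "2 * r < int p")
    case True
    then show thesis
      using that[of r] r dr \<open>r \<noteq> 0\<close> by auto
  next
    case False
    have "d * (int p - r) + e = int p * d - (d * r - e)"
      by (simp add: algebra_simps)
    then have "int p dvd d * (int p - r) + e"
      using dr by (metis dvd_diff dvd_triv_left)
    then show thesis
      using that[of "int p - r"] r False \<open>2 * r \<noteq> int p\<close> by auto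
  qed
qed

lemma exits_representative:
  assumes "periodic W" "int p dvd d * l - e \<or> int p dvd d * l + e" "\<not> int p dvd d"
  shows "exits {x. d * x \<in> W} l = exits W e"
proof -
  have "exits W (d * l) = exits W e"
  proof (cases "int p dvd d * l - e")
    case True
    then show ?thesis
      using exits_cong[OF assms(1)] by (simp add: cong_iff_dvd_diff)
  next
    case False
    then have "[d * l = - e] (mod int p)"
      using assms(2) by (simp add: cong_iff_dvd_diff)
    then show ?thesis
      using exits_cong[OF assms(1)] exits_uminus[OF assms(1)] by metis
  qed
  then show ?thesis
    using exits_mult[OF assms(1,3)] by simp
qed

text \<open>Division by \<open>d\<close> turns \<open>d\<close> into the direction 1 and any other
  direction \<open>e\<close> into the length \<open>l\<close> with
  \<open>d * l = \<plusminus> e\<close>.\<close>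

lemma arcs_of_direction:
  assumes "periodic W" "0 < sz W" "sz W < p" "\<not> int p dvd d" "exits W d \<le> 2"
  shows "\<exists>V L1 L2 s. periodic V \<and> arcs V L1 L2 s \<and> sz V = sz W \<and>
    (\<forall>e l. int p dvd d * l - e \<or> int p dvd d * l + e \<longrightarrow> exits V l = exits W e)"
proof -
  let ?U = "{x. d * x \<in> W}"
  have U: "periodic ?U" "sz ?U = sz W"
    using assms sz_mult by auto
  have "exits ?U 1 \<le> 2"
    using exits_representative[OF assms(1), of d 1 d] assms by simp
  moreover have "?U \<noteq> {}" "?U \<noteq> UNIV"
    using U(2) assms(2,3) by (metis sz_empty less_irrefl, metis sz_UNIV less_irrefl)
  ultimately obtain c L1 L2 s where "arcs {x. x + c \<in> ?U} L1 L2 s"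
    using arcs_exist[OF U(1)] by blast
  moreover have "exits {x. x + c \<in> ?U} l = exits W e"
    if "int p dvd d * l - e \<or> int p dvd d * l + e" for e l
    using exits_shift[OF U(1)] exits_representative[OF assms(1) that assms(4)] by simp
  ultimately show ?thesis
    using periodic_shift[OF U(1), of c] U(2) sz_shift[OF U(1), of c] by metis
qed

lemma direction_ratio_half:
  assumes W: "periodic W" "5 \<le> sz W" "2 * sz W < p" and "odd p"
    and d: "\<not> int p dvd d" "exits W d \<le> 2" and e: "\<not> int p dvd e" "exits W e \<le> 2"
  shows "int p dvd d - e \<or> int p dvd d + e \<or> int p dvd 2 * d - e \<or> int p dvd 2 * d + e \<or>
    int p dvd d - 2 * e \<or> int p dvd d + 2 * e"
proof -
  have szW: "0 < sz W" "sz W < p"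
    using W by linarith+
  obtain V L1 L2 s where V: "periodic V" "arcs V L1 L2 s" "sz V = sz W"
    "\<forall>e l. int p dvd d * l - e \<or> int p dvd d * l + e \<longrightarrow> exits V l = exits W e"
    using arcs_of_direction[OF W(1) szW d] by blast
  obtain l where l: "0 < l" "2 * l < int p" "int p dvd d * l - e \<or> int p dvd d * l + e"
    using small_representative[OF \<open>odd p\<close> d(1) e(1)] .
  have sz: "int (sz W) = L1 + L2"
    using arcs_sz[OF V(2)] V(3) by simp
  have b: "0 < L1" "L1 \<le> s" "0 \<le> L2" "s + L2 < int p"
    using V(2) by (auto simp: arcs_def)
  have "exits V l \<le> 2"
    using V(4)[rule_format, OF l(3)] e(2) by simp
  then have "int (sz V) \<le> int (sz {x \<in> V. x + l \<in> V}) + 2"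
    using sz_stay[of V l] by linarith
  moreover have "int (sz {x \<in> V. x + l \<in> V}) \<le> arcs_stay (int p) L1 L2 s l"
    using V(1,2) l sz W(3) b by (intro arcs_stay_bound) linarith+
  ultimately have stay: "L1 + L2 \<le> arcs_stay (int p) L1 L2 s l + 2"
    using sz V(3) by linarith
  have "5 \<le> L1 + L2" "2 * (L1 + L2) < int p"
    unfolding sz[symmetric] using W(2,3) by auto
  from arcs_stay_small[OF b this, of l] have "\<not> (3 \<le> l \<and> 2 * l + 3 \<le> int p)"
    using stay by auto
  moreover have "2 * l + 2 \<noteq> int p"
    using \<open>odd p\<close> by (metis even_of_nat_iff dvd_add dvd_triv_left dvd_refl)
  \<comment> \<open>The lengths mean \<open>e = \<plusminus> d\<close>,
    \<open>e = \<plusminus> 2 * d\<close> and \<open>d = \<plusminus> 2 * e\<close>; the last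
    because \<open>2 * l\<close> is \<open>- 1\<close> modulo \<open>p\<close>.\<close>
  ultimately consider "l = 1" | "l = 2" | "2 * l = int p - 1"
    using l by linarith
  then show ?thesis
  proof cases
    case 3
    have "d + 2 * e = int p * d - 2 * (d * l - e)" "d - 2 * e = int p * d - 2 * (d * l + e)"
      using arg_cong[OF 3, of "\<lambda>x. d * x"] by (simp_all add: algebra_simps)
    then have "int p dvd d + 2 * e \<or> int p dvd d - 2 * e"
      using l(3) by (metis dvd_diff dvd_mult dvd_triv_left)
    then show ?thesis by blast
  qed (use l(3) in \<open>auto simp: mult.commute\<close>)
qed

text \<open>One of \<open>W\<close> and its complement is less than half of the residues, and both
  have the same exits.\<close>

lemma direction_ratio:
  assumes W: "periodic W" "5 \<le> sz W" "sz W + 5 \<le> p"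
    and d: "\<not> int p dvd d" "exits W d \<le> 2" and e: "\<not> int p dvd e" "exits W e \<le> 2"
  shows "int p dvd d - e \<or> int p dvd d + e \<or> int p dvd 2 * d - e \<or> int p dvd 2 * d + e \<or>
    int p dvd d - 2 * e \<or> int p dvd d + 2 * e"
proof -
  have "odd p"
    using prime W prime_odd_nat by auto
  then have "2 * sz W \<noteq> p"
    by (metis dvd_triv_left)
  then consider "2 * sz W < p" | "2 * sz (- W) < p"
    using sz_Compl[of W] by linarith
  then show ?thesis
  proof cases
    case 1
    then show ?thesis
      using direction_ratio_half W d e \<open>odd p\<close> by blast
  next
    case 2
    then show ?thesis
      using direction_ratio_half[of "- W" d e] W d e \<open>odd p\<close> sz_Compl[of W] exits_Compl by simp
  qed
qed

text \<open>Three directions that differ up to sign would become 1 and two further lengths after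
  rescaling, which \<open>arcs_stay_four\<close> excludes.\<close>

lemma directions_four_aux:
  assumes W: "periodic W" "sz W = 4" "9 \<le> p" and "odd p"
    and d: "\<not> int p dvd d" "exits W d \<le> 2" and e: "\<not> int p dvd e" "exits W e \<le> 2"
    and f: "\<not> int p dvd f" "exits W f \<le> 2"
  shows "int p dvd d - e \<or> int p dvd d + e \<or> int p dvd d - f \<or> int p dvd d + f \<or>
    int p dvd e - f \<or> int p dvd e + f"
proof -
  have szW: "0 < sz W" "sz W < p"
    using W by linarith+
  obtain V L1 L2 s where V: "periodic V" "arcs V L1 L2 s" "sz V = sz W"
    "\<forall>e l. int p dvd d * l - e \<or> int p dvd d * l + e \<longrightarrow> exits V l = exits W e"
    using arcs_of_direction[OF W(1) szW d] by blast
  obtain l where l: "0 < l" "2 * l < int p" "int p dvd d * l - e \<or> int p dvd d * l + e"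
    using small_representative[OF \<open>odd p\<close> d(1) e(1)] .
  obtain m where m: "0 < m" "2 * m < int p" "int p dvd d * m - f \<or> int p dvd d * m + f"
    using small_representative[OF \<open>odd p\<close> d(1) f(1)] .
  have sz: "L1 + L2 = 4"
    using arcs_sz[OF V(2)] V(3) W(2) by simp
  have b: "0 < L1" "L1 \<le> s" "0 \<le> L2" "s + L2 < int p"
    using V(2) by (auto simp: arcs_def)
  have stay: "2 \<le> arcs_stay (int p) L1 L2 s k"
    if k: "0 < k" "2 * k < int p" "exits V k \<le> 2" for k
  proof -
    have "2 \<le> int (sz {x \<in> V. x + k \<in> V})"
      using sz_stay[of V k] k(3) V(3) W(2) by linarith
    moreover have "int (sz {x \<in> V. x + k \<in> V}) \<le> arcs_stay (int p) L1 L2 s k"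
      using V(1,2) k sz W(3) b by (intro arcs_stay_bound) linarith+
    ultimately show ?thesis by linarith
  qed
  have 1: "2 \<le> arcs_stay (int p) L1 L2 s l" "2 \<le> arcs_stay (int p) L1 L2 s m"
    using stay[OF l(1,2)] stay[OF m(1,2)] V(4)[rule_format, OF l(3)] V(4)[rule_format, OF m(3)] e(2) f(2) by simp_all
  have "9 \<le> int p" using W(3) by simp
  then have "\<not> (1 < l \<and> l < m)" "\<not> (1 < m \<and> m < l)"
    using 1 arcs_stay_four[OF b sz, of l m] arcs_stay_four[OF b sz, of m l] l(1,2) m(1,2) by auto
  then consider "l = 1" | "m = 1" | "l = m"
    using l(1) m(1) by linarith
  then show ?thesis
  proof cases
    case 3
    have "int p dvd e - f \<or> int p dvd e + f"
      using l(3) m(3) unfolding 3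
    proof (elim disjE)
      assume "int p dvd d * m - e" "int p dvd d * m - f"
      from dvd_diff[OF this(2,1)] show ?thesis by simp
    next
      assume "int p dvd d * m - e" "int p dvd d * m + f"
      from dvd_diff[OF this(2,1)] show ?thesis by (simp add: add.commute)
    next
      assume "int p dvd d * m + e" "int p dvd d * m - f"
      from dvd_diff[OF this] show ?thesis by simp
    next
      assume "int p dvd d * m + e" "int p dvd d * m + f"
      from dvd_diff[OF this] show ?thesis by simp
    qed
    then show ?thesis by blast
  qed (use l(3) m(3) in auto)
qed

lemma directions_four:
  assumes W: "periodic W" "sz W = 4 \<or> sz W + 4 = p" "9 \<le> p"
    and d: "\<not> int p dvd d" "exits W d \<le> 2" and e: "\<not> int p dvd e" "exits W e \<le> 2"
    and f: "\<not> int p dvd f" "exits W f \<le> 2"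
  shows "int p dvd d - e \<or> int p dvd d + e \<or> int p dvd d - f \<or> int p dvd d + f \<or>
    int p dvd e - f \<or> int p dvd e + f"
proof -
  have "odd p"
    using prime W prime_odd_nat by auto
  show ?thesis
  proof (cases "sz W = 4")
    case True
    then show ?thesis
      using directions_four_aux W d e f \<open>odd p\<close> by blast
  next
    case False
    then show ?thesis
      using directions_four_aux[of "- W" d e f] W d e f \<open>odd p\<close> sz_Compl[of W] exits_Compl by simp
  qed
qed

end

section \<open>Colorings without rainbow solutions\<close>

definition perm3 :: "nat \<Rightarrow> nat \<Rightarrow> nat \<Rightarrow> bool" where
  "perm3 i j k \<longleftrightarrow> {i, j, k} = {0, 1, 2}"

lemma perm3_cases:
  "perm3 i j k \<longleftrightarrow> (i, j, k) \<in> {(0, 1, 2), (0, 2, 1), (1, 0, 2), (1, 2, 0), (2, 0, 1), (2, 1, 0)}"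
  (is "_ \<longleftrightarrow> ?R")
proof
  assume "perm3 i j k"
  then have *: "{i, j, k} = {0, 1, 2}"
    by (simp add: perm3_def)
  have "i \<in> {0, 1, 2}" "j \<in> {0, 1, 2}" "k \<in> {0, 1, 2}"
    unfolding *[symmetric] by simp_all
  moreover have "card {i, j, k} = 3"
    unfolding * by simp
  then have "i \<noteq> j \<and> i \<noteq> k \<and> j \<noteq> k"
    by (cases "i = j"; cases "i = k"; cases "j = k") (simp_all add: card_insert_if)
  ultimately show ?R
    by (elim insertE emptyE) simp_all
qed (auto simp: perm3_def)

lemma perm3D:
  assumes "perm3 i j k"
  shows "i < 3" "j < 3" "k < 3" "perm3 j i k" "perm3 i k j" "perm3 k j i" "perm3 j k i" "perm3 k i j"
  using assms by (auto simp: perm3_cases)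

lemma perm3_third:
  assumes "i < 3" "j < 3" "i \<noteq> j"
  obtains k where "perm3 i j k"
proof -
  have "i \<in> {0, 1, 2}" "j \<in> {0, 1, 2}"
    using assms by auto
  then have "\<exists>k \<in> {0, 1, 2}. perm3 i j k"
    using assms(3) by (auto simp: perm3_cases)
  then show thesis
    using that by blast
qed

locale linear_equation = prime_modulus +
  fixes a :: "nat \<Rightarrow> int" and b :: int
  assumes unit: "i < 3 \<Longrightarrow> \<not> int p dvd a i"
begin

definition recip :: "nat \<Rightarrow> int" where
  "recip i = (SOME n. [a i * n = 1] (mod int p))"

text \<open>\<open>scaled i c W\<close> is the set \<open>a i * W - c\<close>.\<close>

definition scaled :: "nat \<Rightarrow> int \<Rightarrow> int set \<Rightarrow> int set" where
  "scaled i c W = {x. recip i * x + recip i * c \<in> W}"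

definition rainbow_free :: "int set \<Rightarrow> int set \<Rightarrow> int set \<Rightarrow> bool" where
  "rainbow_free A B C \<longleftrightarrow> (\<forall>i j k. perm3 i j k \<longrightarrow>
     (\<forall>x\<in>A. \<forall>y\<in>B. \<forall>z\<in>C. \<not> [a i * x + a j * y + a k * z = b] (mod int p)))"

definition free_coloring :: "int set \<Rightarrow> int set \<Rightarrow> int set \<Rightarrow> bool" where
  "free_coloring A B C \<longleftrightarrow> rainbow_free A B C \<and> periodic A \<and> periodic B \<and> periodic C \<and>
     A \<noteq> {} \<and> B \<noteq> {} \<and> C \<noteq> {} \<and> A \<inter> B = {} \<and> A \<inter> C = {} \<and> B \<inter> C = {} \<and> A \<union> B \<union> C = UNIV"

text \<open>Up to the common factor \<open>a 0 * a 1 * a 2\<close>, the ratio of \<open>a i\<close> to \<open>a j\<close> is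
  \<open>(a i)\<^sup>2 * a k\<close>, where \<open>k\<close> is the third index; this avoids inverses.\<close>

definition directed_by :: "int set \<Rightarrow> int \<Rightarrow> bool" where
  "directed_by C d \<longleftrightarrow> \<not> int p dvd d \<and>
     (\<forall>i j k. perm3 i j k \<longrightarrow> exits C ((a i)\<^sup>2 * a k * d) \<le> 2)"

section \<open>Dilated classes and the transfer of directions between them\<close>

lemma recip: "i < 3 \<Longrightarrow> [a i * recip i = 1] (mod int p)"
  unfolding recip_def by (rule someI_ex) (meson unit unit_inverse)

lemma recip_unit: "i < 3 \<Longrightarrow> \<not> int p dvd recip i"
  using recip[of i] not_p_dvd_1 by (meson cong_dvd_iff dvd_mult)

lemma mult_unit: "\<not> int p dvd x \<Longrightarrow> \<not> int p dvd y \<Longrightarrow> \<not> int p dvd x * y"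
  using prime_int by (simp add: prime_dvd_mult_iff)

lemma periodic_scaled [simp]: "periodic W \<Longrightarrow> periodic (scaled i c W)"
  by (simp add: scaled_def)

lemma sz_scaled [simp]: "periodic W \<Longrightarrow> i < 3 \<Longrightarrow> sz (scaled i c W) = sz W"
  unfolding scaled_def by (simp add: sz_affine recip_unit)

lemma exits_scaled:
  assumes "periodic W" "i < 3"
  shows "exits (scaled i c W) d = exits W (recip i * d)"
proof -
  have "scaled i c W = {x. recip i * x \<in> {x. x + recip i * c \<in> W}}"
    by (simp add: scaled_def)
  then show ?thesis
    using assms exits_mult[of "{x. x + recip i * c \<in> W}" "recip i" d] recip_unit exits_shift[OF assms(1)]
    by simp
qed

lemma exits_scaled_mult:
  assumes "periodic W" "i < 3"
  shows "exits (scaled i c W) (a i * d) = exits W d"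
proof -
  have "[recip i * (a i * d) = d] (mod int p)"
    using cong_scalar_right[OF recip[OF assms(2)], of d] by (simp add: algebra_simps)
  then show ?thesis
    using exits_scaled[OF assms] exits_cong[OF assms(1)] by simp
qed

lemma rainbow_free_swap: "rainbow_free A B C \<Longrightarrow> rainbow_free B A C"
  unfolding rainbow_free_def by (metis perm3D(4) add.commute)

lemma rainbow_free_swap': "rainbow_free A B C \<Longrightarrow> rainbow_free A C B"
  unfolding rainbow_free_def by (metis perm3D(5) add.commute add.left_commute)

lemma free_coloring_swap: "free_coloring A B C \<Longrightarrow> free_coloring B A C"
  unfolding free_coloring_def by (metis Un_commute Int_commute rainbow_free_swap)

lemma free_coloring_swap': "free_coloring A B C \<Longrightarrow> free_coloring A C B"
  unfolding free_coloring_def by (metis Un_commute Un_assoc Int_commute rainbow_free_swap')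

lemma free_coloring_sz:
  assumes "free_coloring A B C"
  shows "sz A + sz B + sz C = p"
proof -
  have "(A \<union> B) \<inter> C = {}" "A \<inter> B = {}" "A \<union> B \<union> C = UNIV"
    using assms unfolding free_coloring_def by blast+
  then show ?thesis
    by (metis sz_disjoint sz_UNIV)
qed

text \<open>Subtracting \<open>b\<close> in the third set alone makes the equation homogeneous, as
  \<open>sum_free\<close> requires.\<close>

lemma free_coloring_sum_free:
  assumes "free_coloring A B C" "perm3 i j k"
  shows "sum_free (scaled i 0 A) (scaled j 0 B) (scaled k b C)"
  unfolding sum_free_def
proof (intro conjI ballI)
  fix x y z assume *: "x \<in> scaled i 0 A" "y \<in> scaled j 0 B" "z \<in> scaled k b C"
  have inv: "[a l * (recip l * t) = t] (mod int p)" if "l < 3" for l t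
    using cong_scalar_right[OF recip[OF that], of t] by (simp add: algebra_simps)
  have "[a i * (recip i * x) + a j * (recip j * y) + a k * (recip k * (z + b)) = x + y + (z + b)] (mod int p)"
    using perm3D[OF assms(2)] by (intro cong_add inv)
  moreover have "\<not> [a i * (recip i * x) + a j * (recip j * y) + a k * (recip k * (z + b)) = b] (mod int p)"
  proof -
    have "recip i * x \<in> A" "recip j * y \<in> B" "recip k * (z + b) \<in> C"
      using * by (simp_all add: scaled_def distrib_left)
    then show ?thesis
      using assms unfolding free_coloring_def rainbow_free_def by blast
  qed
  ultimately have "x + y + (z + b) \<noteq> b" by metis
  then show "x + y + z \<noteq> 0" by simp
qed (use assms in \<open>auto simp: free_coloring_def\<close>)

lemma perm3_prod: "perm3 i j k \<Longrightarrow> a i * a j * a k = a 0 * a 1 * a 2"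
  by (auto simp: perm3_cases)

lemma directed_byI:
  assumes C: "periodic C" and "\<not> int p dvd d" "[a 0 * a 1 * a 2 * d' = d] (mod int p)"
    and "\<And>i j k. perm3 i j k \<Longrightarrow> exits C (recip j * a i * d) \<le> 2"
  shows "directed_by C d'"
  unfolding directed_by_def
proof (intro conjI allI impI)
  show "\<not> int p dvd d'"
    using assms(2,3) by (meson cong_dvd_iff dvd_mult)
  fix i j k assume *: "perm3 i j k"
  have "[recip j * a i * d = recip j * a i * (a i * a j * a k * d')] (mod int p)"
    using assms(3) perm3_prod[OF *] by (intro cong_mult cong_refl) (simp add: cong_sym)
  also have "recip j * a i * (a i * a j * a k * d') = (a j * recip j) * ((a i)\<^sup>2 * a k * d')"
    by (simp add: power2_eq_square algebra_simps)
  also have "[(a j * recip j) * ((a i)\<^sup>2 * a k * d') = 1 * ((a i)\<^sup>2 * a k * d')] (mod int p)"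
    using perm3D[OF *] by (intro cong_mult cong_refl recip)
  finally show "exits C ((a i)\<^sup>2 * a k * d') \<le> 2"
    using exits_cong[OF C] assms(4)[OF *] by simp
qed

lemma prod_unit: "\<not> int p dvd a 0 * a 1 * a 2"
  using unit by (intro mult_unit) auto

lemma normalize_direction:
  obtains d' where "[a 0 * a 1 * a 2 * d' = d] (mod int p)"
proof -
  obtain n where "[a 0 * a 1 * a 2 * n = 1] (mod int p)"
    using unit_inverse prod_unit by blast
  then have "[a 0 * a 1 * a 2 * (n * d) = d] (mod int p)"
    using cong_scalar_right[of _ 1 "int p" d] by (metis mult.assoc mult_1)
  then show thesis using that by blast
qed

text \<open>\<open>a i * A\<close> has at most one exit in the direction \<open>a i * d\<close>, so
  by slack one \<open>a j * C\<close> has at most two, and division by \<open>a j\<close> produces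
  the ratio. Every ordered pair of indices is available, the third coefficient going to
  \<open>B\<close>.\<close>

lemma directed_of_progression:
  assumes col: "free_coloring A B C" and A: "2 \<le> sz A" "exits A d \<le> 1" and d: "\<not> int p dvd d"
    and d': "[a 0 * a 1 * a 2 * d' = d] (mod int p)"
  shows "directed_by C d'"
proof (rule directed_byI[OF _ d d'])
  show C: "periodic C"
    using col by (simp add: free_coloring_def)
  have per: "periodic A" "periodic B"
    using col by (simp_all add: free_coloring_def)
  fix i j k assume *: "perm3 i j k"
  note lt = perm3D[OF *]
  have free: "sum_free (scaled i 0 A) (scaled k 0 B) (scaled j b C)"
    using free_coloring_sum_free[OF col] lt by blast
  have "0 < sz B" "0 < sz C"
    using col sz_pos_iff unfolding free_coloring_def by blast+
  then have "scaled k 0 B \<noteq> {}" "scaled j b C \<noteq> {}"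
    using sz_scaled per(2) C lt(2,3) by (metis sz_empty less_irrefl)+
  then have "exits (scaled j b C) (a i * d) + (sz A + sz B + sz C) \<le> exits A d + p + 1"
    using exits_step[OF free, of "a i * d"] A exits_scaled_mult[OF per(1) lt(1)] per C lt by simp
  then show "exits C (recip j * a i * d) \<le> 2"
    using A(2) free_coloring_sz[OF col] exits_scaled[OF C lt(2)] by (simp add: mult.assoc)
qed

text \<open>If \<open>B\<close> had three exits, then shrinking \<open>C\<close> and enlarging \<open>B\<close> would produce a critical triple,
  and \<open>A\<close> would be a progression.\<close>

lemma transfer_direction:
  assumes col: "free_coloring A B C" and sz: "2 \<le> sz A" "2 \<le> sz B" "4 \<le> sz C"
    and A: "\<And>d. \<not> int p dvd d \<Longrightarrow> 2 \<le> exits A d"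
    and C2: "exits C t \<le> 2" and perm: "perm3 i j k"
  shows "exits B (recip j * a k * t) \<le> 2"
proof (rule ccontr)
  assume contr: "\<not> ?thesis"
  have per: "periodic A" "periodic B" "periodic C"
    using col by (simp_all add: free_coloring_def)
  note lt = perm3D[OF perm]
  let ?X = "scaled i 0 A" and ?Y = "scaled j 0 B" and ?Z = "scaled k b C" and ?t = "a k * t"
  have free: "sum_free ?Z ?X ?Y"
    using free_coloring_sum_free[OF col perm] sum_free_rotate by blast
  have szs: "sz ?X = sz A" "sz ?Y = sz B" "sz ?Z = sz C"
    using per lt by simp_all
  have ne: "?X \<noteq> {}" "?Y \<noteq> {}"
    using szs sz by auto
  have eZ: "exits ?Z ?t = exits C t"
    using exits_scaled_mult per lt by simp
  have eY: "exits ?Y ?t = exits B (recip j * a k * t)"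
    using exits_scaled[OF per(2) lt(2)] by (simp add: mult.assoc)
  have "exits ?Y ?t + (sz ?Z + sz ?X + sz ?Y) \<le> exits ?Z ?t + p + 1"
    using exits_step[OF free _ ne, of ?t] eZ C2 szs sz by simp
  \<comment> \<open>Slack one permits one exit more than on \<open>C\<close>, so a failure of the
    claim leaves exactly three against two.\<close>
  then have eq: "exits ?Y ?t = 3" "exits ?Z ?t = 2"
    using eZ eY C2 contr szs free_coloring_sz[OF col] by linarith+
  let ?Z' = "{z \<in> ?Z. z + ?t \<in> ?Z}" and ?Y' = "?Y \<union> {y. y - ?t \<in> ?Y}"
  have "sum_free ?Y' ?Z' ?X"
    using sum_free_lattice[OF free] sum_free_rotate by blast
  \<comment> \<open>Two points lost and three gained raise the total size from \<open>p\<close> to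
    the critical \<open>p + 1\<close>.\<close>
  moreover have "sz ?Z' + 2 = sz C" "sz ?Y' = sz B + 3"
    using sz_stay[of ?Z ?t] eq szs sz_Un_shift[of ?Y ?t] per by simp_all
  ultimately obtain d where d: "\<not> int p dvd d" "exits ?X d \<le> 1"
    using few_exits_critical[of ?Y' ?Z' ?X] ne szs sz free_coloring_sz[OF col] by auto
  then have "exits A (recip i * d) \<le> 1"
    using exits_scaled[OF per(1) lt(1)] by simp
  moreover have "\<not> int p dvd recip i * d"
    using d recip_unit lt by (intro mult_unit) auto
  ultimately show False
    using A by fastforce
qed

text \<open>\<open>few_exits\<close> yields a direction of \<open>C\<close> for one assignment of
  the coefficients only. Carrying it to \<open>B\<close> once, and from there back to
  \<open>C\<close> under every assignment, produces all ratios of the same direction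
  \<open>r\<close>.\<close>

lemma directed_of_not_progression:
  assumes col: "free_coloring A B C" and sz: "3 \<le> sz A" "4 \<le> sz B" "4 \<le> sz C"
    and A: "\<And>d. \<not> int p dvd d \<Longrightarrow> 2 \<le> exits A d"
  shows "\<exists>d. directed_by C d"
proof -
  have per: "periodic A" "periodic B" "periodic C"
    using col by (simp_all add: free_coloring_def)
  have perm: "perm3 0 1 2" by (simp add: perm3_def)
  have "scaled 2 b C \<noteq> {}"
    using sz_scaled[OF per(3), of 2 b] sz(3) by auto
  then obtain t where t: "\<not> int p dvd t" "exits (scaled 2 b C) t \<le> 2"
    using few_exits[OF free_coloring_sum_free[OF col perm]] per sz free_coloring_sz[OF col] by auto
  define s where "s = recip 2 * t"
  define r where "r = recip 1 * a 2 * s"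
  have "exits C s \<le> 2"
    using t exits_scaled[OF per(3)] by (simp add: s_def)
  then have B: "exits B r \<le> 2"
    unfolding r_def using sz by (intro transfer_direction[OF col _ _ _ A _ perm]) auto
  have "exits C (recip j * a i * r) \<le> 2" if "perm3 i j k" for i j k
    using sz B perm3D[OF that] by (intro transfer_direction[OF free_coloring_swap'[OF col] _ _ _ A]) auto
  moreover have "\<not> int p dvd r"
    unfolding r_def s_def using t unit recip_unit by (intro mult_unit) auto
  moreover obtain d' where "[a 0 * a 1 * a 2 * d' = r] (mod int p)"
    using normalize_direction .
  ultimately show ?thesis
    using directed_byI[OF per(3)] by blast
qed

section \<open>Ratios of coefficients forced by the directions of the largest class\<close>

lemma numeral_dvd_cancel: "int p dvd c * x \<Longrightarrow> 0 < c \<Longrightarrow> c < int p \<Longrightarrow> int p dvd x"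
  using prime_dvd_multD[OF prime_int] zdvd_not_zless by blast

text \<open>Eliminating \<open>y\<close> leaves 2, 6, 7 or 9 times \<open>x\<close>, and
  \<open>10 \<le> p\<close> makes these factors invertible.\<close>

lemma numeral_combinations:
  assumes "10 \<le> p" "int p dvd 4 * x - y"
    and "int p dvd 2 * x - y \<or> int p dvd 2 * x + y \<or> int p dvd x - 2 * y \<or> int p dvd x + 2 * y"
  shows "int p dvd x"
proof -
  have "int p dvd 2 * x \<or> int p dvd 6 * x \<or> int p dvd 7 * x \<or> int p dvd 9 * x"
    using assms(3)
  proof (elim disjE)
    assume "int p dvd 2 * x - y"
    from dvd_diff[OF assms(2) this] show ?thesis by simp
  next
    assume "int p dvd 2 * x + y"
    from dvd_add[OF assms(2) this] show ?thesis by simp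
  next
    assume "int p dvd x - 2 * y"
    from dvd_diff[OF dvd_mult[OF assms(2), of 2] this] show ?thesis by (simp add: algebra_simps)
  next
    assume "int p dvd x + 2 * y"
    from dvd_add[OF dvd_mult[OF assms(2), of 2] this] show ?thesis by (simp add: algebra_simps)
  qed
  then show ?thesis
    using numeral_dvd_cancel[of _ x] assms(1) by fastforce
qed

text \<open>If the ratio of \<open>u\<close> to \<open>v\<close> were \<plusminus>2 or
  \<plusminus>1/2, its square would be 4 or 1/4 and also one of \<plusminus>1, \<plusminus>2,
  \<plusminus>1/2, which fails for primes above 9. So the ratio or its square is
  \<plusminus>1.\<close>

lemma ratio_and_square:
  fixes u v :: int
  assumes p: "10 \<le> p" and u: "\<not> int p dvd u" "\<not> int p dvd v"
    and 1: "int p dvd u - v \<or> int p dvd u + v \<or> int p dvd 2 * u - v \<or>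
      int p dvd 2 * u + v \<or> int p dvd u - 2 * v \<or> int p dvd u + 2 * v"
    and 2: "int p dvd u\<^sup>2 - v\<^sup>2 \<or> int p dvd u\<^sup>2 + v\<^sup>2 \<or> int p dvd 2 * u\<^sup>2 - v\<^sup>2 \<or>
      int p dvd 2 * u\<^sup>2 + v\<^sup>2 \<or> int p dvd u\<^sup>2 - 2 * v\<^sup>2 \<or> int p dvd u\<^sup>2 + 2 * v\<^sup>2"
  shows "int p dvd u ^ 4 - v ^ 4"
proof (rule ccontr)
  assume contr: "\<not> ?thesis"
  have "u ^ 4 - v ^ 4 = (u - v) * (u + v) * (u\<^sup>2 + v\<^sup>2)" "u\<^sup>2 - v\<^sup>2 = (u - v) * (u + v)"
    by (simp_all add: power2_eq_square power4_eq_xxxx algebra_simps)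
  then have no: "\<not> int p dvd u - v" "\<not> int p dvd u + v" "\<not> int p dvd u\<^sup>2 - v\<^sup>2" "\<not> int p dvd u\<^sup>2 + v\<^sup>2"
    using contr by auto
  have sq: "\<not> int p dvd u\<^sup>2" "\<not> int p dvd v\<^sup>2"
    using u mult_unit by (simp_all add: power2_eq_square)
  have "4 * u\<^sup>2 - v\<^sup>2 = (2 * u - v) * (2 * u + v)" "4 * v\<^sup>2 - u\<^sup>2 = - ((u - 2 * v) * (u + 2 * v))"
    by (simp_all add: power2_eq_square algebra_simps)
  then have "int p dvd 4 * u\<^sup>2 - v\<^sup>2 \<or> int p dvd 4 * v\<^sup>2 - u\<^sup>2"
    using 1 no by auto
  then show False
  proof
    assume "int p dvd 4 * u\<^sup>2 - v\<^sup>2"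
    then show False
      using numeral_combinations[OF p] 2 no sq by blast
  next
    assume *: "int p dvd 4 * v\<^sup>2 - u\<^sup>2"
    have "int p dvd 2 * v\<^sup>2 - u\<^sup>2 \<or> int p dvd 2 * v\<^sup>2 + u\<^sup>2 \<or> int p dvd v\<^sup>2 - 2 * u\<^sup>2 \<or> int p dvd v\<^sup>2 + 2 * u\<^sup>2"
      using 2 no by (metis add.commute dvd_diff_commute)
    then show False
      using numeral_combinations[OF p *] sq by blast
  qed
qed

text \<open>The directions \<open>(a i)\<^sup>2 * a j * d\<close> and
  \<open>(a j)\<^sup>2 * a i * d\<close> have the quotient \<open>a i / a j\<close>; with
  \<open>a k\<close> as the last coefficient of both, the quotient is its square.\<close>

lemma directed_large:
  assumes C: "periodic C" "directed_by C d" and sz: "5 \<le> sz C" "sz C + 5 \<le> p"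
    and ij: "i < 3" "j < 3" "i \<noteq> j"
  shows "int p dvd (a i) ^ 4 - (a j) ^ 4"
proof -
  obtain k where perm: "perm3 i j k"
    using perm3_third ij by blast
  note lt = perm3D[OF perm]
  let ?u = "a i" and ?v = "a j" and ?w = "a k"
  have u: "\<not> int p dvd ?u" "\<not> int p dvd ?v" "\<not> int p dvd ?w" and d: "\<not> int p dvd d"
    using unit lt C(2) by (auto simp: directed_by_def)
  have ex: "exits C (?u\<^sup>2 * ?v * d) \<le> 2" "exits C (?v\<^sup>2 * ?u * d) \<le> 2"
    "exits C (?u\<^sup>2 * ?w * d) \<le> 2" "exits C (?v\<^sup>2 * ?w * d) \<le> 2"
    using C(2) perm lt unfolding directed_by_def by blast+
  have cancel: "int p dvd ?u * ?v * d * x \<longleftrightarrow> int p dvd x" for x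
    using u d mult_unit by (intro dvd_mult_cancel_unit) auto
  have cancel': "int p dvd ?w * d * x \<longleftrightarrow> int p dvd x" for x
    using u d mult_unit by (intro dvd_mult_cancel_unit) auto
  have "int p dvd ?u * ?v * d * (?u - ?v) \<or> int p dvd ?u * ?v * d * (?u + ?v) \<or>
    int p dvd ?u * ?v * d * (2 * ?u - ?v) \<or> int p dvd ?u * ?v * d * (2 * ?u + ?v) \<or>
    int p dvd ?u * ?v * d * (?u - 2 * ?v) \<or> int p dvd ?u * ?v * d * (?u + 2 * ?v)"
    using direction_ratio[OF C(1) sz _ ex(1) _ ex(2)] u d mult_unit
    by (simp add: power2_eq_square algebra_simps)
  then have 1: "int p dvd ?u - ?v \<or> int p dvd ?u + ?v \<or> int p dvd 2 * ?u - ?v \<or>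
    int p dvd 2 * ?u + ?v \<or> int p dvd ?u - 2 * ?v \<or> int p dvd ?u + 2 * ?v"
    unfolding cancel .
  have "int p dvd ?w * d * (?u\<^sup>2 - ?v\<^sup>2) \<or> int p dvd ?w * d * (?u\<^sup>2 + ?v\<^sup>2) \<or>
    int p dvd ?w * d * (2 * ?u\<^sup>2 - ?v\<^sup>2) \<or> int p dvd ?w * d * (2 * ?u\<^sup>2 + ?v\<^sup>2) \<or>
    int p dvd ?w * d * (?u\<^sup>2 - 2 * ?v\<^sup>2) \<or> int p dvd ?w * d * (?u\<^sup>2 + 2 * ?v\<^sup>2)"
    using direction_ratio[OF C(1) sz _ ex(3) _ ex(4)] u d mult_unit
    by (simp add: power2_eq_square algebra_simps)
  then have 2: "int p dvd ?u\<^sup>2 - ?v\<^sup>2 \<or> int p dvd ?u\<^sup>2 + ?v\<^sup>2 \<or> int p dvd 2 * ?u\<^sup>2 - ?v\<^sup>2 \<or>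
    int p dvd 2 * ?u\<^sup>2 + ?v\<^sup>2 \<or> int p dvd ?u\<^sup>2 - 2 * ?v\<^sup>2 \<or> int p dvd ?u\<^sup>2 + 2 * ?v\<^sup>2"
    unfolding cancel' .
  show ?thesis
    using ratio_and_square[OF _ u(1,2) 1 2] sz(2) sz(1) by simp
qed

text \<open>Unequal fourth powers make two directions of \<open>C\<close> different up to sign, and
  \<open>directions_four\<close> admits no third. Comparing squares expresses equality up to
  sign.\<close>

lemma four_pair:
  assumes C: "periodic C" "directed_by C d" and sz: "sz C = 4 \<or> sz C + 4 = p" "9 \<le> p"
    and perm: "perm3 i j k" and ratio: "\<not> int p dvd (a i) ^ 4 - (a j) ^ 4"
    and X: "\<not> int p dvd X" "exits C X \<le> 2"
  shows "int p dvd X\<^sup>2 - ((a i)\<^sup>2 * a k * d)\<^sup>2 \<or> int p dvd X\<^sup>2 - ((a j)\<^sup>2 * a k * d)\<^sup>2"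
proof -
  note lt = perm3D[OF perm]
  let ?u = "a i" and ?v = "a j" and ?w = "a k"
  have u: "\<not> int p dvd ?u" "\<not> int p dvd ?v" "\<not> int p dvd ?w" and d: "\<not> int p dvd d"
    using unit lt C(2) by (auto simp: directed_by_def)
  have ex: "exits C (?u\<^sup>2 * ?w * d) \<le> 2" "exits C (?v\<^sup>2 * ?w * d) \<le> 2"
    using C(2) perm lt unfolding directed_by_def by blast+
  have nz: "\<not> int p dvd ?u\<^sup>2 * ?w * d" "\<not> int p dvd ?v\<^sup>2 * ?w * d"
    using u d mult_unit by (simp_all add: power2_eq_square)
  have fact: "x\<^sup>2 - y\<^sup>2 = (x - y) * (x + y)" for x y :: int
    by (simp add: power2_eq_square algebra_simps)
  have "\<not> int p dvd (?u\<^sup>2 - ?v\<^sup>2) * (?w * d)" "\<not> int p dvd (?u\<^sup>2 + ?v\<^sup>2) * (?w * d)"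
  proof -
    have "?u ^ 4 - ?v ^ 4 = (?u\<^sup>2 - ?v\<^sup>2) * (?u\<^sup>2 + ?v\<^sup>2)"
      by (simp add: power2_eq_square power4_eq_xxxx algebra_simps)
    then have "\<not> int p dvd ?u\<^sup>2 - ?v\<^sup>2" "\<not> int p dvd ?u\<^sup>2 + ?v\<^sup>2"
      using ratio by auto
    then show "\<not> int p dvd (?u\<^sup>2 - ?v\<^sup>2) * (?w * d)" "\<not> int p dvd (?u\<^sup>2 + ?v\<^sup>2) * (?w * d)"
      using mult_unit[OF u(3) d] mult_unit by blast+
  qed
  moreover have "(?u\<^sup>2 - ?v\<^sup>2) * (?w * d) = ?u\<^sup>2 * ?w * d - ?v\<^sup>2 * ?w * d"
    "(?u\<^sup>2 + ?v\<^sup>2) * (?w * d) = ?u\<^sup>2 * ?w * d + ?v\<^sup>2 * ?w * d"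
    by (simp_all add: algebra_simps)
  ultimately have "int p dvd X - ?u\<^sup>2 * ?w * d \<or> int p dvd X + ?u\<^sup>2 * ?w * d \<or>
      int p dvd X - ?v\<^sup>2 * ?w * d \<or> int p dvd X + ?v\<^sup>2 * ?w * d"
    using directions_four[OF C(1) sz X nz(1) ex(1) nz(2) ex(2)] by metis
  then show ?thesis
    unfolding fact by (metis dvd_mult dvd_mult2)
qed

text \<open>To be used with the squares of the coefficients. Only two quadratic relations together
  leave \<open>U\<close> and \<open>V\<close> apart, and then
  \<open>U ^ 3 = U * V * W = V ^ 3\<close> modulo \<open>p\<close>.\<close>

lemma cubes_agree:
  fixes U V W :: int
  assumes unit: "\<not> int p dvd U" "\<not> int p dvd V"
    and 1: "int p dvd V - W \<or> int p dvd U\<^sup>2 - V * W" and 2: "int p dvd U - W \<or> int p dvd V\<^sup>2 - U * W"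
  shows "int p dvd U - V \<or> int p dvd U ^ 3 - V ^ 3"
  using 1 2
proof (elim disjE)
  assume "int p dvd V - W" "int p dvd U - W"
  from dvd_diff[OF this(2,1)] show ?thesis by simp
next
  assume "int p dvd V - W" "int p dvd V\<^sup>2 - U * W"
  from dvd_diff[OF dvd_mult[OF this(1), of U] this(2)] have "int p dvd V * (U - V)"
    by (simp add: power2_eq_square algebra_simps)
  then show ?thesis
    using unit dvd_mult_cancel_unit by blast
next
  assume "int p dvd U\<^sup>2 - V * W" "int p dvd U - W"
  from dvd_diff[OF this(1) dvd_mult[OF this(2), of V]] have "int p dvd U * (U - V)"
    by (simp add: power2_eq_square algebra_simps)
  then show ?thesis
    using unit dvd_mult_cancel_unit by blast
next
  assume "int p dvd U\<^sup>2 - V * W" "int p dvd V\<^sup>2 - U * W"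
  from dvd_diff[OF dvd_mult[OF this(1), of U] dvd_mult[OF this(2), of V]]
  show ?thesis
    by (simp add: power2_eq_square power3_eq_cube algebra_simps)
qed

text \<open>The two directions of \<open>four_pair\<close> must also account for
  \<open>(a i)\<^sup>2 * a j * d\<close> and \<open>(a j)\<^sup>2 * a i * d\<close>. This gives the
  alternatives of \<open>cubes_agree\<close> for the squared coefficients.\<close>

lemma four_sixth_powers:
  assumes C: "periodic C" "directed_by C d" and sz: "sz C = 4 \<or> sz C + 4 = p" "9 \<le> p"
    and perm: "perm3 i j k" and ratio: "\<not> int p dvd (a i) ^ 4 - (a j) ^ 4"
  shows "int p dvd ((a i)\<^sup>2) ^ 3 - ((a j)\<^sup>2) ^ 3"
proof -
  note lt = perm3D[OF perm]
  let ?u = "a i" and ?v = "a j" and ?w = "a k"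
  have u: "\<not> int p dvd ?u" "\<not> int p dvd ?v" "\<not> int p dvd ?w" and d: "\<not> int p dvd d"
    using unit lt C(2) by (auto simp: directed_by_def)
  have sq: "\<not> int p dvd ?u\<^sup>2" "\<not> int p dvd ?v\<^sup>2"
    using u mult_unit by (simp_all add: power2_eq_square)
  have ex: "exits C (?u\<^sup>2 * ?v * d) \<le> 2" "exits C (?v\<^sup>2 * ?u * d) \<le> 2"
    using C(2) perm lt unfolding directed_by_def by blast+
  have nz: "\<not> int p dvd ?u\<^sup>2 * ?v * d" "\<not> int p dvd ?v\<^sup>2 * ?u * d"
    using sq u d mult_unit by simp_all
  have canc: "int p dvd c * d\<^sup>2 * x \<longleftrightarrow> int p dvd x" if "\<not> int p dvd c" for c x
    using that d mult_unit by (intro dvd_mult_cancel_unit) (simp add: power2_eq_square)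
  have c: "\<not> int p dvd ?u ^ 4" "\<not> int p dvd ?v ^ 4"
    using u mult_unit by (simp_all add: power4_eq_xxxx)
  have "int p dvd ?u ^ 4 * d\<^sup>2 * (?v\<^sup>2 - ?w\<^sup>2) \<or> int p dvd ?v\<^sup>2 * d\<^sup>2 * ((?u\<^sup>2)\<^sup>2 - ?v\<^sup>2 * ?w\<^sup>2)"
    using four_pair[OF C sz perm ratio nz(1) ex(1)]
    by (simp add: power2_eq_square power4_eq_xxxx algebra_simps)
  then have 1: "int p dvd ?v\<^sup>2 - ?w\<^sup>2 \<or> int p dvd (?u\<^sup>2)\<^sup>2 - ?v\<^sup>2 * ?w\<^sup>2"
    using canc c sq by simp
  have "int p dvd ?u\<^sup>2 * d\<^sup>2 * ((?v\<^sup>2)\<^sup>2 - ?u\<^sup>2 * ?w\<^sup>2) \<or> int p dvd ?v ^ 4 * d\<^sup>2 * (?u\<^sup>2 - ?w\<^sup>2)"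
    using four_pair[OF C sz perm ratio nz(2) ex(2)]
    by (simp add: power2_eq_square power4_eq_xxxx algebra_simps)
  then have 2: "int p dvd ?u\<^sup>2 - ?w\<^sup>2 \<or> int p dvd (?v\<^sup>2)\<^sup>2 - ?u\<^sup>2 * ?w\<^sup>2"
    using canc c sq by auto
  have "?u ^ 4 - ?v ^ 4 = (?u\<^sup>2 - ?v\<^sup>2) * (?u\<^sup>2 + ?v\<^sup>2)"
    by (simp add: power2_eq_square power4_eq_xxxx algebra_simps)
  then have "\<not> int p dvd ?u\<^sup>2 - ?v\<^sup>2"
    using ratio by auto
  then show ?thesis
    using cubes_agree[OF sq 1 2] by blast
qed

text \<open>Tenth powers are 1 modulo 11, so \<open>u ^ 12 = u\<^sup>2\<close>, and equal sixth
  powers force equal squares.\<close>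

lemma directed_eleven:
  assumes C: "periodic C" "directed_by C d" and sz: "sz C = 4 \<or> sz C + 4 = p" and p: "p = 11"
    and ij: "i < 3" "j < 3" "i \<noteq> j"
  shows "int p dvd (a i) ^ 4 - (a j) ^ 4"
proof (rule ccontr)
  assume ratio: "\<not> ?thesis"
  obtain k where perm: "perm3 i j k"
    using perm3_third ij by blast
  let ?u = "a i" and ?v = "a j"
  have "int p dvd (?u\<^sup>2) ^ 3 - (?v\<^sup>2) ^ 3"
    using four_sixth_powers[OF C sz _ perm ratio] p by simp
  then have "[?u ^ 6 = ?v ^ 6] (mod int p)"
    by (simp add: cong_iff_dvd_diff)
  then have "[(?u ^ 6) ^ 2 = (?v ^ 6) ^ 2] (mod int p)"
    by (rule cong_pow)
  moreover have fermat: "[x ^ 10 = 1] (mod int p)" if "\<not> int p dvd x" for x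
  proof -
    have "x mod int p \<in> {1, 2, 3, 4, 5, 6, 7, 8, 9, 10}"
    proof -
      have "0 \<le> x mod int p" "x mod int p < int p" "x mod int p \<noteq> 0"
        using that p by (auto simp: dvd_eq_mod_eq_0)
      then show ?thesis
        unfolding p by (simp; presburger)
    qed
    then have "[(x mod int p) ^ 10 = 1] (mod int p)"
      unfolding p by (elim insertE emptyE) (simp_all add: cong_def)
    then show ?thesis
      by (simp add: cong_def power_mod)
  qed
  have "[?u ^ 12 = ?u\<^sup>2] (mod int p)" "[?v ^ 12 = ?v\<^sup>2] (mod int p)"
    using cong_scalar_left[OF fermat[OF unit[OF ij(1)]], of "?u\<^sup>2"]
      cong_scalar_left[OF fermat[OF unit[OF ij(2)]], of "?v\<^sup>2"]
    by (simp_all flip: power_add)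
  ultimately have "[?u\<^sup>2 = ?v\<^sup>2] (mod int p)"
    by (simp flip: power_mult) (meson cong_sym cong_trans)
  then have "[(?u\<^sup>2) ^ 2 = (?v\<^sup>2) ^ 2] (mod int p)"
    by (rule cong_pow)
  then show False
    using ratio by (simp add: cong_iff_dvd_diff)
qed

section \<open>Two color classes with two elements\<close>

lemma exits_Un_le:
  assumes "periodic A" "periodic B"
  shows "exits (A \<union> B) d \<le> exits A d + exits B d"
proof -
  have "{x \<in> A \<union> B. x + d \<notin> A \<union> B} \<subseteq> {x \<in> A. x + d \<notin> A} \<union> {x \<in> B. x + d \<notin> B}"
    by auto
  then have "exits (A \<union> B) d \<le> sz ({x \<in> A. x + d \<notin> A} \<union> {x \<in> B. x + d \<notin> B})"
    unfolding exits_def using assms by (intro sz_mono periodic_Un periodic_exits)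
  also have "\<dots> \<le> exits A d + exits B d"
    using sz_Un_Int[of "{x \<in> A. x + d \<notin> A}" "{x \<in> B. x + d \<notin> B}"] by (simp add: exits_def)
  finally show ?thesis .
qed

text \<open>The pairs \<open>A\<close> and \<open>B\<close> yield parameters \<open>d\<close> and
  \<open>e\<close>, and \<open>C\<close> is directed by both. If these agree up to sign, the common
  difference of the pairs is a third direction of the complement of \<open>C\<close>. If not, having
  only two directions forces \<open>e\<^sup>2 * u ^ 4 = d\<^sup>2 * v ^ 4\<close> and the same with
  \<open>u\<close> and \<open>v\<close> exchanged, hence \<open>u ^ 4 = - v ^ 4\<close>, which is
  incompatible with equal sixth powers.\<close>

lemma two_pairs:
  assumes col: "free_coloring A B C" and sz: "sz A = 2" "sz B = 2" "9 \<le> p"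
    and ij: "i < 3" "j < 3" "i \<noteq> j"
  shows "int p dvd (a i) ^ 4 - (a j) ^ 4"
proof (rule ccontr)
  assume ratio: "\<not> ?thesis"
  obtain k where perm: "perm3 i j k"
    using perm3_third ij by blast
  note lt = perm3D[OF perm]
  have per: "periodic A" "periodic B" "periodic C"
    using col by (simp_all add: free_coloring_def)
  have szC: "sz C = 4 \<or> sz C + 4 = p"
    using free_coloring_sz[OF col] sz by simp
  obtain s where s: "\<not> int p dvd s" "exits A s \<le> 1"
    using sz_2_exits per(1) sz(1) .
  obtain t where t: "\<not> int p dvd t" "exits B t \<le> 1"
    using sz_2_exits per(2) sz(2) .
  obtain d where d: "[a 0 * a 1 * a 2 * d = s] (mod int p)"
    using normalize_direction .
  obtain e where e: "[a 0 * a 1 * a 2 * e = t] (mod int p)"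
    using normalize_direction .
  have Cd: "directed_by C d"
    using directed_of_progression[OF col _ s(2,1) d] sz by simp
  have Ce: "directed_by C e"
    using directed_of_progression[OF free_coloring_swap[OF col] _ t(2,1) e] sz by simp
  let ?u = "a i" and ?v = "a j" and ?w = "a k"
  have u: "\<not> int p dvd ?u" "\<not> int p dvd ?v" "\<not> int p dvd ?w" and du: "\<not> int p dvd d" and eu: "\<not> int p dvd e"
    using unit lt Cd Ce by (auto simp: directed_by_def)
  have "?u ^ 4 - ?v ^ 4 = (?u\<^sup>2 - ?v\<^sup>2) * (?u\<^sup>2 + ?v\<^sup>2)"
    by (simp add: power2_eq_square power4_eq_xxxx algebra_simps)
  then have nsq: "\<not> int p dvd ?u\<^sup>2 - ?v\<^sup>2"
    using ratio by auto
  have sq: "\<not> int p dvd x\<^sup>2" if "\<not> int p dvd x" for x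
    using mult_unit that by (simp add: power2_eq_square)
  note pair = four_pair[OF per(3) Cd szC sz(3) perm ratio]
  have ne: "\<not> int p dvd e\<^sup>2 - d\<^sup>2"
  proof
    assume *: "int p dvd e\<^sup>2 - d\<^sup>2"
    have "e\<^sup>2 - d\<^sup>2 = (e - d) * (e + d)"
      by (simp add: power2_eq_square algebra_simps)
    then have "int p dvd e - d \<or> int p dvd e + d"
      using * prime_dvd_multD[OF prime_int] by auto
    let ?N = "?u * ?v * ?w"
    have "exits A (?N * d) \<le> 1"
      using exits_cong[OF per(1) d] s(2) perm3_prod[OF perm] by simp
    moreover have "exits B (?N * d) = exits B (?N * e)"
      using \<open>int p dvd e - d \<or> int p dvd e + d\<close>
    proof
      assume "int p dvd e - d"
      then have "[?N * e = ?N * d] (mod int p)"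
        by (intro cong_scalar_left) (simp add: cong_iff_dvd_diff)
      then show ?thesis
        using exits_cong[OF per(2)] by simp
    next
      assume "int p dvd e + d"
      then have "[?N * e = ?N * - d] (mod int p)"
        by (intro cong_scalar_left) (simp add: cong_iff_dvd_diff)
      then show ?thesis
        using exits_cong[OF per(2)] exits_uminus[OF per(2), of "?N * d"] by simp
    qed
    moreover have "exits B (?N * e) \<le> 1"
      using exits_cong[OF per(2) e] t(2) perm3_prod[OF perm] by simp
    moreover have "- C = A \<union> B"
      using col unfolding free_coloring_def by blast
    ultimately have "exits C (?N * d) \<le> 2"
      using exits_Un_le[OF per(1,2), of "?N * d"] exits_Compl[OF per(3), of "?N * d"] by simp
    moreover have "\<not> int p dvd ?N * d"
      using u du mult_unit by blast
    ultimately have "int p dvd (?u\<^sup>2 * ?w\<^sup>2 * d\<^sup>2) * (?v\<^sup>2 - ?u\<^sup>2) \<or> int p dvd (?v\<^sup>2 * ?w\<^sup>2 * d\<^sup>2) * (?u\<^sup>2 - ?v\<^sup>2)"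
      using pair[of "?N * d"] by (simp add: power2_eq_square algebra_simps)
    moreover have "\<not> int p dvd ?v\<^sup>2 - ?u\<^sup>2"
      using nsq by (metis dvd_diff_commute)
    moreover have "\<not> int p dvd ?u\<^sup>2 * ?w\<^sup>2 * d\<^sup>2" "\<not> int p dvd ?v\<^sup>2 * ?w\<^sup>2 * d\<^sup>2"
      using u du sq mult_unit by simp_all
    ultimately show False
      using nsq mult_unit by blast
  qed
  have ex: "exits C (?u\<^sup>2 * ?w * e) \<le> 2" "exits C (?v\<^sup>2 * ?w * e) \<le> 2"
    using Ce perm lt unfolding directed_by_def by blast+
  have nz: "\<not> int p dvd ?u\<^sup>2 * ?w * e" "\<not> int p dvd ?v\<^sup>2 * ?w * e"
    using u eu sq mult_unit by simp_all
  have units: "\<not> int p dvd ?u ^ 4 * ?w\<^sup>2" "\<not> int p dvd ?v ^ 4 * ?w\<^sup>2"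
    using u sq mult_unit by (simp_all add: power4_eq_xxxx)
  let ?P = "?u ^ 4" and ?Q = "?v ^ 4"
  have "int p dvd (?u ^ 4 * ?w\<^sup>2) * (e\<^sup>2 - d\<^sup>2) \<or> int p dvd ?w\<^sup>2 * (e\<^sup>2 * ?P - d\<^sup>2 * ?Q)"
    using pair[OF nz(1) ex(1)] by (simp add: power2_eq_square power4_eq_xxxx algebra_simps)
  then have 1: "int p dvd e\<^sup>2 * ?P - d\<^sup>2 * ?Q"
    using ne units(1) mult_unit u sq dvd_mult_cancel_unit by blast
  have "int p dvd (?v ^ 4 * ?w\<^sup>2) * (e\<^sup>2 - d\<^sup>2) \<or> int p dvd ?w\<^sup>2 * (e\<^sup>2 * ?Q - d\<^sup>2 * ?P)"
    using pair[OF nz(2) ex(2)] by (simp add: power2_eq_square power4_eq_xxxx algebra_simps) blast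
  then have 2: "int p dvd e\<^sup>2 * ?Q - d\<^sup>2 * ?P"
    using ne units(2) mult_unit u sq dvd_mult_cancel_unit by blast
  have "e\<^sup>2 * ((?P - ?Q) * (?P + ?Q)) = (e\<^sup>2 * ?P - d\<^sup>2 * ?Q) * ?P - (e\<^sup>2 * ?Q - d\<^sup>2 * ?P) * ?Q"
    by (simp add: algebra_simps)
  then have "int p dvd e\<^sup>2 * ((?P - ?Q) * (?P + ?Q))"
    using 1 2 by simp
  then have sum: "int p dvd ?P + ?Q"
    using mult_unit[OF sq[OF eu] mult_unit[OF ratio]] by blast
  have six: "int p dvd (?u\<^sup>2) ^ 3 - (?v\<^sup>2) ^ 3"
    by (rule four_sixth_powers[OF per(3) Cd szC sz(3) perm ratio])
  \<comment> \<open>Equal sixth powers give \<open>?P ^ 3 = ?Q ^ 3\<close>, while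
    \<open>?P = - ?Q\<close> gives \<open>?P ^ 3 = - (?Q ^ 3)\<close>; the identity adds the
    two.\<close>
  have "2 * ?P ^ 3 = ((?u\<^sup>2) ^ 3 - (?v\<^sup>2) ^ 3) * ((?u\<^sup>2) ^ 3 + (?v\<^sup>2) ^ 3) + (?P + ?Q) * (?P\<^sup>2 - ?P * ?Q + ?Q\<^sup>2)"
    by (simp add: algebra_simps power2_eq_square power3_eq_cube power4_eq_xxxx)
  then have two: "int p dvd 2 * ?P ^ 3"
    using six sum by (metis dvd_add dvd_mult2)
  have "int p dvd ?P ^ 3"
    by (rule numeral_dvd_cancel[OF two]) (use sz(3) in linarith)+
  then have "int p dvd ?u"
    using prime_dvd_power[OF prime_int] by metis
  then show False
    using u(1) by simp
qed

text \<open>The group generated by the negated ratios of the coefficients acts transitively on the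
  nonzero residues.\<close>

definition transitive :: bool where
  "transitive \<longleftrightarrow> (\<forall>Q. periodic Q \<longrightarrow> Q \<noteq> {} \<longrightarrow> (\<forall>x\<in>Q. \<not> int p dvd x) \<longrightarrow>
     (\<forall>i<3. \<forall>j<3. i \<noteq> j \<longrightarrow> (\<forall>x\<in>Q. \<forall>y. int p dvd a i * x + a j * y \<longrightarrow> y \<in> Q)) \<longrightarrow>
     (\<forall>x. \<not> int p dvd x \<longrightarrow> x \<in> Q))"

text \<open>The negated ratios are themselves fourth roots of unity, so these roots form an
  invariant set. If it held all nonzero residues, 2 would belong to it and \<open>p\<close> would
  divide 15.\<close>

lemma not_transitive_of_fourth_powers:
  assumes p: "7 \<le> p" and a: "\<And>i j. i < 3 \<Longrightarrow> j < 3 \<Longrightarrow> int p dvd (a i) ^ 4 - (a j) ^ 4"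
  shows "\<not> transitive"
proof
  assume trans: transitive
  define Q where "Q = {x. [x ^ 4 = 1] (mod int p)}"
  have "periodic Q"
  proof (rule periodicI)
    fix x y assume "[x = y] (mod int p)" "x \<in> Q"
    then show "y \<in> Q"
      unfolding Q_def using cong_pow[of x y "int p" 4] by (auto intro: cong_trans cong_sym)
  qed
  moreover have "1 \<in> Q"
    by (simp add: Q_def)
  then have "Q \<noteq> {}" by auto
  moreover have "\<not> int p dvd x" if "x \<in> Q" for x
  proof
    assume "int p dvd x"
    then have "int p dvd x ^ 4"
      using dvd_trans[OF _ dvd_power[of 4 x]] by simp
    then show False
      using that not_p_dvd_1 cong_dvd_iff unfolding Q_def by blast
  qed
  moreover have "y \<in> Q" if ij: "i < 3" "j < 3" and x: "x \<in> Q" "int p dvd a i * x + a j * y" for i j x y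
  proof -
    have "[a i * x = - (a j * y)] (mod int p)"
      using x(2) by (simp add: cong_iff_dvd_diff)
    then have "[(a i * x) ^ 4 = (- (a j * y)) ^ 4] (mod int p)"
      by (rule cong_pow)
    then have 1: "[a i ^ 4 * x ^ 4 = a j ^ 4 * y ^ 4] (mod int p)"
      by (simp add: power_mult_distrib)
    have "[a j ^ 4 * 1 = a i ^ 4 * x ^ 4] (mod int p)"
      using a[OF ij(2,1)] x(1) unfolding Q_def
      by (intro cong_mult) (auto simp: cong_iff_dvd_diff dvd_diff_commute)
    then have "[a j ^ 4 * 1 = a j ^ 4 * y ^ 4] (mod int p)"
      using 1 by (rule cong_trans)
    then have "int p dvd a j ^ 4 * (1 - y ^ 4)"
      by (simp add: cong_iff_dvd_diff right_diff_distrib)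
    moreover have "\<not> int p dvd a j ^ 4"
      using unit[OF ij(2)] mult_unit by (simp add: power4_eq_xxxx)
    ultimately show ?thesis
      using dvd_mult_cancel_unit dvd_diff_commute unfolding Q_def cong_iff_dvd_diff by blast
  qed
  ultimately have "\<forall>x. \<not> int p dvd x \<longrightarrow> x \<in> Q"
    using trans unfolding transitive_def by blast
  moreover have "\<not> int p dvd 2"
    using p zdvd_not_zless[of 2 "int p"] by simp
  ultimately have "[2 ^ 4 = 1] (mod int p)"
    unfolding Q_def by blast
  then have "int p dvd 3 * (5 * 1)"
    by (simp add: cong_iff_dvd_diff)
  then have "int p dvd 5 * 1"
    by (rule numeral_dvd_cancel) (use p in auto)
  then have "int p dvd 1"
    by (rule numeral_dvd_cancel) (use p in auto)
  then show False
    using not_p_dvd_1 by simp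
qed

text \<open>\<open>?g\<close> is \<open>(u + v) ^ 4 - u ^ 4\<close> divided by \<open>v\<close>, and
  it vanishes because \<open>u + v = - a 2\<close>. Equal fourth powers mean
  \<open>u\<^sup>2 = \<plusminus> v\<^sup>2\<close>, and eliminating \<open>u\<close> then leaves
  \<open>15 * v\<^sup>2\<close> or \<open>5 * v\<^sup>2\<close>.\<close>

lemma sum_unit_of_fourth_powers:
  assumes p: "7 \<le> p" and a: "\<And>i j. i < 3 \<Longrightarrow> j < 3 \<Longrightarrow> int p dvd (a i) ^ 4 - (a j) ^ 4"
  shows "\<not> int p dvd a 0 + a 1 + a 2"
proof
  assume sum: "int p dvd a 0 + a 1 + a 2"
  let ?u = "a 0" and ?v = "a 1"
  let ?g = "4 * ?u ^ 3 + 6 * ?u\<^sup>2 * ?v + 4 * ?u * ?v\<^sup>2 + ?v ^ 3"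
  have u: "\<not> int p dvd ?u" "\<not> int p dvd ?v"
    using unit by auto
  have v2: "\<not> int p dvd ?v\<^sup>2"
    using u mult_unit by (simp add: power2_eq_square)
  have "[?u + ?v = - a 2] (mod int p)"
    using sum by (simp add: cong_iff_dvd_diff)
  then have "[(?u + ?v) ^ 4 = (- a 2) ^ 4] (mod int p)"
    by (rule cong_pow)
  then have "int p dvd (?u + ?v) ^ 4 - (a 2) ^ 4"
    by (simp add: cong_iff_dvd_diff)
  from dvd_add[OF this a[of 2 0]] have "int p dvd (?u + ?v) ^ 4 - ?u ^ 4"
    by simp
  moreover have "(?u + ?v) ^ 4 - ?u ^ 4 = ?v * ?g"
    by (simp add: power2_eq_square power3_eq_cube power4_eq_xxxx algebra_simps)
  ultimately have g: "int p dvd ?g"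
    using dvd_mult_cancel_unit[OF u(2)] by simp
  have "?u ^ 4 - ?v ^ 4 = (?u\<^sup>2 - ?v\<^sup>2) * (?u\<^sup>2 + ?v\<^sup>2)"
    by (simp add: power2_eq_square power4_eq_xxxx algebra_simps)
  then have "int p dvd ?u\<^sup>2 - ?v\<^sup>2 \<or> int p dvd ?u\<^sup>2 + ?v\<^sup>2"
    using a[of 0 1] prime_dvd_multD[OF prime_int] by simp
  then have "int p dvd ?v\<^sup>2"
  proof
    assume sq: "int p dvd ?u\<^sup>2 - ?v\<^sup>2"
    from dvd_diff[OF g dvd_mult[OF sq, of "4 * ?u + 6 * ?v"]]
    have "int p dvd ?v\<^sup>2 * (8 * ?u + 7 * ?v)"
      by (simp add: power2_eq_square power3_eq_cube algebra_simps)
    then have "int p dvd 8 * ?u + 7 * ?v"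
      using dvd_mult_cancel_unit[OF v2] by blast
    from dvd_diff[OF dvd_mult[OF sq, of 64] dvd_mult[OF this, of "8 * ?u - 7 * ?v"]]
    have "int p dvd - (3 * (5 * ?v\<^sup>2))"
      by (simp add: power2_eq_square algebra_simps)
    then have "int p dvd 3 * (5 * ?v\<^sup>2)"
      by (simp only: dvd_minus_iff)
    then have "int p dvd 5 * ?v\<^sup>2"
      by (rule numeral_dvd_cancel) (use p in auto)
    then show ?thesis
      by (rule numeral_dvd_cancel) (use p in auto)
  next
    assume "int p dvd ?u\<^sup>2 + ?v\<^sup>2"
    from dvd_diff[OF dvd_mult[OF this, of "4 * ?u + 6 * ?v"] g]
    have "int p dvd ?v * (5 * ?v\<^sup>2)"
      by (simp add: power2_eq_square power3_eq_cube algebra_simps)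
    then have "int p dvd 5 * ?v\<^sup>2"
      using dvd_mult_cancel_unit[OF u(2)] by blast
    then show ?thesis
      by (rule numeral_dvd_cancel) (use p in auto)
  qed
  then show False
    using v2 by simp
qed

section \<open>A color class with a single element\<close>

text \<open>The solution \<open>y\<close> of \<open>a j * x + a k * y = c\<close> modulo
  \<open>p\<close>, the equation that remains once the singleton class has been translated to the
  origin.\<close>

definition partner :: "nat \<Rightarrow> nat \<Rightarrow> int \<Rightarrow> int \<Rightarrow> int" where
  "partner j k c x = recip k * (c - a j * x)"

lemma partner:
  assumes "k < 3"
  shows "int p dvd a j * x + a k * partner j k c x - c"
proof -
  have "[a k * (recip k * (c - a j * x)) = c - a j * x] (mod int p)"
    using cong_scalar_right[OF recip[OF assms], of "c - a j * x"] by (simp add: algebra_simps)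
  then have "int p dvd a k * partner j k c x - (c - a j * x)"
    by (simp add: cong_iff_dvd_diff partner_def)
  then show ?thesis
    by (simp add: algebra_simps)
qed

text \<open>\<open>B\<close> and \<open>C\<close> share the nonzero residues. The point
  \<open>recip j * c\<close> has partner 0; if it lies in \<open>B\<close>, the partner maps
  starting with index \<open>j\<close> send \<open>C\<close> into itself. Composed around the three
  indices they are reflections of \<open>C\<close>, and two reflections make a translation, which
  has to be trivial.\<close>

lemma coefficients_equal_of_free:
  assumes per: "periodic B" "periodic C"
    and cover: "\<And>x. \<not> int p dvd x \<Longrightarrow> x \<in> B \<or> x \<in> C"
    and nz: "\<And>x. x \<in> B \<or> x \<in> C \<Longrightarrow> \<not> int p dvd x" and disj: "B \<inter> C = {}" and "C \<noteq> {}"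
    and c: "\<not> int p dvd c"
    and free: "\<And>j k x y. j < 3 \<Longrightarrow> k < 3 \<Longrightarrow> j \<noteq> k \<Longrightarrow> x \<in> B \<Longrightarrow> y \<in> C \<Longrightarrow>
      \<not> int p dvd a j * x + a k * y - c"
    and B0: "recip 0 * c \<in> B" and ij: "i < 3" "j < 3"
  shows "int p dvd a i - a j"
proof -
  have ac: "[a k * (recip k * c) = c] (mod int p)" if "k < 3" for k
    using cong_scalar_right[OF recip[OF that], of c] by (simp add: algebra_simps)
  have stable: "partner j k c x \<in> C" if j: "j < 3" "k < 3" "j \<noteq> k" and B: "recip j * c \<in> B" and x: "x \<in> C" for j k x
  proof -
    have eq: "int p dvd a j * x + a k * partner j k c x - c"
      using partner j(2) .
    have "int p dvd a k * partner j k c x + a j * x - c"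
      using eq by (simp add: add.commute)
    then have "partner j k c x \<notin> B"
      using free[of k j "partner j k c x" x] j x by blast
    moreover have "\<not> int p dvd partner j k c x"
    proof
      assume "int p dvd partner j k c x"
      then have "int p dvd a j * x - c"
        using eq by (metis add_diff_eq diff_add_eq dvd_add_right_iff dvd_mult add.commute)
      then have "[a j * x = a j * (recip j * c)] (mod int p)"
        using ac[OF j(1)] by (meson cong_iff_dvd_diff cong_sym cong_trans)
      then have "int p dvd a j * (x - recip j * c)"
        by (simp add: cong_iff_dvd_diff right_diff_distrib)
      then have "int p dvd x - recip j * c"
        using dvd_mult_cancel_unit[OF unit[OF j(1)]] by blast
      then have "recip j * c \<in> C"
        using x periodicD_dvd[OF per(2)] by blast
      then show False
        using B disj by blast
    qed
    ultimately show ?thesis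
      using cover by blast
  qed
  have B: "recip k * c \<in> B" if k: "k < 3" for k
  proof (rule ccontr)
    assume not: "recip k * c \<notin> B"
    then have k0: "k \<noteq> 0" using B0 by metis
    have "\<not> int p dvd recip k * c"
      using recip_unit[OF k] c mult_unit by blast
    then have inC: "recip k * c \<in> C"
      using not cover by blast
    \<comment> \<open>The preimage of \<open>C\<close> under an injective affine map has the size of
      \<open>C\<close>. It would contain \<open>C\<close> and also 0, whose partner is
      \<open>recip k * c\<close>: one point too many.\<close>
    let ?V = "{x. (- (recip k * a 0)) * x + recip k * c \<in> C}"
    have V: "x \<in> ?V \<longleftrightarrow> partner 0 k c x \<in> C" for x
      by (simp add: partner_def algebra_simps)
    have "0 \<in> ?V" using inC by simp
    moreover have "C \<subseteq> ?V"
    proof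
      fix x assume "x \<in> C"
      then show "x \<in> ?V"
        using stable[of 0 k x] k k0 B0 unfolding V by simp
    qed
    moreover have "0 \<notin> C"
      using nz by auto
    ultimately have "C \<subset> ?V" by blast
    then have less: "sz C < sz ?V"
      using sz_psubset[OF periodic_affine[OF per(2)] per(2)] by blast
    have "\<not> int p dvd recip k * a 0"
      using recip_unit[OF k] unit[of 0] mult_unit by simp
    then have "\<not> int p dvd - (recip k * a 0)"
      by (simp only: dvd_minus_iff not_False_eq_True)
    then have "sz ?V = sz C"
      by (rule sz_affine[OF per(2)])
    then show False
      using less by simp
  qed
  show ?thesis
  proof (rule ccontr)
    assume ne: "\<not> int p dvd a i - a j"
    then have "i \<noteq> j" by auto
    then obtain k where perm: "perm3 i j k"
      using perm3_third ij by blast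
    have k: "k < 3" "k \<noteq> i" "k \<noteq> j"
      using perm by (auto simp: perm3_cases)
    \<comment> \<open>Going around the three equations cancels the intermediate terms, and
      \<open>x\<close> arrives at \<open>c / a u - x\<close>.\<close>
    have rot: "recip u * c - x \<in> C" if x: "x \<in> C" and u: "u < 3" "v < 3" "w < 3" "u \<noteq> v" "v \<noteq> w" "u \<noteq> w" for u v w x
    proof -
      let ?y = "partner u v c x"
      let ?z = "partner v w c ?y"
      let ?t = "partner w u c ?z"
      have "?t \<in> C"
        using x u B by (intro stable) auto
      have 1: "int p dvd a u * x + a v * ?y - c" "int p dvd a v * ?y + a w * ?z - c" "int p dvd a w * ?z + a u * ?t - c"
        using partner u by blast+
      have "int p dvd a u * (recip u * c) - c"
        using ac[OF u(1)] by (simp add: cong_iff_dvd_diff)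
      from dvd_add[OF dvd_diff[OF dvd_diff[OF this 1(1)] 1(3)] 1(2)]
      have "int p dvd a u * (recip u * c - x - ?t)"
        by (simp add: algebra_simps)
      then have "int p dvd recip u * c - x - ?t"
        using dvd_mult_cancel_unit[OF unit[OF u(1)]] by blast
      then show ?thesis
        using \<open>?t \<in> C\<close> periodicD_dvd[OF per(2)] by blast
    qed
    have shift: "x + (recip j * c - recip i * c) \<in> C" if "x \<in> C" for x
    proof -
      have "recip i * c - x \<in> C"
        using rot[of x i j k] that ij k \<open>i \<noteq> j\<close> by blast
      then have "recip j * c - (recip i * c - x) \<in> C"
        using rot[of _ j i k] ij k \<open>i \<noteq> j\<close> by blast
      then show ?thesis
        by (simp add: algebra_simps)
    qed
    have "\<not> int p dvd recip j * c - recip i * c"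
    proof
      assume "int p dvd recip j * c - recip i * c"
      then have "int p dvd a i * a j * (recip j * c - recip i * c)"
        by simp
      then have 1: "int p dvd a i * (a j * (recip j * c)) - a j * (a i * (recip i * c))"
        by (simp add: algebra_simps)
      have "[a i * (a j * (recip j * c)) - a j * (a i * (recip i * c)) = a i * c - a j * c] (mod int p)"
        using ij by (intro cong_diff cong_scalar_left ac)
      then have "int p dvd a i * c - a j * c"
        using 1 by (simp add: cong_dvd_iff)
      then have "int p dvd c * (a i - a j)"
        by (simp add: algebra_simps)
      then show False
        using dvd_mult_cancel_unit[OF c] ne by blast
    qed
    then have "C = {} \<or> C = UNIV"
      using invariant_shift_trivial[OF per(2)] shift by blast
    then show False
      using \<open>C \<noteq> {}\<close> nz[of 0] by auto
  qed
qed

text \<open>Translation of the singleton to 0 changes the right-hand side to \<open>c\<close>. If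
  \<open>c\<close> is nonzero, the class containing \<open>recip 0 * c\<close> plays the role of
  \<open>B\<close> in \<open>coefficients_equal_of_free\<close>. If \<open>c\<close> is zero,
  \<open>b\<close> is a multiple of the sum of the coefficients, which excludes the first
  hypothesis, and \<open>B\<close> is closed under the negated ratios.\<close>

lemma no_singleton_class:
  assumes col: "free_coloring A B C" and sz: "sz A = 1"
    and ne: "i < 3" "j < 3" "\<not> int p dvd a i - a j"
    and hyp: "int p dvd a 0 + a 1 + a 2 \<and> \<not> int p dvd b \<or> transitive"
  shows False
proof -
  have per: "periodic A" "periodic B" "periodic C"
    using col by (simp_all add: free_coloring_def)
  obtain s where s: "A = res_class s"
    using sz_eq_1D[OF per(1) sz] .
  define c where "c = b - (a 0 + a 1 + a 2) * s"
  let ?B = "{x. x + s \<in> B}" and ?C = "{x. x + s \<in> C}"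
  have perBC: "periodic ?B" "periodic ?C"
    using per by simp_all
  have A: "x + s \<in> A \<longleftrightarrow> int p dvd x" for x
    by (simp add: s res_class_mem)
  have cover: "x \<in> ?B \<or> x \<in> ?C" if "\<not> int p dvd x" for x
    using that A col unfolding free_coloring_def by blast
  have nz: "\<not> int p dvd x" if "x \<in> ?B \<or> x \<in> ?C" for x
    using that A[of x] col unfolding free_coloring_def by blast
  have disj: "?B \<inter> ?C = {}"
    using col unfolding free_coloring_def by blast
  have shift_ne: "{x. x + s \<in> W} \<noteq> {}" if W: "W \<noteq> {}" for W
  proof -
    obtain w where "w \<in> W" using W by blast
    then have "w - s \<in> {x. x + s \<in> W}" by simp
    then show ?thesis by blast
  qed
  have neB: "?B \<noteq> {}" and neC: "?C \<noteq> {}"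
    using col shift_ne unfolding free_coloring_def by blast+
  have free: "\<not> int p dvd a j * x + a k * y - c"
    if jk: "j < 3" "k < 3" "j \<noteq> k" and xy: "x \<in> ?B" "y \<in> ?C" for j k x y
  proof
    assume *: "int p dvd a j * x + a k * y - c"
    obtain i where perm: "perm3 j k i"
      using perm3_third jk by blast
    then have sum: "a i + a j + a k = a 0 + a 1 + a 2"
      by (auto simp: perm3_cases)
    have "a i * s + a j * (x + s) + a k * (y + s) - b = a j * x + a k * y - c"
      unfolding c_def sum[symmetric] by (simp add: algebra_simps)
    then have "[a i * s + a j * (x + s) + a k * (y + s) = b] (mod int p)"
      using * by (simp add: cong_iff_dvd_diff)
    moreover have "perm3 i j k" using perm perm3D by blast
    moreover have "s \<in> A" by (simp add: s)
    ultimately show False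
      using col xy unfolding free_coloring_def rainbow_free_def by blast
  qed
  show False
  proof (cases "int p dvd c")
    case False
    have "\<not> int p dvd recip 0 * c"
      using recip_unit[of 0] False by (intro mult_unit) auto
    then consider "recip 0 * c \<in> ?B" | "recip 0 * c \<in> ?C"
      using cover by blast
    then show False
    proof cases
      case 1
      then show False
        using coefficients_equal_of_free[OF perBC cover nz disj neC False free] ne by blast
    next
      case 2
      have free': "\<not> int p dvd a j * x + a k * y - c"
        if "j < 3" "k < 3" "j \<noteq> k" "x \<in> ?C" "y \<in> ?B" for j k x y
        using free[of k j y x] that by (simp add: add.commute)
      have cover': "x \<in> ?C \<or> x \<in> ?B" if "\<not> int p dvd x" for x
        using that cover by blast
      have nz': "\<not> int p dvd x" if "x \<in> ?C \<or> x \<in> ?B" for x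
        using that nz by blast
      show False
        using coefficients_equal_of_free[OF perBC(2,1) cover' nz' _ neB False free' 2 ne(1,2)] disj ne(3) by blast
    qed
  next
    case True
    have "transitive"
    proof (rule ccontr)
      assume "\<not> transitive"
      then have h: "int p dvd a 0 + a 1 + a 2" "\<not> int p dvd b"
        using hyp by auto
      have "b = c + (a 0 + a 1 + a 2) * s"
        by (simp add: c_def)
      then show False
        using h True by (metis dvd_add dvd_mult2)
    qed
    moreover have "y \<in> ?B" if "i < 3" "j < 3" "i \<noteq> j" "x \<in> ?B" "int p dvd a i * x + a j * y" for i j x y
    proof -
      have "y \<notin> ?C"
        using free[OF that(1-4)] that(5) True dvd_diff by blast
      moreover have "\<not> int p dvd y"
      proof
        assume "int p dvd y"
        then have "int p dvd a i * x"
          using that(5) by (metis dvd_add_left_iff dvd_mult)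
        then show False
          using unit[OF that(1)] nz[of x] that(4) mult_unit by blast
      qed
      ultimately show ?thesis
        using cover by blast
    qed
    ultimately have "\<forall>x. \<not> int p dvd x \<longrightarrow> x \<in> ?B"
      using perBC(1) neB nz unfolding transitive_def by blast
    then show False
      using neC nz disj by blast
  qed
qed

end

section \<open>Two color classes with three elements\<close>

context prime_modulus
begin

section \<open>Sums of two three-element sets\<close>

lemma sz_ge_list:
  assumes "periodic W" "set xs \<subseteq> W" "distinct (map (\<lambda>x. x mod int p) xs)"
  shows "length xs \<le> sz W"
proof -
  have "length xs = card ((\<lambda>x. x mod int p) ` set xs)"
    using distinct_card[OF assms(3)] by simp
  also have "\<dots> \<le> sz W"
    unfolding sz_def
  proof (rule card_mono)
    show "(\<lambda>x. x mod int p) ` set xs \<subseteq> W \<inter> {0..<int p}"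
    proof safe
      fix x assume "x \<in> set xs"
      then show "x mod int p \<in> W"
        using assms(2) periodicD[OF assms(1), of "x mod int p" x] by (auto simp: cong_def)
    qed (use p_ge_2 in auto)
  qed auto
  finally show ?thesis .
qed

lemma third_element:
  assumes X: "periodic X" "sz X = 3" and d: "x \<in> X" "x + d \<in> X" "\<not> int p dvd d"
  obtains u where "X = res_class x \<union> res_class (x + d) \<union> res_class (x + u)" "\<not> int p dvd u" "\<not> int p dvd u - d"
proof -
  have "res_class x \<inter> res_class (x + d) = {}"
  proof -
    have "False" if "int p dvd y - x" "int p dvd y - (x + d)" for y
      using dvd_diff[OF that] d(3) by simp
    then show ?thesis
      by (auto simp: res_class_mem)
  qed
  then have two: "sz (res_class x \<union> res_class (x + d)) = 2"
    using sz_disjoint[of "res_class x" "res_class (x + d)"] by simp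
  have sub: "res_class x \<union> res_class (x + d) \<subseteq> X"
    using res_class_subset[OF X(1)] d by blast
  then obtain y where y: "y \<in> X" "y \<notin> res_class x" "y \<notin> res_class (x + d)"
    using two X(2) by (cases "res_class x \<union> res_class (x + d) = X") auto
  have "(res_class x \<union> res_class (x + d)) \<inter> res_class y = {}"
    using y periodicD[OF periodic_res_class] unfolding res_class_def by (auto dest: cong_sym cong_trans)
  then have three: "sz (res_class x \<union> res_class (x + d) \<union> res_class y) = 3"
    using sz_disjoint[of "res_class x \<union> res_class (x + d)" "res_class y"] two by simp
  have "res_class x \<union> res_class (x + d) \<union> res_class y \<subseteq> X"
    using sub res_class_subset[OF X(1) y(1)] by blast
  then have "X = res_class x \<union> res_class (x + d) \<union> res_class (x + (y - x))"
    using sz_psubset[OF X(1), of "res_class x \<union> res_class (x + d) \<union> res_class y"] three X(2) by auto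
  moreover have "\<not> int p dvd y - x" "\<not> int p dvd y - x - d"
    using y by (simp_all add: res_class_mem algebra_simps)
  ultimately show thesis
    using that by blast
qed

lemma progression_of_three:
  assumes X: "periodic X" "sz X = 3" and d: "x \<in> X" "x + d \<in> X" "x + d + d \<in> X" "\<not> int p dvd d"
  shows "exits X d \<le> 1"
proof -
  have "length [x, x + d] \<le> sz {x \<in> X. x + d \<in> X}"
    using assms by (intro sz_ge_list) (auto simp: mod_eq_dvd_iff)
  then show ?thesis
    using sz_stay[of X d] X(2) by simp
qed

lemma mod_neqI:
  assumes "\<not> int p dvd z"
  shows "x - y = z \<Longrightarrow> x mod int p \<noteq> y mod int p" "y - x = z \<Longrightarrow> x mod int p \<noteq> y mod int p"
  using assms by (metis mod_eq_dvd_iff dvd_diff_commute)+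

text \<open>For \<open>v = u + d\<close> the nine sums of {0, d, u} and {0, d, v} reduce to seven,
  which are distinct because neither triple is a progression.\<close>

lemma triples_seven_sums:
  assumes S: "periodic S" "sz S \<le> 6" and p: "3 \<le> p"
    and d: "\<not> int p dvd d"
    and u: "\<not> int p dvd u" "\<not> int p dvd u - d" "\<not> int p dvd u + d" "\<not> int p dvd u - 2 * d" "\<not> int p dvd 2 * u - d"
    and v: "\<not> int p dvd v + d" "\<not> int p dvd 2 * v - d"
    and sums: "{w, w + d, w + 2 * d, w + u, w + u + d, w + v + d, w + u + v} \<subseteq> S"
    and vu: "int p dvd v - u - d"
  shows False
proof -
  have two: "\<not> int p dvd 2"
    using p zdvd_not_zless[of 2 "int p"] by simp
  have eqv: "[v = u + d] (mod int p)"
    using vu by (simp add: cong_iff_dvd_diff algebra_simps)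
  have "[w + v + d = w + u + 2 * d] (mod int p)" "[w + u + v = w + 2 * u + d] (mod int p)"
    using cong_add[OF cong_refl[of "w + d"] eqv] cong_add[OF cong_refl[of "w + u"] eqv] by (simp_all add: algebra_simps)
  then have sub: "set [w, w + d, w + 2 * d, w + u, w + u + d, w + u + 2 * d, w + 2 * u + d] \<subseteq> S"
    using sums periodicD[OF S(1)] by auto
  have two': "\<not> int p dvd 2 * d" "\<not> int p dvd 2 * u"
    using two d u(1) prime_dvd_multD[OF prime_int] by blast+
  have "\<not> int p dvd u + 2 * d"
  proof
    assume "int p dvd u + 2 * d"
    from dvd_add[OF this vu] show False
      using v(1) by (simp add: algebra_simps)
  qed
  moreover have "\<not> int p dvd 2 * u + d"
  proof
    assume "int p dvd 2 * u + d"
    from dvd_add[OF this dvd_mult[OF vu, of 2]] show False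
      using v(2) by (simp add: algebra_simps)
  qed
  ultimately have "\<not> int p dvd z" if "z \<in> {d, 2 * d, 2 * u, u, u - d, u + d, u - 2 * d, 2 * u - d, u + 2 * d, 2 * u + d}" for z
    using that d u two' by blast
  then have nd: "\<not> int p dvd d" "\<not> int p dvd 2 * d" "\<not> int p dvd 2 * u" "\<not> int p dvd u" "\<not> int p dvd u - d"
    "\<not> int p dvd u + d" "\<not> int p dvd u - 2 * d" "\<not> int p dvd 2 * u - d" "\<not> int p dvd u + 2 * d" "\<not> int p dvd 2 * u + d"
    by blast+
  note n = nd[THEN mod_neqI(1)] nd[THEN mod_neqI(2)]
  have "distinct (map (\<lambda>x. x mod int p) [w, w + d, w + 2 * d, w + u, w + u + d, w + u + 2 * d, w + 2 * u + d])"
    by (simp only: list.map list.set distinct.simps insert_iff empty_iff de_Morgan_disj simp_thms; intro conjI;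
        (rule n, linarith))
  then have "length [w, w + d, w + 2 * d, w + u, w + u + d, w + u + 2 * d, w + 2 * u + d] \<le> sz S"
    by (intro sz_ge_list[OF S(1) sub])
  then show False using S(2) by simp
qed

text \<open>If \<open>u\<close> and \<open>v\<close> differed, the sums other than
  \<open>u + v\<close> would have seven values, unless \<open>v = u + d\<close> or
  \<open>u = v + d\<close>; then \<open>triples_seven_sums\<close> finds seven values as
  well.\<close>

lemma triples_same_shape:
  assumes S: "periodic S" "sz S \<le> 6" and p: "3 \<le> p"
    and d: "\<not> int p dvd d"
    and u: "\<not> int p dvd u" "\<not> int p dvd u - d" "\<not> int p dvd u + d" "\<not> int p dvd u - 2 * d" "\<not> int p dvd 2 * u - d"
    and v: "\<not> int p dvd v" "\<not> int p dvd v - d" "\<not> int p dvd v + d" "\<not> int p dvd v - 2 * d" "\<not> int p dvd 2 * v - d"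
    and sums: "{w, w + d, w + 2 * d, w + u, w + u + d, w + v, w + v + d, w + u + v} \<subseteq> S"
  shows "int p dvd u - v"
proof (rule ccontr)
  assume uv: "\<not> ?thesis"
  have 1: "\<not> int p dvd v - u - d"
    using triples_seven_sums[OF S p d u v(3,5), of w] sums by auto
  have "w + v + u \<in> S"
    using sums by (simp add: algebra_simps)
  then have 2: "\<not> int p dvd u - v - d"
    using triples_seven_sums[OF S p d v u(3,5), of w] sums by auto
  have "\<not> int p dvd 2"
    using p zdvd_not_zless[of 2 "int p"] by simp
  then have two: "\<not> int p dvd 2 * d"
    using d prime_dvd_multD[OF prime_int] by blast
  note nd = d two u v uv 1 2
  note n = nd[THEN mod_neqI(1)] nd[THEN mod_neqI(2)]
  have "distinct (map (\<lambda>x. x mod int p) [w, w + d, w + 2 * d, w + u, w + u + d, w + v, w + v + d])"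
    by (simp only: list.map list.set distinct.simps insert_iff empty_iff de_Morgan_disj simp_thms; intro conjI;
        (rule n, linarith))
  then have "length [w, w + d, w + 2 * d, w + u, w + u + d, w + v, w + v + d] \<le> sz S"
    using sums by (intro sz_ge_list[OF S(1)]) auto
  then show False using S(2) by simp
qed

text \<open>Each of the excluded relations arranges \<open>x\<close>, \<open>x + d\<close>,
  \<open>x + u\<close> in an arithmetic progression.\<close>

lemma not_progression_three:
  assumes X: "periodic X" "sz X = 3" and np: "\<And>d. \<not> int p dvd d \<Longrightarrow> 2 \<le> exits X d"
    and x: "x \<in> X" "x + d \<in> X" "x + u \<in> X" and d: "\<not> int p dvd d" "\<not> int p dvd u" "\<not> int p dvd u - d"
  shows "\<not> int p dvd u + d" "\<not> int p dvd u - 2 * d" "\<not> int p dvd 2 * u - d"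
proof -
  have no: False if "y \<in> X" "y + e \<in> X" "y + e + e \<in> X" "\<not> int p dvd e" for y e
    using progression_of_three[OF X that] np[OF that(4)] by simp
  show "\<not> int p dvd u + d"
  proof
    assume "int p dvd u + d"
    then have "int p dvd (x + u + u) - (x + u) - (- d)" "int p dvd x + d + u - x"
      by (simp_all add: algebra_simps)
    then have "x + d + u \<in> X" "x + d + u + u \<in> X"
      using x periodicD_dvd[OF X(1), of "x + d + u" x] periodicD_dvd[OF X(1), of "x + d + u + u" "x + u"]
      by (simp_all add: algebra_simps)
    then show False
      using no[of "x + d" u] x d by simp
  qed
  show "\<not> int p dvd u - 2 * d"
  proof
    assume "int p dvd u - 2 * d"
    then have "x + d + d \<in> X"
      using x periodicD_dvd[OF X(1), of "x + u" "x + d + d"] by (simp add: algebra_simps)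
    then show False
      using no[of x d] x d by simp
  qed
  show "\<not> int p dvd 2 * u - d"
  proof
    assume "int p dvd 2 * u - d"
    then have "x + u + u \<in> X"
      using x periodicD_dvd[OF X(1), of "x + u + u" "x + d"] by (simp add: algebra_simps)
    then show False
      using no[of x u] x d by simp
  qed
qed

text \<open>Without a common nonzero difference all nine sums would be distinct, more than the six
  allowed. A common difference aligns two points of each triple, and
  \<open>triples_same_shape\<close> aligns the third.\<close>

lemma triples_translate:
  assumes X: "periodic X" "sz X = 3" "\<And>d. \<not> int p dvd d \<Longrightarrow> 2 \<le> exits X d"
    and Y: "periodic Y" "sz Y = 3" "\<And>d. \<not> int p dvd d \<Longrightarrow> 2 \<le> exits Y d"
    and S: "periodic S" "sz S \<le> 6" and p: "3 \<le> p"
    and sums: "\<And>x y. x \<in> X \<Longrightarrow> y \<in> Y \<Longrightarrow> x + y \<in> S"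
  shows "\<exists>c. \<forall>x. x \<in> Y \<longleftrightarrow> x - c \<in> X"
proof -
  have "\<exists>x y d. \<not> int p dvd d \<and> x \<in> X \<and> x + d \<in> X \<and> y \<in> Y \<and> y + d \<in> Y"
  proof (rule ccontr)
    assume none: "\<nexists>x y d. \<not> int p dvd d \<and> x \<in> X \<and> x + d \<in> X \<and> y \<in> Y \<and> y + d \<in> Y"
    obtain x y where xy: "x \<in> X" "y \<in> X" "\<not> int p dvd y - x"
      using sz_ge_2D[of X] X by auto
    then obtain u where u: "X = res_class x \<union> res_class (x + (y - x)) \<union> res_class (x + u)"
      "\<not> int p dvd u" "\<not> int p dvd u - (y - x)"
      using third_element[OF X(1,2), of x "y - x"] by auto
    define z where "z = x + u"
    have z: "z \<in> X" "\<not> int p dvd z - x" "\<not> int p dvd z - y"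
      using u(2,3) res_class_self[of "x + u"] unfolding u(1) z_def by (simp_all add: algebra_simps)
    have disj: "{t. t - v \<in> Y} \<inter> {t. t - w \<in> Y} = {}" if "v \<in> X" "w \<in> X" "\<not> int p dvd w - v" for v w
    proof -
      have False if t: "t - v \<in> Y" "t - w \<in> Y" for t
      proof -
        have "t - w + (w - v) \<in> Y" "v + (w - v) \<in> X"
          using t \<open>w \<in> X\<close> by simp_all
        then show False
          using none \<open>v \<in> X\<close> \<open>\<not> int p dvd w - v\<close> t(2) by blast
      qed
      then show ?thesis by blast
    qed
    let ?U = "\<lambda>v. {t. t - v \<in> Y}"
    have "sz (?U x \<union> ?U y \<union> ?U z) = 9"
      using disj[OF xy] disj[OF xy(1) z(1,2)] disj[OF xy(2) z(1,3)] Y(1,2)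
      by (simp add: sz_disjoint sz_shift_left Int_Un_distrib2)
    moreover have "?U x \<union> ?U y \<union> ?U z \<subseteq> S"
    proof -
      have "?U v \<subseteq> S" if "v \<in> X" for v
        using sums[OF that] by (metis (no_types, lifting) add_diff_eq add_diff_cancel_left' mem_Collect_eq subsetI)
      then show ?thesis
        using xy z by simp
    qed
    then have "sz (?U x \<union> ?U y \<union> ?U z) \<le> sz S"
      by (rule sz_mono[OF S(1)])
    ultimately show False
      using S(2) by simp
  qed
  then obtain x y d where d: "\<not> int p dvd d" and x: "x \<in> X" "x + d \<in> X" and y: "y \<in> Y" "y + d \<in> Y"
    by blast
  obtain u where u: "X = res_class x \<union> res_class (x + d) \<union> res_class (x + u)" "\<not> int p dvd u" "\<not> int p dvd u - d"
    using third_element[OF X(1,2) x d] .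
  obtain v where v: "Y = res_class y \<union> res_class (y + d) \<union> res_class (y + v)" "\<not> int p dvd v" "\<not> int p dvd v - d"
    using third_element[OF Y(1,2) y d] .
  have xu: "x + u \<in> X" and yv: "y + v \<in> Y"
    using u(1) v(1) by auto
  have eq: "int p dvd u - v"
  proof (rule triples_same_shape[OF S p d u(2,3) not_progression_three[OF X x xu d u(2,3)]
        v(2,3) not_progression_three[OF Y y yv d v(2,3)]])
    show "{x + y, x + y + d, x + y + 2 * d, x + y + u, x + y + u + d, x + y + v, x + y + v + d, x + y + u + v} \<subseteq> S"
      using sums[OF x(1) y(1)] sums[OF x(2) y(1)] sums[OF x(2) y(2)] sums[OF xu y(1)] sums[OF xu y(2)]
        sums[OF x(1) yv] sums[OF x(2) yv] sums[OF xu yv]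
      by (simp add: algebra_simps)
  qed
  have "z \<in> Y \<longleftrightarrow> z - (y - x) \<in> X" for z
  proof -
    have "int p dvd z - (y + v) \<longleftrightarrow> int p dvd z - (y - x) - (x + u)"
    proof -
      have "z - (y + v) = (z - (y - x) - (x + u)) + (u - v)" by simp
      then show ?thesis
        using eq by (metis dvd_add_left_iff)
    qed
    then show ?thesis
      unfolding u(1) v(1) by (simp add: res_class_mem algebra_simps)
  qed
  then show ?thesis by blast
qed

text \<open>The sum of the elements of a set of residues; only its class modulo \<open>p\<close> matters.\<close>

definition mom :: "int set \<Rightarrow> int" where
  "mom W = (\<Sum>x\<in>W \<inter> {0..<int p}. x)"

lemma mom_reindex:
  assumes "periodic W" "finite F" "inj_on (\<lambda>x. f x mod int p) F" "\<And>x. x \<in> F \<Longrightarrow> f x \<in> W" "card F = sz W"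
  shows "[mom W = (\<Sum>x\<in>F. f x)] (mod int p)"
proof -
  have "(\<lambda>x. f x mod int p) ` F \<subseteq> W \<inter> {0..<int p}"
  proof safe
    fix x assume "x \<in> F"
    then show "f x mod int p \<in> W"
      using assms(4) periodicD[OF assms(1), of "f x mod int p" "f x"] by (auto simp: cong_def)
  qed (use p_ge_2 in auto)
  moreover have "card ((\<lambda>x. f x mod int p) ` F) = card (W \<inter> {0..<int p})"
    using card_image[OF assms(3)] assms(5) by (simp add: sz_def)
  ultimately have "(\<lambda>x. f x mod int p) ` F = W \<inter> {0..<int p}"
    by (intro card_subset_eq) auto
  then have "mom W = (\<Sum>x\<in>F. f x mod int p)"
    unfolding mom_def using sum.reindex[OF assms(3), of id] by simp
  also have "[\<dots> = (\<Sum>x\<in>F. f x)] (mod int p)"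
    by (intro cong_sum) (simp add: cong_def)
  finally show ?thesis .
qed

end

section \<open>First moments of two three-element classes\<close>

context linear_equation
begin

lemma recip_mult: "j < 3 \<Longrightarrow> [recip j * (a j * x) = x] (mod int p)"
  using cong_scalar_right[OF recip, of j x] by (simp add: algebra_simps)

lemma mult_recip: "j < 3 \<Longrightarrow> [a j * (recip j * x) = x] (mod int p)"
  using cong_scalar_right[OF recip, of j x] by (simp add: algebra_simps)

lemma mult_mem_scaled: "periodic W \<Longrightarrow> j < 3 \<Longrightarrow> a j * x \<in> scaled j 0 W \<longleftrightarrow> x \<in> W"
  using periodicD[OF _ recip_mult] by (simp add: scaled_def)

text \<open>The complement of \<open>b - a k * C\<close>, which contains the sums of \<open>a i * A\<close> and \<open>a j * B\<close>.\<close>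

definition sumset_bound :: "nat \<Rightarrow> int set \<Rightarrow> int set" where
  "sumset_bound k C = {s. 0 - s \<in> - scaled k b C}"

context
  fixes A B C
  assumes col: "free_coloring A B C" and sz: "sz A = 3" "sz B = 3" and p: "11 \<le> p"
    and npA: "\<And>d. \<not> int p dvd d \<Longrightarrow> 2 \<le> exits A d"
    and npB: "\<And>d. \<not> int p dvd d \<Longrightarrow> 2 \<le> exits B d"
begin

lemma per: "periodic A" "periodic B" "periodic C"
  using col by (simp_all add: free_coloring_def)

lemma sumset_bound: 
  assumes "perm3 i j k"
  shows "periodic (sumset_bound k C)" "sz (sumset_bound k C) = 6"
    and "\<And>x y. x \<in> scaled i 0 A \<Longrightarrow> y \<in> scaled j 0 B \<Longrightarrow> x + y \<in> sumset_bound k C"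
proof -
  have Z: "periodic (- scaled k b C)" "sz (scaled k b C) = sz C"
    using per perm3D[OF assms] by simp_all
  show "periodic (sumset_bound k C)"
    unfolding sumset_bound_def by (rule periodic_reflect[OF Z(1)])
  have "sz (sumset_bound k C) = sz (- scaled k b C)"
    unfolding sumset_bound_def by (rule sz_reflect[OF Z(1)])
  then show "sz (sumset_bound k C) = 6"
    using sz_Compl[of "scaled k b C"] Z(2) free_coloring_sz[OF col] sz by simp
  fix x y assume *: "x \<in> scaled i 0 A" "y \<in> scaled j 0 B"
  show "x + y \<in> sumset_bound k C"
  proof (rule ccontr)
    assume "x + y \<notin> sumset_bound k C"
    then have "- x - y \<in> scaled k b C"
      by (simp add: sumset_bound_def)
    then have "x + y + (- x - y) \<noteq> 0"
      using free_coloring_sum_free[OF col assms] * unfolding sum_free_def by blast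
    then show False by simp
  qed
qed

lemma images_translate:
  assumes "perm3 i j k"
  shows "\<exists>c. \<forall>x. x \<in> scaled j 0 B \<longleftrightarrow> x - c \<in> scaled i 0 A"
proof (rule triples_translate[OF _ _ _ _ _ _ sumset_bound(1)[OF assms]])
  note lt = perm3D[OF assms]
  show "periodic (scaled i 0 A)" "periodic (scaled j 0 B)" "sz (scaled i 0 A) = 3" "sz (scaled j 0 B) = 3"
    using per sz lt by simp_all
  show "2 \<le> exits (scaled i 0 A) d" "2 \<le> exits (scaled j 0 B) d" if "\<not> int p dvd d" for d
    using that npA npB exits_scaled per lt mult_unit recip_unit by simp_all
qed (use sumset_bound[OF assms] p in auto)

lemma difference_transfer:
  assumes "perm3 i j k" "y \<in> B" "y + d \<in> B"
  shows "\<exists>x. x \<in> A \<and> x + recip i * a j * d \<in> A"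
proof -
  note lt = perm3D[OF assms(1)]
  obtain c where c: "\<And>x. x \<in> scaled j 0 B \<longleftrightarrow> x - c \<in> scaled i 0 A"
    using images_translate[OF assms(1)] by blast
  have "a j * y \<in> scaled j 0 B" "a j * (y + d) \<in> scaled j 0 B"
    using mult_mem_scaled per lt assms by simp_all
  then have "recip i * (a j * y - c) \<in> A" "recip i * (a j * (y + d) - c) \<in> A"
    unfolding c by (simp_all add: scaled_def)
  moreover have "recip i * (a j * (y + d) - c) = recip i * (a j * y - c) + recip i * a j * d"
    by (simp add: algebra_simps)
  ultimately show ?thesis by auto
qed

text \<open>Moments of both sides of \<open>a j * B = a i * A + c\<close>, where three elements
  contribute \<open>3 * c\<close>.\<close>

lemma mom_transfer:
  assumes perm: "perm3 i j k" and c: "\<And>x. x \<in> scaled j 0 B \<longleftrightarrow> x - c \<in> scaled i 0 A"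
  shows "[a i * mom A = a j * mom B - 3 * c] (mod int p)"
proof -
  note lt = perm3D[OF perm]
  let ?F = "B \<inter> {0..<int p}"
  have "[mom A = (\<Sum>y\<in>?F. recip i * (a j * y - c))] (mod int p)"
  proof (rule mom_reindex[OF per(1)])
    show "inj_on (\<lambda>y. recip i * (a j * y - c) mod int p) ?F"
    proof (rule inj_onI)
      fix x y assume *: "x \<in> ?F" "y \<in> ?F" "recip i * (a j * x - c) mod int p = recip i * (a j * y - c) mod int p"
      then have "int p dvd (recip i * a j) * (x - y)"
        by (simp add: mod_eq_dvd_iff algebra_simps)
      moreover have "\<not> int p dvd recip i * a j"
        using recip_unit unit lt mult_unit by simp
      ultimately have "int p dvd x - y"
        using dvd_mult_cancel_unit by blast
      then show "x = y"
        using * by (intro cong_less_imp_eq_int) (auto simp: cong_iff_dvd_diff)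
    qed
    fix y assume "y \<in> ?F"
    then have "a j * y \<in> scaled j 0 B"
      using mult_mem_scaled per lt by simp
    then show "recip i * (a j * y - c) \<in> A"
      unfolding c by (simp add: scaled_def)
  qed (use sz in \<open>auto simp: sz_def\<close>)
  also have "(\<Sum>y\<in>?F. recip i * (a j * y - c)) = recip i * (a j * mom B - 3 * c)"
    using sz(2) by (simp add: mom_def sum_subtractf flip: sum_distrib_left) (simp add: sz_def)
  finally have "[a i * mom A = a i * (recip i * (a j * mom B - 3 * c))] (mod int p)"
    by (rule cong_scalar_left)
  then show ?thesis
    using mult_recip[OF lt(1)] cong_trans by blast
qed

text \<open>The complement of \<open>C\<close> is \<open>A \<union> B\<close>, so
  \<open>sumset_bound k C\<close> is \<open>b - a k * (A \<union> B)\<close>.\<close>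

lemma mom_complement:
  assumes perm: "perm3 i j k"
  shows "[mom (sumset_bound k C) = 6 * b - a k * (mom A + mom B)] (mod int p)"
proof -
  note lt = perm3D[OF perm]
  let ?F = "(A \<inter> {0..<int p}) \<union> (B \<inter> {0..<int p})"
  have disj: "(A \<inter> {0..<int p}) \<inter> (B \<inter> {0..<int p}) = {}"
    using col unfolding free_coloring_def by blast
  have card: "card ?F = 6"
    using card_Un_disjoint[OF _ _ disj] sz by (simp add: sz_def)
  have "[mom (sumset_bound k C) = (\<Sum>x\<in>?F. b - a k * x)] (mod int p)"
  proof (rule mom_reindex[OF sumset_bound(1)[OF perm]])
    show "inj_on (\<lambda>x. (b - a k * x) mod int p) ?F"
    proof (rule inj_onI)
      fix x y assume *: "x \<in> ?F" "y \<in> ?F" "(b - a k * x) mod int p = (b - a k * y) mod int p"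
      then have "int p dvd a k * (y - x)"
        by (simp add: mod_eq_dvd_iff algebra_simps)
      then have "int p dvd y - x"
        using dvd_mult_cancel_unit unit lt by blast
      then show "x = y"
        using * by (intro cong_less_imp_eq_int) (auto simp: cong_iff_dvd_diff dvd_diff_commute)
    qed
    fix x assume "x \<in> ?F"
    then have "x \<notin> C"
      using col unfolding free_coloring_def by blast
    moreover have "[recip k * (0 - (b - a k * x)) + recip k * b = x] (mod int p)"
      using recip_mult[OF lt(3), of x] by (simp add: algebra_simps)
    ultimately have "recip k * (0 - (b - a k * x)) + recip k * b \<notin> C"
      using periodicD[OF per(3)] by blast
    then show "b - a k * x \<in> sumset_bound k C"
      unfolding sumset_bound_def scaled_def by (simp only: mem_Collect_eq Compl_iff not_False_eq_True)
  qed (use card sumset_bound[OF perm] in auto)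
  also have "(\<Sum>x\<in>?F. b - a k * x) = 6 * b - a k * (mom A + mom B)"
    using card disj by (simp add: sum_subtractf mom_def sum.union_disjoint flip: sum_distrib_left)
  finally show ?thesis .
qed

text \<open>As \<open>a j * B = a i * A + c\<close>, the sums are \<open>a i * (u + v) + c\<close>
  with \<open>u\<close>, \<open>v\<close> in \<open>A\<close>. The six unordered pairs give distinct
  values because \<open>A\<close> is not a progression, so they fill
  \<open>sumset_bound k C\<close>; each element of \<open>A\<close> occurs in them four
  times.\<close>

lemma mom_sums:
  assumes perm: "perm3 i j k" and c: "\<And>x. x \<in> scaled j 0 B \<longleftrightarrow> x - c \<in> scaled i 0 A"
  shows "[mom (sumset_bound k C) = 4 * a i * mom A + 6 * c] (mod int p)"
proof -
  note lt = perm3D[OF perm]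
  have "card (A \<inter> {0..<int p}) = 3"
    using sz by (simp add: sz_def)
  then obtain x y z where xyz: "A \<inter> {0..<int p} = {x, y, z}" and ne: "x \<noteq> y" "x \<noteq> z" "y \<noteq> z"
    unfolding card_3_iff by blast
  have A: "x \<in> A" "y \<in> A" "z \<in> A"
    using xyz by blast+
  have ndvd: "\<not> int p dvd u - v" if "u \<in> {x, y, z}" "v \<in> {x, y, z}" "u \<noteq> v" for u v
  proof
    assume "int p dvd u - v"
    moreover have "0 \<le> u" "u < int p" "0 \<le> v" "v < int p"
      using that unfolding xyz[symmetric] by auto
    ultimately show False
      using that(3) cong_less_imp_eq_int cong_iff_dvd_diff by blast
  qed
  have d: "\<not> int p dvd y - x" "\<not> int p dvd z - x" "\<not> int p dvd z - y"
    using ndvd ne by auto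
  then have "\<not> int p dvd z - x - (y - x)" by simp
  then have np: "\<not> int p dvd (z - x) + (y - x)" "\<not> int p dvd z - x - 2 * (y - x)" "\<not> int p dvd 2 * (z - x) - (y - x)"
    using not_progression_three[OF per(1) sz(1), of x "y - x" "z - x"] npA A d by simp_all
  have "\<not> int p dvd 2"
    using p zdvd_not_zless[of 2 "int p"] by simp
  then have two: "\<not> int p dvd 2 * (y - x)" "\<not> int p dvd 2 * (z - x)" "\<not> int p dvd 2 * (z - y)"
    using d prime_dvd_multD[OF prime_int] by blast+
  note nd = d two np
  note n = nd[THEN mod_neqI(1)] nd[THEN mod_neqI(2)]
  let ?L = "[(x, x), (x, y), (x, z), (y, y), (y, z), (z, z)]"
  have dist: "distinct (map (\<lambda>v. v mod int p) [x + x, x + y, x + z, y + y, y + z, z + z])"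
    by (simp only: list.map list.set distinct.simps insert_iff empty_iff de_Morgan_disj simp_thms; intro conjI;
        (rule n, simp; fail | rule n, linarith))
  then have "distinct (map (\<lambda>(u, v). (u + v) mod int p) ?L)"
    by simp
  then have L: "distinct ?L" "inj_on (\<lambda>(u, v). (u + v) mod int p) (set ?L)"
    using distinct_map by blast+
  have "[mom (sumset_bound k C) = (\<Sum>(u, v)\<in>set ?L. a i * u + (a i * v + c))] (mod int p)"
  proof (rule mom_reindex[OF sumset_bound(1)[OF perm]])
    show "inj_on (\<lambda>x. (case x of (u, v) \<Rightarrow> a i * u + (a i * v + c)) mod int p) (set ?L)"
    proof (rule inj_onI)
      fix s t assume *: "s \<in> set ?L" "t \<in> set ?L" "(case s of (u, v) \<Rightarrow> a i * u + (a i * v + c)) mod int p =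
          (case t of (u, v) \<Rightarrow> a i * u + (a i * v + c)) mod int p"
      obtain u v u' v' where st: "s = (u, v)" "t = (u', v')"
        by (cases s, cases t) blast
      have "int p dvd a i * ((u + v) - (u' + v'))"
        using *(3) unfolding st by (simp add: mod_eq_dvd_iff algebra_simps)
      then have "int p dvd (u + v) - (u' + v')"
        using dvd_mult_cancel_unit unit lt by blast
      then show "s = t"
        using L(2) * unfolding st by (intro inj_onD[OF L(2)]) (simp_all add: mod_eq_dvd_iff)
    qed
    fix s assume "s \<in> set ?L"
    then obtain u v where s: "s = (u, v)" "u \<in> A" "v \<in> A"
      using A by auto
    then have "a i * u \<in> scaled i 0 A" "a i * v + c \<in> scaled j 0 B"
      using mult_mem_scaled per lt unfolding c by simp_all
    then show "(case s of (u, v) \<Rightarrow> a i * u + (a i * v + c)) \<in> sumset_bound k C"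
      using sumset_bound(3)[OF perm] s by simp
  next
    show "card (set ?L) = sz (sumset_bound k C)"
      using distinct_card[OF L(1)] sumset_bound(2)[OF perm] by simp
  qed simp
  also have "(\<Sum>(u, v)\<in>set ?L. a i * u + (a i * v + c)) = 4 * a i * mom A + 6 * c"
    unfolding sum.distinct_set_conv_list[OF L(1)] mom_def xyz using ne by (simp add: algebra_simps)
  finally show ?thesis .
qed

text \<open>Two evaluations of the moment of \<open>sumset_bound k C\<close>, with \<open>c\<close>
  eliminated by \<open>mom_transfer\<close>.\<close>

lemma mom_equation:
  assumes perm: "perm3 i j k"
  shows "int p dvd 6 * b - a k * (mom A + mom B) - 2 * a i * mom A - 2 * a j * mom B"
proof -
  obtain c where c: "\<And>x. x \<in> scaled j 0 B \<longleftrightarrow> x - c \<in> scaled i 0 A"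
    using images_translate[OF perm] by blast
  have "[6 * b - a k * (mom A + mom B) = 4 * a i * mom A + 6 * c] (mod int p)"
    using mom_complement[OF perm] mom_sums[OF perm c] by (meson cong_sym cong_trans)
  then have 1: "int p dvd 6 * b - a k * (mom A + mom B) - (4 * a i * mom A + 6 * c)"
    by (simp only: cong_iff_dvd_diff)
  have 2: "int p dvd a i * mom A - (a j * mom B - 3 * c)"
    using mom_transfer[OF perm c] by (simp only: cong_iff_dvd_diff)
  from dvd_add[OF 1 dvd_mult[OF 2, of 2]] show ?thesis
    by (simp add: algebra_simps)
qed

end

text \<open>In the first case exchanging two unequal coefficients shows that \<open>A\<close> and
  \<open>B\<close> have equal moments, which makes \<open>6 * b\<close> a multiple of the sum of the
  coefficients. In the second the differences of \<open>A\<close> are closed under the negated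
  ratios and hence exhaust the residues, but three elements have too few differences.\<close>

lemma no_triples:
  assumes col: "free_coloring A B C" and sz: "sz A = 3" "sz B = 3" and p: "11 \<le> p"
    and npA: "\<And>d. \<not> int p dvd d \<Longrightarrow> 2 \<le> exits A d"
    and npB: "\<And>d. \<not> int p dvd d \<Longrightarrow> 2 \<le> exits B d"
    and ne: "i < 3" "j < 3" "\<not> int p dvd a i - a j"
    and hyp: "int p dvd a 0 + a 1 + a 2 \<and> \<not> int p dvd b \<or> transitive"
  shows False
  using hyp
proof
  assume h: "int p dvd a 0 + a 1 + a 2 \<and> \<not> int p dvd b"
  have "i \<noteq> j" using ne(3) by auto
  then obtain k where perm: "perm3 i j k"
    using perm3_third ne by blast
  have eq: "int p dvd 6 * b - a k * (mom A + mom B) - 2 * a i * mom A - 2 * a j * mom B" if "perm3 i j k" for i j k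
    using mom_equation[OF col sz p _ _ that] npA npB by blast
  from dvd_diff[OF eq[OF perm3D(4)[OF perm]] eq[OF perm]]
  have "int p dvd 2 * ((a i - a j) * (mom A - mom B))"
    by (simp add: algebra_simps)
  then have "int p dvd (a i - a j) * (mom A - mom B)"
    by (rule numeral_dvd_cancel) (use p in auto)
  then have m: "int p dvd mom A - mom B"
    using dvd_mult_cancel_unit[OF ne(3)] by blast
  have s: "int p dvd a i + a j + a k"
    using h perm by (auto simp: perm3_cases algebra_simps)
  have "6 * b = (6 * b - a k * (mom A + mom B) - 2 * a i * mom A - 2 * a j * mom B)
      + (a i + a j + a k) * (2 * mom B) + (mom A - mom B) * (a k + 2 * a i)"
    by (simp add: algebra_simps)
  then have "int p dvd 6 * b"
    using eq[OF perm] s m by (metis dvd_add dvd_mult2)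
  then have "int p dvd b"
    by (rule numeral_dvd_cancel) (use p in auto)
  then show False using h by simp
next
  assume trans: transitive
  have per: "periodic A" "periodic B"
    using col by (simp_all add: free_coloring_def)
  let ?D = "{d. \<exists>x\<in>A. x + d \<in> A}"
  have perD: "periodic ?D"
  proof (rule periodicI)
    fix d e assume *: "[d = e] (mod int p)" "d \<in> ?D"
    then obtain x where x: "x \<in> A" "x + d \<in> A" by blast
    have "[x + d = x + e] (mod int p)"
      using *(1) by (intro cong_add cong_refl)
    then show "e \<in> ?D"
      using x periodicD[OF per(1)] by blast
  qed
  have to_B: "\<exists>y. y \<in> B \<and> y + recip i * a j * d \<in> B" if "perm3 i j k" "x \<in> A" "x + d \<in> A" for i j k x d
    using difference_transfer[OF free_coloring_swap[OF col] sz(2,1) p _ _ that] npA npB by blast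
  have to_A: "\<exists>x. x \<in> A \<and> x + recip i * a j * d \<in> A" if "perm3 i j k" "y \<in> B" "y + d \<in> B" for i j k y d
    using difference_transfer[OF col sz p _ _ that] npA npB by blast
  have closed: "e \<in> ?D" if ij: "i < 3" "j < 3" "i \<noteq> j" and d: "d \<in> ?D" "int p dvd a i * d + a j * e" for i j d e
  proof -
    obtain k where perm: "perm3 i j k"
      using perm3_third ij by blast
    note lt = perm3D[OF perm]
    obtain x where "x \<in> A" "x + d \<in> A" using d by blast
    then obtain y where "y \<in> B" "y + recip k * a i * d \<in> B"
      using to_B[of k i j] lt by blast
    then obtain z where z: "z \<in> A" "z + recip j * a k * (recip k * a i * d) \<in> A"
      using to_A[of j k i] lt by blast
    \<comment> \<open>A transfer to \<open>B\<close> along \<open>a i / a k\<close> and one back to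
      \<open>A\<close> along \<open>a k / a j\<close> multiply the difference by
      \<open>a i / a j\<close>.\<close>
    let ?g = "recip j * a k * (recip k * a i * d)"
    have "[a j * ?g = a i * d] (mod int p)"
      using cong_trans[OF mult_recip[OF lt(2), of "a k * (recip k * (a i * d))"] mult_recip[OF lt(3)]]
      by (simp add: mult.assoc)
    then have "int p dvd a j * ?g - a i * d"
      by (simp only: cong_iff_dvd_diff)
    from dvd_add[OF this d(2)] have "int p dvd a j * (?g + e)"
      by (simp add: algebra_simps)
    then have "int p dvd ?g + e"
      using dvd_mult_cancel_unit[OF unit[OF lt(2)]] by blast
    \<comment> \<open>The pair is read backwards, from \<open>z + ?g\<close> to \<open>z\<close>;
      this supplies the minus sign of the negated ratio.\<close>
    then have "z + ?g + e \<in> A"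
      using z periodicD_dvd[OF per(1), of "z + ?g + e" z] by (simp add: algebra_simps)
    then show ?thesis
      using z by blast
  qed
  let ?Q = "{d. d \<in> ?D \<and> \<not> int p dvd d}"
  have "periodic {d::int. \<not> int p dvd d}"
    by (rule periodicI) (simp add: cong_dvd_iff)
  then have perQ: "periodic ?Q"
    using perD unfolding periodic_def by blast
  obtain x y where xy: "x \<in> A" "y \<in> A" "\<not> int p dvd y - x"
    using sz_ge_2D[OF per(1)] sz by auto
  then have "x + (y - x) \<in> A" by simp
  then have Q0: "y - x \<in> ?Q" using xy by blast
  have closedQ: "e \<in> ?Q" if "i < 3" "j < 3" "i \<noteq> j" "d \<in> ?Q" "int p dvd a i * d + a j * e" for i j d e
  proof -
    have "\<not> int p dvd e"
    proof
      assume "int p dvd e"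
      then have "int p dvd a i * d"
        using that(5) by (metis dvd_add_left_iff dvd_mult)
      then show False
        using that(4) mult_unit[OF unit[OF that(1)]] by blast
    qed
    then show ?thesis
      using closed[OF that(1-3)] that(4,5) by blast
  qed
  have all: "d \<in> ?D" if "\<not> int p dvd d" for d
    using trans perQ Q0 closedQ that unfolding transitive_def by blast
  obtain u where u: "A = res_class x \<union> res_class (x + (y - x)) \<union> res_class (x + u)"
    using third_element[OF per(1) sz(1), of x "y - x"] xy by auto
  define z where "z = x + u"
  \<comment> \<open>\<open>?U v\<close> holds the differences that start at \<open>v\<close>; three
    sets of three elements cannot cover eleven or more residues.\<close>
  let ?U = "\<lambda>v. {d. d + v \<in> A}"
  have "d \<in> ?U x \<union> ?U y \<union> ?U z" for d
  proof (cases "int p dvd d")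
    case True
    then show ?thesis
      using xy(1) periodicD_dvd[OF per(1), of "d + x" x] by simp
  next
    case False
    then obtain v where v: "v \<in> A" "v + d \<in> A" using all by blast
    then obtain w where w: "w \<in> {x, y, z}" "v \<in> res_class w"
      using u unfolding z_def by auto
    then have "d + w \<in> A"
      using v periodicD_dvd[OF per(1), of "v + d" "d + w"] by (simp add: res_class_mem)
    then show ?thesis using w by auto
  qed
  then have "?U x \<union> ?U y \<union> ?U z = UNIV" by blast
  then have "p = sz (?U x \<union> ?U y \<union> ?U z)" by simp
  also have "\<dots> \<le> sz (?U x) + sz (?U y) + sz (?U z)"
    using sz_Un_Int[of "?U x \<union> ?U y" "?U z"] sz_Un_Int[of "?U x" "?U y"] by linarith
  also have "\<dots> = 9"
    using sz_shift[OF per(1)] sz by simp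
  finally show False using p by simp
qed

end

section \<open>The field with seven elements\<close>

text \<open>The classes are in normal form: {0, 1}, {s, t}, and the rest of 2, ..., 6.\<close>

definition sums_seven :: "int \<Rightarrow> int \<Rightarrow> int \<times> int \<times> int \<Rightarrow> int list" where
  "sums_seven s t c = (case c of (i, j, k) \<Rightarrow> [(i * x + j * y + k * z) mod 7.
     x \<leftarrow> [0, 1], y \<leftarrow> [s, t], z \<leftarrow> filter (\<lambda>z. z \<noteq> s \<and> z \<noteq> t) [2, 3, 4, 5, 6]])"

text \<open>The conditional stops the evaluation as soon as every residue is attained.\<close>

primrec covers_seven :: "int \<Rightarrow> int \<Rightarrow> int list \<Rightarrow> (int \<times> int \<times> int) list \<Rightarrow> bool" where
  "covers_seven s t R [] = (R = [])"
| "covers_seven s t R (c # cs) =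
     (if R = [] then True else covers_seven s t (filter (\<lambda>b. b \<notin> set (sums_seven s t c)) R) cs)"

lemma covers_sevenD:
  "covers_seven s t R cs \<Longrightarrow> b \<in> set R \<Longrightarrow> \<exists>c\<in>set cs. b \<in> set (sums_seven s t c)"
proof (induction cs arbitrary: R)
  case (Cons c cs)
  then show ?case
  proof (cases "b \<in> set (sums_seven s t c)")
    case False
    then have "b \<in> set (filter (\<lambda>b. b \<notin> set (sums_seven s t c)) R)"
      using Cons.prems(2) by simp
    moreover have "covers_seven s t (filter (\<lambda>b. b \<notin> set (sums_seven s t c)) R) cs"
      using Cons.prems by (auto split: if_splits)
    ultimately show ?thesis
      using Cons.IH by (meson list.set_intros(2))
  qed auto
qed simp

definition orders3 :: "'a \<Rightarrow> 'a \<Rightarrow> 'a \<Rightarrow> ('a \<times> 'a \<times> 'a) list" where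
  "orders3 u v w = [(u, v, w), (u, w, v), (v, u, w), (v, w, u), (w, u, v), (w, v, u)]"

definition pairs_seven :: "(int \<times> int) list" where
  "pairs_seven = [(2, 3), (2, 4), (2, 5), (2, 6), (3, 4), (3, 5), (3, 6), (4, 5), (4, 6), (5, 6)]"

text \<open>Dividing by \<open>a 0\<close> and moving a two-element class to {0, 1} by an affine map
  leaves 36 pairs of coefficients and ten choices of the second class. Only equal coefficients,
  \<open>u = v = 1\<close>, are exempt.\<close>

lemma seven_check:
  "list_all (\<lambda>u. list_all (\<lambda>v. if u = 1 \<and> v = 1 then True else
     list_all (\<lambda>(s, t). covers_seven s t [0, 1, 2, 3, 4, 5, 6] (orders3 1 u v)) pairs_seven)
     [1, 2, 3, 4, 5, 6]) [1, 2, 3, 4, 5, 6]"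
  by code_simp

lemma seven_sums:
  fixes u v s t b :: int
  assumes "u \<in> {1..6}" "v \<in> {1..6}" "\<not> (u = 1 \<and> v = 1)" "s \<in> {2..6}" "t \<in> {2..6}" "s < t" "b \<in> {0..6}"
  shows "\<exists>(i, j, k)\<in>set (orders3 1 u v). \<exists>x\<in>{0, 1}. \<exists>y\<in>{s, t}. \<exists>z\<in>{2..6} - {s, t}.
    (i * x + j * y + k * z) mod 7 = b"
proof -
  have uv: "u \<in> set [1, 2, 3, 4, 5, 6]" "v \<in> set [1, 2, 3, 4, 5, 6]" and b: "b \<in> set [0, 1, 2, 3, 4, 5, 6]"
    using assms(1,2,7) by auto
  have "s \<in> {2, 3, 4, 5, 6}" "t \<in> {2, 3, 4, 5, 6}"
    using assms(4,5) by auto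
  then have st: "(s, t) \<in> set pairs_seven"
    using assms(6) unfolding pairs_seven_def by (elim insertE emptyE) simp_all
  have "list_all (\<lambda>(s, t). covers_seven s t [0, 1, 2, 3, 4, 5, 6] (orders3 1 u v)) pairs_seven"
    using bspec[OF bspec[OF seven_check[unfolded list_all_iff[of _ "[1, 2, 3, 4, 5, 6]"]] uv(1)] uv(2)] assms(3)
    by simp
  then have "covers_seven s t [0, 1, 2, 3, 4, 5, 6] (orders3 1 u v)"
    using st unfolding list_all_iff by fast
  then have "\<exists>c\<in>set (orders3 1 u v). b \<in> set (sums_seven s t c)"
    using covers_sevenD b by blast
  then obtain i j k where ijk: "(i, j, k) \<in> set (orders3 1 u v)" "b \<in> set (sums_seven s t (i, j, k))"
    by auto
  have comprehension: "c \<in> set [f x y z. x \<leftarrow> xs, y \<leftarrow> ys, z \<leftarrow> zs] \<longleftrightarrow>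
      (\<exists>x\<in>set xs. \<exists>y\<in>set ys. \<exists>z\<in>set zs. f x y z = c)" for c :: int and f and xs ys zs :: "int list"
    by auto
  obtain x y z where x: "x \<in> set [0, 1]" and y: "y \<in> set [s, t]" and z: "z \<in> set (filter (\<lambda>z. z \<noteq> s \<and> z \<noteq> t) [2, 3, 4, 5, 6])"
      and eq: "(i * x + j * y + k * z) mod 7 = b"
    using ijk(2) unfolding sums_seven_def prod.case comprehension by blast
  have "z \<in> {2..6} - {s, t}"
    using z unfolding set_filter by auto
  moreover have "x \<in> {0, 1}" "y \<in> {s, t}"
    using x y by simp_all
  ultimately show ?thesis
    using ijk(1) eq by blast
qed

context linear_equation
begin

lemma no_coloring_seven:
  assumes col: "free_coloring A B C" and p: "p = 7" and sz: "sz A = 2" "sz B = 2"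
    and ne: "i < 3" "j < 3" "\<not> int p dvd a i - a j"
  shows False
proof -
  have per: "periodic A" "periodic B" "periodic C"
    using col by (simp_all add: free_coloring_def)
  obtain r r' where r: "r \<in> A" "r' \<in> A" "\<not> int p dvd r' - r"
    using sz_ge_2D[OF per(1)] sz by auto
  \<comment> \<open>The map \<open>x \<mapsto> m * x + r\<close> sends 0 and 1 to the two chosen
    elements of \<open>A\<close>.\<close>
  define m where "m = r' - r"
  obtain n where n: "[m * n = 1] (mod int p)"
    using unit_inverse r(3) unfolding m_def .
  let ?T = "\<lambda>W. {x. m * x + r \<in> W}"
  have perT: "periodic (?T W)" if "periodic W" for W
    using that by (rule periodic_affine)
  have szT: "card (?T W \<inter> {0..<7}) = sz W" if "periodic W" for W
  proof -
    have "int p = 7" using p by simp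
    moreover have "sz (?T W) = sz W"
      unfolding m_def by (rule sz_affine[OF that r(3)])
    ultimately show ?thesis
      unfolding sz_def[of "?T W"] by simp
  qed
  have "?T A \<inter> {0..<7} = {0, 1}"
  proof (rule card_seteq[symmetric])
    show "{0, 1} \<subseteq> ?T A \<inter> {0..<7}"
      using r by (auto simp: m_def)
    show "card (?T A \<inter> {0..<7}) \<le> card {0, 1::int}"
      using szT[OF per(1)] sz by simp
  qed simp
  then have A: "x \<in> ?T A \<longleftrightarrow> x = 0 \<or> x = 1" if "0 \<le> x" "x < 7" for x
    using that by (metis (no_types, lifting) IntD1 IntI atLeastLessThan_iff insert_iff singletonD)
  obtain s t where st: "?T B \<inter> {0..<7} = {s, t}" "s < t"
  proof -
    obtain s t where *: "?T B \<inter> {0..<7} = {s, t}" "s \<noteq> t"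
      using szT[OF per(2)] sz by (auto simp: card_2_iff)
    show thesis
    proof (cases "s < t")
      case True then show thesis using that * by blast
    next
      case False
      then have "t < s" using *(2) by simp
      then show thesis using that[of t s] * by (simp add: insert_commute)
    qed
  qed
  have disj: "?T A \<inter> ?T B = {}" and cover: "?T A \<union> ?T B \<union> ?T C = UNIV"
    using col unfolding free_coloring_def by blast+
  have range: "s \<in> {2..6}" "t \<in> {2..6}"
  proof -
    have "y \<in> {2..6}" if "y \<in> {s, t}" for y
    proof -
      have y: "y \<in> ?T B" "0 \<le> y" "y < 7"
        using that unfolding st(1)[symmetric] by auto
      then have "y \<noteq> 0" "y \<noteq> 1"
        using A[of y] disj by blast+
      then show ?thesis using y by auto
    qed
    then show "s \<in> {2..6}" "t \<in> {2..6}" by blast+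
  qed
  define q where "q i = (recip 0 * a i) mod 7" for i
  have q: "[a 0 * q i = a i] (mod int p)" for i
  proof -
    have "[a 0 * q i = a 0 * (recip 0 * a i)] (mod int p)"
      by (intro cong_scalar_left) (simp add: q_def p cong_def)
    from cong_trans[OF this mult_recip[of 0 "a i"]] show ?thesis
      by simp
  qed
  have q_range: "q i \<in> {1..6}" if "i < 3" for i
  proof -
    have "q i \<noteq> 0"
      using q[of i] unit[OF that] by (metis cong_0_iff cong_sym mult_zero_right)
    moreover have "0 \<le> q i" "q i < 7"
      by (simp_all add: q_def)
    ultimately show ?thesis by auto
  qed
  have q0: "q 0 = 1"
    using recip[of 0] p by (simp add: q_def cong_def mult.commute)
  have "\<not> (q 1 = 1 \<and> q 2 = 1)"
  proof
    assume *: "q 1 = 1 \<and> q 2 = 1"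
    have all: "[a 0 = a l] (mod int p)" if "l < 3" for l
    proof -
      have "l \<in> {0, 1, 2}" using that by auto
      then have "q l = 1" using * q0 by auto
      then show ?thesis using q[of l] by simp
    qed
    then have "[a i = a j] (mod int p)"
      using ne by (meson cong_sym cong_trans)
    then show False
      using ne(3) by (simp add: cong_iff_dvd_diff)
  qed
  \<comment> \<open>The right-hand side after substituting \<open>m * x + r\<close> for each unknown
    and dividing by \<open>m * a 0\<close>.\<close>
  define c where "c = (recip 0 * (n * (b - (a 0 + a 1 + a 2) * r))) mod 7"
  have "c \<in> {0..6}"
    using pos_mod_bound[of 7] pos_mod_sign[of 7] by (force simp: c_def)
  moreover have "q 1 \<in> {1..6}" "q 2 \<in> {1..6}"
    by (rule q_range, simp)+
  ultimately obtain P where P: "P \<in> set (orders3 1 (q 1) (q 2))" "case P of (i, j, k) \<Rightarrow>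
      \<exists>x\<in>{0, 1}. \<exists>y\<in>{s, t}. \<exists>z\<in>{2..6} - {s, t}. (i * x + j * y + k * z) mod 7 = c"
    using seven_sums[OF _ _ \<open>\<not> (q 1 = 1 \<and> q 2 = 1)\<close> range st(2)] by meson
  obtain i' j' k' where P': "P = (i', j', k')"
    by (cases P)
  obtain x y z where found: "(i', j', k') \<in> set (orders3 1 (q 1) (q 2))" "x \<in> {0, 1}"
      "y \<in> {s, t}" "z \<in> {2..6} - {s, t}" "(i' * x + j' * y + k' * z) mod 7 = c"
    using P unfolding P' prod.case by meson
  have "\<exists>i j k. perm3 i j k \<and> i' = q i \<and> j' = q j \<and> k' = q k"
  proof -
    have "(i', j', k') \<in> set (orders3 (q 0) (q 1) (q 2))"
      using found(1) q0 by simp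
    then consider "(i', j', k') = (q 0, q 1, q 2)" | "(i', j', k') = (q 0, q 2, q 1)" | "(i', j', k') = (q 1, q 0, q 2)"
      | "(i', j', k') = (q 1, q 2, q 0)" | "(i', j', k') = (q 2, q 0, q 1)" | "(i', j', k') = (q 2, q 1, q 0)"
      unfolding orders3_def by auto
    then show ?thesis
    proof cases
      case 1 then show ?thesis by (intro exI[of _ 0] exI[of _ 1] exI[of _ 2]) (simp add: perm3_cases)
    next
      case 2 then show ?thesis by (intro exI[of _ 0] exI[of _ 2] exI[of _ 1]) (simp add: perm3_cases)
    next
      case 3 then show ?thesis by (intro exI[of _ 1] exI[of _ 0] exI[of _ 2]) (simp add: perm3_cases)
    next
      case 4 then show ?thesis by (intro exI[of _ 1] exI[of _ 2] exI[of _ 0]) (simp add: perm3_cases)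
    next
      case 5 then show ?thesis by (intro exI[of _ 2] exI[of _ 0] exI[of _ 1]) (simp add: perm3_cases)
    next
      case 6 then show ?thesis by (intro exI[of _ 2] exI[of _ 1] exI[of _ 0]) (simp add: perm3_cases)
    qed
  qed
  then obtain i j k where perm: "perm3 i j k" and ijk: "i' = q i" "j' = q j" "k' = q k"
    by blast
  have sum: "a i + a j + a k = a 0 + a 1 + a 2"
    using perm by (auto simp: perm3_cases)
  let ?b = "b - (a 0 + a 1 + a 2) * r"
  have "[a i * x + a j * y + a k * z = (a 0 * q i) * x + (a 0 * q j) * y + (a 0 * q k) * z] (mod int p)"
    by (intro cong_add cong_scalar_right cong_sym[OF q])
  also have "(a 0 * q i) * x + (a 0 * q j) * y + (a 0 * q k) * z = a 0 * (i' * x + j' * y + k' * z)"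
    unfolding ijk by (simp add: algebra_simps)
  also have "[a 0 * (i' * x + j' * y + k' * z) = a 0 * (recip 0 * (n * ?b))] (mod int p)"
    using found(5) by (intro cong_scalar_left) (simp add: c_def cong_def p)
  also have "[a 0 * (recip 0 * (n * ?b)) = n * ?b] (mod int p)"
    by (rule mult_recip) simp
  finally have "[m * (a i * x + a j * y + a k * z) = m * (n * ?b)] (mod int p)"
    by (rule cong_scalar_left)
  moreover have "[m * (n * ?b) = ?b] (mod int p)"
    using cong_scalar_right[OF n, of ?b] by (simp add: mult.assoc)
  ultimately have "[m * (a i * x + a j * y + a k * z) = ?b] (mod int p)"
    by (rule cong_trans)
  then have "[m * (a i * x + a j * y + a k * z) + (a i + a j + a k) * r = ?b + (a i + a j + a k) * r] (mod int p)"
    by (intro cong_add cong_refl)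
  moreover have "?b + (a i + a j + a k) * r = b"
    unfolding sum by simp
  moreover have "m * (a i * x + a j * y + a k * z) + (a i + a j + a k) * r
      = a i * (m * x + r) + a j * (m * y + r) + a k * (m * z + r)"
    by (simp add: algebra_simps)
  ultimately have "[a i * (m * x + r) + a j * (m * y + r) + a k * (m * z + r) = b] (mod int p)"
    by (simp only:)
  moreover have "m * x + r \<in> A"
    using A[of x] found(2) by auto
  moreover have "m * y + r \<in> B"
    using found(3) unfolding st(1)[symmetric] by blast
  moreover have "m * z + r \<in> C"
  proof -
    have z: "z \<in> {0..<7}" "z \<notin> {s, t}" "0 \<le> z" "z < 7" "z \<noteq> 0" "z \<noteq> 1"
      using found(4) by simp_all
    have "z \<notin> ?T B"
    proof
      assume "z \<in> ?T B"
      then have "z \<in> ?T B \<inter> {0..<7}"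
        using z(1) by blast
      then show False
        unfolding st(1) using z(2) by blast
    qed
    moreover have "z \<notin> ?T A"
      using A[OF z(3,4)] z(5,6) by blast
    ultimately show ?thesis using cover by blast
  qed
  ultimately show False
    using col perm unfolding free_coloring_def rainbow_free_def by blast
qed

section \<open>Every coloring has a rainbow solution\<close>

lemma no_sorted_coloring:
  assumes col: "free_coloring A B C" and sorted: "sz A \<le> sz B" "sz B \<le> sz C"
    and ne: "i < 3" "j < 3" "\<not> int p dvd a i - a j"
    and hyp: "int p dvd a 0 + a 1 + a 2 \<and> \<not> int p dvd b \<or> transitive"
  shows False
proof -
  have per: "periodic A" "periodic B" "periodic C"
    using col by (simp_all add: free_coloring_def)
  note sum = free_coloring_sz[OF col]
  have "0 < sz A"
    using col sz_pos_iff[OF per(1)] by (simp add: free_coloring_def)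
  moreover have "sz A \<noteq> 1"
    using no_singleton_class[OF col _ ne hyp] by blast
  ultimately have A2: "2 \<le> sz A" by linarith
  \<comment> \<open>Classes of size at least 2 give \<open>6 \<le> p\<close>, so the only primes up
    to 12 that remain are 7 and 11.\<close>
  have composite: "p \<notin> {6, 8, 9, 10, 12}"
    using prime by auto
  have p7: "p \<noteq> 7"
  proof
    assume p: "p = 7"
    then have "sz A = 2" "sz B = 2"
      using A2 sorted sum by linarith+
    then show False
      using no_coloring_seven[OF col p _ _ ne] by blast
  qed
  have "6 \<le> p"
    using A2 sorted sum by linarith
  then have p: "11 \<le> p"
    using composite p7 by auto
  \<comment> \<open>Either hypothesis fails when all fourth powers agree, so some pair of them
    differs; the remaining steps contradict this.\<close>
  obtain k l where kl: "k < 3" "l < 3" "\<not> int p dvd (a k) ^ 4 - (a l) ^ 4"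
    using not_transitive_of_fourth_powers sum_unit_of_fourth_powers hyp p by fastforce
  then have "k \<noteq> l" by auto
  have "\<exists>d. directed_by C d"
  proof -
    have of_A: ?thesis if "\<not> int p dvd d" "exits A d \<le> 1" for d
      using directed_of_progression[OF col A2 that(2,1)] normalize_direction by blast
    have of_B: ?thesis if "\<not> int p dvd d" "exits B d \<le> 1" for d
      using directed_of_progression[OF free_coloring_swap[OF col] _ that(2,1)] normalize_direction A2 sorted
      by (meson le_trans)
    consider "\<exists>d. \<not> int p dvd d \<and> exits A d \<le> 1" | "\<exists>d. \<not> int p dvd d \<and> exits B d \<le> 1"
      | "\<And>d. \<not> int p dvd d \<Longrightarrow> 2 \<le> exits A d" "\<And>d. \<not> int p dvd d \<Longrightarrow> 2 \<le> exits B d"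
    proof -
      have "e \<le> 1 \<or> 2 \<le> e" for e :: nat by linarith
      then show thesis using that by blast
    qed
    then show ?thesis
    proof cases
      case 3
      have A3: "3 \<le> sz A"
      proof (rule ccontr)
        assume "\<not> 3 \<le> sz A"
        then have "sz A = 2" using A2 by simp
        then obtain d where "\<not> int p dvd d" "exits A d \<le> 1"
          using sz_2_exits per(1) by blast
        then show False using 3(1) by fastforce
      qed
      show ?thesis
      proof (cases "4 \<le> sz B")
        case True
        then show ?thesis
          using directed_of_not_progression[OF col A3 True le_trans[OF True sorted(2)]] 3(1) by blast
      next
        case False
        then have "sz A = 3" "sz B = 3" using A3 sorted by linarith+
        then show ?thesis
          using no_triples[OF col _ _ p _ _ ne hyp] 3 by blast
      qed
    qed (use of_A of_B in blast)+
  qed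
  then obtain d where d: "directed_by C d" by blast
  \<comment> \<open>\<open>sz C = 4\<close> bounds \<open>p\<close> by 12 and leaves 11. If
    \<open>sz C + 5\<close> exceeds \<open>p\<close>, the smaller classes have at most four elements
    together, hence two each.\<close>
  consider "5 \<le> sz C" "sz C + 5 \<le> p" | "sz C = 4" "p = 11" | "sz A = 2" "sz B = 2"
  proof -
    have "4 \<le> sz C" using p sorted sum by linarith
    show thesis
    proof (cases "sz C = 4")
      case True
      then have "p = 11" using p sorted sum composite by auto
      then show thesis using that(2) True by blast
    next
      case False
      then have "5 \<le> sz C" using \<open>4 \<le> sz C\<close> by linarith
      show thesis
      proof (cases "sz C + 5 \<le> p")
        case True
        then show thesis using that(1) \<open>5 \<le> sz C\<close> by blast
      next
        case False
        then have "sz A = 2" "sz B = 2" using A2 sorted sum by linarith+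
        then show thesis using that(3) by blast
      qed
    qed
  qed
  then have "int p dvd (a k) ^ 4 - (a l) ^ 4"
  proof cases
    case 1
    then show ?thesis
      using directed_large[OF per(3) d _ _ kl(1,2) \<open>k \<noteq> l\<close>] by blast
  next
    case 2
    then show ?thesis
      using directed_eleven[OF per(3) d _ _ kl(1,2) \<open>k \<noteq> l\<close>] by blast
  next
    case 3
    then show ?thesis
      using two_pairs[OF col _ _ _ kl(1,2) \<open>k \<noteq> l\<close>] p by simp
  qed
  then show False
    using kl(3) by blast
qed

theorem no_free_coloring:
  assumes col: "free_coloring A B C"
    and ne: "i < 3" "j < 3" "\<not> int p dvd a i - a j"
    and hyp: "int p dvd a 0 + a 1 + a 2 \<and> \<not> int p dvd b \<or> transitive"
  shows False
proof -
  have sorted: False if "free_coloring X Y Z" "sz X \<le> sz Y" "sz Y \<le> sz Z" for X Y Z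
    using no_sorted_coloring[OF that ne hyp] .
  have orders: "free_coloring A B C" "free_coloring A C B" "free_coloring B A C" "free_coloring B C A"
    "free_coloring C A B" "free_coloring C B A"
    using col free_coloring_swap free_coloring_swap' by blast+
  show False
    using sorted[OF orders(1)] sorted[OF orders(2)] sorted[OF orders(3)] sorted[OF orders(4)]
      sorted[OF orders(5)] sorted[OF orders(6)] by linarith
qed

end

section \<open>The group of ratios\<close>

context linear_equation
begin

abbreviation Zp :: "int ring" where
  "Zp \<equiv> residue_ring (int p)"

lemma residues_Zp: "residues_prime p"
  by unfold_locales (rule prime)

lemma Zp_simps:
  "carrier Zp = {0..<int p}" "x \<otimes>\<^bsub>Zp\<^esub> y = x * y mod int p" "x \<oplus>\<^bsub>Zp\<^esub> y = (x + y) mod int p"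
  "\<zero>\<^bsub>Zp\<^esub> = 0" "\<one>\<^bsub>Zp\<^esub> = 1"
proof -
  interpret Z: residues_prime p Zp by (rule residues_Zp) simp
  show "carrier Zp = {0..<int p}" "x \<otimes>\<^bsub>Zp\<^esub> y = x * y mod int p" "x \<oplus>\<^bsub>Zp\<^esub> y = (x + y) mod int p"
    "\<zero>\<^bsub>Zp\<^esub> = 0" "\<one>\<^bsub>Zp\<^esub> = 1"
    using Z.res_carrier_eq Z.res_mult_eq Z.res_add_eq Z.res_zero_eq Z.res_one_eq by auto
qed

definition ratio :: "nat \<Rightarrow> nat \<Rightarrow> int" where
  "ratio i j = (- a i * recip j) mod int p"

definition ratios :: "int set" where
  "ratios = {ratio i j | i j. i < 3 \<and> j < 3 \<and> i \<noteq> j}"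

abbreviation ratio_group :: "int set" where
  "ratio_group \<equiv> generate (mult_of Zp) ratios"

lemma ratio_cong:
  assumes "j < 3"
  shows "[a j * ratio i j = - a i] (mod int p)"
proof -
  have "[a j * ratio i j = a j * (- a i * recip j)] (mod int p)"
    by (intro cong_scalar_left) (simp add: ratio_def)
  also have "a j * (- a i * recip j) = a j * (recip j * (- a i))"
    by simp
  also have "[\<dots> = - a i] (mod int p)"
    using assms by (rule mult_recip)
  finally show ?thesis .
qed

lemma ratio_eq:
  assumes "a i \<in> {0..<int p}" "a j \<in> {0..<int p}" "i < 3" "j < 3"
  shows "\<ominus>\<^bsub>Zp\<^esub> a i \<otimes>\<^bsub>Zp\<^esub> inv\<^bsub>Zp\<^esub> a j = ratio i j"
proof -
  interpret Z: residues_prime p Zp by (rule residues_Zp) simp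
  have "a j \<otimes>\<^bsub>Zp\<^esub> (recip j mod int p) = \<one>\<^bsub>Zp\<^esub>"
    using recip[OF assms(4)] p_ge_2 by (simp add: Zp_simps cong_def mod_mult_right_eq)
  then have "inv\<^bsub>Zp\<^esub> a j = recip j mod int p"
    using assms p_ge_2 by (intro Z.comm_inv_char) (auto simp: Zp_simps)
  then show ?thesis
    by (simp add: Z.res_neg_eq Zp_simps ratio_def mod_mult_eq)
qed

lemma ratio_in_units:
  assumes "i < 3" "j < 3"
  shows "ratio i j \<in> carrier (mult_of Zp)"
proof -
  have "ratio i j \<noteq> 0"
  proof
    assume "ratio i j = 0"
    then have "int p dvd a i * recip j"
      by (simp add: ratio_def mod_eq_0_iff_dvd)
    then show False
      using mult_unit unit recip_unit assms by blast
  qed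
  then show ?thesis
    using p_ge_2 by (simp add: Zp_simps ratio_def)
qed

lemma ratio_group_subset: "ratio_group \<subseteq> carrier (mult_of Zp)"
proof -
  interpret Z: residues_prime p Zp by (rule residues_Zp) simp
  have "ratios \<subseteq> carrier (mult_of Zp)"
    using ratio_in_units unfolding ratios_def by blast
  then show ?thesis
    by (rule group.generate_incl[OF Z.field_mult_group])
qed

lemma card_mult_of_Zp: "finite (carrier (mult_of Zp))" "card (carrier (mult_of Zp)) = p - 1"
proof -
  have "carrier (mult_of Zp) = {1..<int p}"
    by (auto simp: Zp_simps)
  then show "finite (carrier (mult_of Zp))" "card (carrier (mult_of Zp)) = p - 1"
    by simp_all
qed

text \<open>The set \<open>Q\<close> contains the orbit of each of its points under the group of
  ratios; when the group is everything, that orbit is the set of all nonzero residues.\<close>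

lemma transitive_of_card:
  assumes "card ratio_group = p - 1"
  shows transitive
  unfolding transitive_def
proof (intro allI impI)
  fix Q x
  assume Q: "periodic Q" "Q \<noteq> {}" "\<forall>x\<in>Q. \<not> int p dvd x"
    and closed: "\<forall>i<3. \<forall>j<3. i \<noteq> j \<longrightarrow> (\<forall>x\<in>Q. \<forall>y. int p dvd a i * x + a j * y \<longrightarrow> y \<in> Q)"
    and x: "\<not> int p dvd x"
  interpret Z: residues_prime p Zp by (rule residues_Zp) simp
  interpret M: group "mult_of Zp" by (rule Z.field_mult_group)
  have G: "ratio_group = carrier (mult_of Zp)"
    using card_subset_eq[OF card_mult_of_Zp(1) ratio_group_subset] assms card_mult_of_Zp(2) by simp
  have act: "g * y \<in> Q" if "g \<in> ratio_group" "y \<in> Q" for g y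
    using that
  proof (induction arbitrary: y)
    case one
    then show ?case by (simp add: Zp_simps)
  next
    case (incl h)
    then obtain i j where h: "h = ratio i j" "i < 3" "j < 3" "i \<noteq> j"
      unfolding ratios_def by blast
    have "[a i * y + (a j * h) * y = a i * y + (- a i) * y] (mod int p)"
      using ratio_cong[OF h(3)] unfolding h(1) by (intro cong_add cong_scalar_right cong_refl)
    then have "int p dvd a i * y + a j * (h * y)"
      by (simp add: cong_0_iff mult.assoc)
    then show ?case
      using closed h incl.prems by blast
  next
    \<comment> \<open>The inverse of \<open>ratio i j\<close> acts as \<open>ratio j i\<close>, so
      the closure condition is applied with the indices exchanged.\<close>
    case (inv h)
    then obtain i j where h: "h = ratio i j" "i < 3" "j < 3" "i \<noteq> j"
      unfolding ratios_def by blast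
    let ?g = "inv\<^bsub>mult_of Zp\<^esub> h"
    have "h \<otimes>\<^bsub>mult_of Zp\<^esub> ?g = \<one>\<^bsub>mult_of Zp\<^esub>"
      using ratio_in_units[OF h(2,3)] unfolding h(1) by (rule M.r_inv)
    then have "[h * ?g = 1] (mod int p)"
      using p_ge_2 by (simp add: Zp_simps cong_def)
    then have "[a j * (h * ?g) * y = a j * 1 * y] (mod int p)"
      by (intro cong_scalar_left cong_scalar_right)
    moreover have "[a j * h * (?g * y) = - a i * (?g * y)] (mod int p)"
      unfolding h(1) by (intro cong_scalar_right ratio_cong[OF h(3)])
    then have "[a j * (h * ?g) * y = - a i * (?g * y)] (mod int p)"
      by (simp add: mult.assoc)
    ultimately have "[a j * 1 * y = - a i * (?g * y)] (mod int p)"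
      by (meson cong_sym cong_trans)
    then have "int p dvd a j * y + a i * (?g * y)"
      by (simp add: cong_iff_dvd_diff)
    then show ?case
      using closed h inv.prems by blast
  next
    case (eng h1 h2)
    have "h1 * (h2 * y) \<in> Q"
      using eng by blast
    moreover have "[h1 * (h2 * y) = (h1 * h2 mod int p) * y] (mod int p)"
      by (simp add: cong_def mod_mult_left_eq mult.assoc)
    ultimately show ?case
      using periodicD[OF Q(1)] by (simp add: Zp_simps)
  qed
  obtain y where y: "y \<in> Q" using Q(2) by blast
  then obtain n where n: "[y * n = 1] (mod int p)"
    using unit_inverse Q(3) by blast
  define g where "g = (x * n) mod int p"
  have gy: "[g * y = x] (mod int p)"
  proof -
    have "[g * y = x * n * y] (mod int p)"
      by (intro cong_scalar_right) (simp add: g_def)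
    also have "x * n * y = x * (y * n)" by simp
    also have "[x * (y * n) = x * 1] (mod int p)"
      by (intro cong_scalar_left n)
    finally show ?thesis by simp
  qed
  have "g \<noteq> 0"
    using gy x by (auto simp: cong_dvd_iff cong_sym_eq[of 0] cong_0_iff)
  then have "g \<in> ratio_group"
    unfolding G using p_ge_2 by (simp add: Zp_simps g_def)
  then show "x \<in> Q"
    using act y gy periodicD[OF Q(1)] by blast
qed

lemma ratio_group_closed:
  assumes "x mod int p \<in> ratio_group" "i < 3" "j < 3" "i \<noteq> j" "int p dvd a i * x + a j * y"
  shows "y mod int p \<in> ratio_group"
proof -
  have "ratio i j \<in> ratio_group"
    using assms unfolding ratios_def by (blast intro: generate.incl)
  then have "ratio i j \<otimes>\<^bsub>mult_of Zp\<^esub> (x mod int p) \<in> ratio_group"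
    using assms(1) by (rule generate.eng)
  moreover have "[a j * (ratio i j * x) = a j * y] (mod int p)"
  proof -
    have "[a j * ratio i j * x = - a i * x] (mod int p)"
      by (intro cong_scalar_right ratio_cong[OF assms(3)])
    moreover have "[- a i * x = a j * y] (mod int p)"
      using assms(5) by (simp add: cong_iff_dvd_diff dvd_diff_commute[of _ "- (a i * x)"] add.commute)
    ultimately show ?thesis
      by (metis cong_trans mult.assoc)
  qed
  then have "int p dvd a j * (ratio i j * x - y)"
    by (simp add: cong_iff_dvd_diff right_diff_distrib)
  then have "int p dvd ratio i j * x - y"
    using dvd_mult_cancel_unit[OF unit[OF assms(3)]] by blast
  then have "ratio i j * x mod int p = y mod int p"
    by (simp add: mod_eq_dvd_iff)
  ultimately show ?thesis
    by (simp add: Zp_simps mod_mult_right_eq)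
qed

section \<open>Colorings as sets of classes\<close>

lemma perm3_sum:
  fixes v :: "nat \<Rightarrow> int"
  assumes "perm3 i j k"
  shows "v i + v j + v k = v 0 + v 1 + v 2"
  using assms by (auto simp: perm3_cases)

lemma solution_iff:
  assumes "b \<in> {0..<int p}"
  shows "a 0 \<otimes>\<^bsub>Zp\<^esub> x \<oplus>\<^bsub>Zp\<^esub> a 1 \<otimes>\<^bsub>Zp\<^esub> y \<oplus>\<^bsub>Zp\<^esub> a 2 \<otimes>\<^bsub>Zp\<^esub> z = b \<longleftrightarrow>
    [a 0 * x + a 1 * y + a 2 * z = b] (mod int p)"
  using assms by (simp add: Zp_simps cong_def mod_simps)

text \<open>A solution set carries no order, while on the right each class contributes a named
  point; the permutation records which coefficient meets which class.\<close>

lemma rainbow_solution_iff: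
  assumes b: "b \<in> {0..<int p}" and sub: "A \<subseteq> {0..<int p}" "B \<subseteq> {0..<int p}" "C \<subseteq> {0..<int p}"
    and disj: "A \<inter> B = {}" "A \<inter> C = {}" "B \<inter> C = {}" and ne: "A \<noteq> B" "A \<noteq> C" "B \<noteq> C"
  shows "(\<exists>S. is_solution Zp (a 0) (a 1) (a 2) b S \<and> rainbow {A, B, C} S) \<longleftrightarrow>
    (\<exists>i j k. perm3 i j k \<and> (\<exists>x\<in>A. \<exists>y\<in>B. \<exists>z\<in>C. [a i * x + a j * y + a k * z = b] (mod int p)))"
    (is "?L \<longleftrightarrow> ?R")
proof
  assume ?L
  then obtain S where sol: "is_solution Zp (a 0) (a 1) (a 2) b S" and rb: "rainbow {A, B, C} S"
    by blast
  obtain x y z where S: "S = {x, y, z}" and eq: "[a 0 * x + a 1 * y + a 2 * z = b] (mod int p)"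
    using sol unfolding is_solution_def solution_iff[OF b] by blast
  obtain s1 s2 s3 X Y Z where s: "S = {s1, s2, s3}" "s1 \<in> X" "s2 \<in> Y" "s3 \<in> Z"
    and XYZ: "X \<in> {A, B, C}" "Y \<in> {A, B, C}" "Z \<in> {A, B, C}" "X \<noteq> Y" "X \<noteq> Z" "Y \<noteq> Z"
    using rb unfolding rainbow_def by blast
  \<comment> \<open>Three different classes out of three are all of them, so \<open>S\<close> meets
    every class.\<close>
  have "{X, Y, Z} = {A, B, C}"
    by (rule card_subset_eq) (use XYZ ne in auto)
  then have meets: "\<exists>t\<in>S. t \<in> W" if "W \<in> {A, B, C}" for W
    using that s by blast
  obtain \<alpha> \<beta> \<gamma> where abc: "\<alpha> \<in> S" "\<alpha> \<in> A" "\<beta> \<in> S" "\<beta> \<in> B" "\<gamma> \<in> S" "\<gamma> \<in> C"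
    using meets[of A] meets[of B] meets[of C] by blast
  \<comment> \<open>Indexing the unknowns turns disjointness of the classes into distinctness of
    positions, which yields the permutation.\<close>
  define v where "v n = (if n = 0 then x else if n = 1 then y else z)" for n :: nat
  have v: "v 0 = x" "v 1 = y" "v 2 = z"
    by (simp_all add: v_def)
  have index: "\<exists>n. (n = 0 \<or> n = 1 \<or> n = 2) \<and> t = v n" if "t \<in> S" for t
    using that v unfolding S by blast
  obtain i where i: "i = 0 \<or> i = 1 \<or> i = 2" "\<alpha> = v i" using index abc by blast
  obtain j where j: "j = 0 \<or> j = 1 \<or> j = 2" "\<beta> = v j" using index abc by blast
  obtain k where k: "k = 0 \<or> k = 1 \<or> k = 2" "\<gamma> = v k" using index abc by blast
  have "i \<noteq> j" "i \<noteq> k" "j \<noteq> k"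
    using abc i(2) j(2) k(2) disj by blast+
  then have perm: "perm3 i j k"
    using i(1) j(1) k(1) by (elim disjE) (simp_all add: perm3_cases)
  have "a i * v i + a j * v j + a k * v k = a 0 * x + a 1 * y + a 2 * z"
    using perm3_sum[OF perm, of "\<lambda>n. a n * v n"] v by simp
  then have "[a i * \<alpha> + a j * \<beta> + a k * \<gamma> = b] (mod int p)"
    using eq i(2) j(2) k(2) by simp
  then show ?R
    using perm abc by blast
next
  assume ?R
  then obtain i j k x y z where perm: "perm3 i j k" and xyz: "x \<in> A" "y \<in> B" "z \<in> C"
    and eq: "[a i * x + a j * y + a k * z = b] (mod int p)" by blast
  define v where "v n = (if n = i then x else if n = j then y else z)" for n
  have v: "v i = x" "v j = y" "v k = z"
    using perm by (auto simp: v_def perm3_cases)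
  have "{v 0, v 1, v 2} = {v i, v j, v k}"
    using perm by (auto simp: perm3_cases)
  then have set: "{v 0, v 1, v 2} = {x, y, z}"
    using v by simp
  have "{v 0, v 1, v 2} \<subseteq> carrier Zp"
    unfolding set Zp_simps using xyz sub by blast
  then have carrier: "v 0 \<in> carrier Zp" "v 1 \<in> carrier Zp" "v 2 \<in> carrier Zp"
    by blast+
  have "[a 0 * v 0 + a 1 * v 1 + a 2 * v 2 = b] (mod int p)"
    using eq perm3_sum[OF perm, of "\<lambda>n. a n * v n"] v by simp
  then have "is_solution Zp (a 0) (a 1) (a 2) b {x, y, z}"
    unfolding is_solution_def solution_iff[OF b] using carrier set by metis
  moreover have "rainbow {A, B, C} {x, y, z}"
    unfolding rainbow_def using xyz ne by blast
  ultimately show ?L by blast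
qed

lemma free_coloring_of_partition:
  assumes b: "b \<in> {0..<int p}" and part: "A \<union> B \<union> C = {0..<int p}" "A \<noteq> {}" "B \<noteq> {}" "C \<noteq> {}"
    and disj: "A \<inter> B = {}" "A \<inter> C = {}" "B \<inter> C = {}"
    and free: "\<And>i j k x y z. perm3 i j k \<Longrightarrow> x \<in> A \<Longrightarrow> y \<in> B \<Longrightarrow> z \<in> C \<Longrightarrow>
      \<not> [a i * x + a j * y + a k * z = b] (mod int p)"
  shows "free_coloring {x. x mod int p \<in> A} {x. x mod int p \<in> B} {x. x mod int p \<in> C}"
  unfolding free_coloring_def
proof (intro conjI)
  have per: "periodic {x. x mod int p \<in> W}" for W
    by (rule periodicI) (simp add: cong_def)
  then show "periodic {x. x mod int p \<in> A}" "periodic {x. x mod int p \<in> B}" "periodic {x. x mod int p \<in> C}"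
    by blast+
  have ne: "{x. x mod int p \<in> W} \<noteq> {}" if W: "W \<noteq> {}" "W \<subseteq> {0..<int p}" for W
  proof -
    obtain w where "w \<in> W" using W(1) by blast
    then have "w mod int p \<in> W" using W(2) by auto
    then show ?thesis by blast
  qed
  show "{x. x mod int p \<in> A} \<noteq> {}" "{x. x mod int p \<in> B} \<noteq> {}" "{x. x mod int p \<in> C} \<noteq> {}"
    using part by (intro ne; blast)+
  have "x mod int p \<in> A \<union> B \<union> C" for x
    unfolding part(1) using p_ge_2 by simp
  then show "{x. x mod int p \<in> A} \<union> {x. x mod int p \<in> B} \<union> {x. x mod int p \<in> C} = UNIV"
    by blast
  show "rainbow_free {x. x mod int p \<in> A} {x. x mod int p \<in> B} {x. x mod int p \<in> C}"
    unfolding rainbow_free_def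
  proof (intro allI impI ballI)
    fix i j k x y z
    assume *: "perm3 i j k" "x \<in> {x. x mod int p \<in> A}" "y \<in> {x. x mod int p \<in> B}" "z \<in> {x. x mod int p \<in> C}"
    then have "\<not> [a i * (x mod int p) + a j * (y mod int p) + a k * (z mod int p) = b] (mod int p)"
      by (intro free) auto
    moreover have "[a i * (x mod int p) + a j * (y mod int p) + a k * (z mod int p) = a i * x + a j * y + a k * z] (mod int p)"
      by (intro cong_add cong_scalar_left) simp_all
    ultimately show "\<not> [a i * x + a j * y + a k * z = b] (mod int p)"
      using cong_trans by blast
  qed
qed (use disj in auto)

theorem rainbow_of_hypothesis:
  assumes b: "b \<in> {0..<int p}" and ne: "i < 3" "j < 3" "\<not> int p dvd a i - a j"
    and hyp: "int p dvd a 0 + a 1 + a 2 \<and> \<not> int p dvd b \<or> card ratio_group = p - 1"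
    and P: "three_coloring Zp P"
  shows "\<exists>S. is_solution Zp (a 0) (a 1) (a 2) b S \<and> rainbow P S"
proof (rule ccontr)
  assume contr: "\<not> ?thesis"
  have part: "partition_on {0..<int p} P" and "card P = 3"
    using P by (simp_all add: three_coloring_def Zp_simps)
  then obtain A B C where ABC: "P = {A, B, C}" "A \<noteq> B" "A \<noteq> C" "B \<noteq> C"
    unfolding card_3_iff by blast
  have union: "A \<union> B \<union> C = {0..<int p}"
    using partition_onD1[OF part] ABC(1) by auto
  have nonempty: "A \<noteq> {}" "B \<noteq> {}" "C \<noteq> {}"
    using partition_onD3[OF part] ABC(1) by auto
  have disj: "A \<inter> B = {}" "A \<inter> C = {}" "B \<inter> C = {}"
    using partition_onD2[OF part] ABC unfolding disjoint_def by auto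
  have sub: "A \<subseteq> {0..<int p}" "B \<subseteq> {0..<int p}" "C \<subseteq> {0..<int p}"
    using union by blast+
  have "free_coloring {x. x mod int p \<in> A} {x. x mod int p \<in> B} {x. x mod int p \<in> C}"
    using contr rainbow_solution_iff[OF b sub disj ABC(2-4)] unfolding ABC(1)
    by (intro free_coloring_of_partition[OF b union nonempty disj]) blast
  then show False
    using no_free_coloring[OF _ ne] hyp transitive_of_card by blast
qed

text \<open>The counterexample coloring: after translating a solution \<open>s\<close> with all unknowns equal to the
  origin, the classes are the origin, the group of ratios, and the remaining residues.\<close>

theorem coloring_without_rainbow:
  assumes b: "b \<in> {0..<int p}" and hyp: "\<not> int p dvd a 0 + a 1 + a 2 \<or> int p dvd b"
    and card: "card ratio_group \<noteq> p - 1"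
  shows "\<exists>P. three_coloring Zp P \<and> \<not> (\<exists>S. is_solution Zp (a 0) (a 1) (a 2) b S \<and> rainbow P S)"
proof -
  \<comment> \<open>The negation of (i) is the existence of a solution with all unknowns equal: the
    sum of the coefficients is invertible, or it vanishes together with \<open>b\<close>.\<close>
  have "\<exists>s. [(a 0 + a 1 + a 2) * s = b] (mod int p)"
  proof (cases "int p dvd a 0 + a 1 + a 2")
    case True
    then have "[(a 0 + a 1 + a 2) * 0 = b] (mod int p)"
      using hyp by (simp add: cong_iff_dvd_diff)
    then show ?thesis by blast
  next
    case False
    then obtain n where "[(a 0 + a 1 + a 2) * n = 1] (mod int p)"
      using unit_inverse by blast
    then have "[(a 0 + a 1 + a 2) * (n * b) = b] (mod int p)"
      using cong_scalar_right[of _ 1 "int p" b] by (metis mult.assoc mult_1)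
    then show ?thesis by blast
  qed
  then obtain s where s: "[(a 0 + a 1 + a 2) * s = b] (mod int p)" by blast
  define A where "A = {x \<in> {0..<int p}. (x - s) mod int p = 0}"
  define B where "B = {x \<in> {0..<int p}. (x - s) mod int p \<in> ratio_group}"
  define C where "C = {x \<in> {0..<int p}. (x - s) mod int p \<noteq> 0 \<and> (x - s) mod int p \<notin> ratio_group}"
  have zero: "0 \<notin> ratio_group"
    using ratio_group_subset by (auto simp: Zp_simps)
  have sub: "A \<subseteq> {0..<int p}" "B \<subseteq> {0..<int p}" "C \<subseteq> {0..<int p}"
    and union: "A \<union> B \<union> C = {0..<int p}"
    by (auto simp: A_def B_def C_def)
  have disj: "A \<inter> B = {}" "A \<inter> C = {}" "B \<inter> C = {}"
    using zero by (auto simp: A_def B_def C_def)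
  have lift: "(t + s) mod int p \<in> {0..<int p}" "((t + s) mod int p - s) mod int p = t" if "t \<in> {0..<int p}" for t
    using that p_ge_2 by (simp_all add: mod_simps)
  have "ratio_group \<noteq> carrier (mult_of Zp)"
    using card card_mult_of_Zp(2) by metis
  then obtain t where t: "t \<in> carrier (mult_of Zp)" "t \<notin> ratio_group"
    using ratio_group_subset by blast
  have "1 \<in> ratio_group"
    using generate.one[of "mult_of Zp" ratios] by (simp add: Zp_simps)
  then have "(0 + s) mod int p \<in> A" "(1 + s) mod int p \<in> B" "(t + s) mod int p \<in> C"
    using t lift[of 0] lift[of 1] lift[of t] p_ge_2 by (simp_all add: A_def B_def C_def Zp_simps)
  then have nonempty: "A \<noteq> {}" "B \<noteq> {}" "C \<noteq> {}" by blast+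
  then have ne: "A \<noteq> B" "A \<noteq> C" "B \<noteq> C"
    using disj by blast+
  have "partition_on {0..<int p} {A, B, C}"
    unfolding partition_on_def
  proof (intro conjI)
    show "\<Union> {A, B, C} = {0..<int p}"
      unfolding union[symmetric] by blast
    show "disjoint {A, B, C}"
      using disj by (simp add: disjoint_def Int_commute)
    show "{} \<notin> {A, B, C}"
      using nonempty by blast
  qed
  moreover have "card {A, B, C} = 3"
    using ne by simp
  ultimately have "three_coloring Zp {A, B, C}"
    by (simp add: three_coloring_def Zp_simps)
  moreover have "\<not> [a i * x + a j * y + a k * z = b] (mod int p)"
    if perm: "perm3 i j k" and xyz: "x \<in> A" "y \<in> B" "z \<in> C" for i j k x y z
  proof
    assume "[a i * x + a j * y + a k * z = b] (mod int p)"
    then have "[a i * x + a j * y + a k * z = (a 0 + a 1 + a 2) * s] (mod int p)"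
      using s by (meson cong_sym cong_trans)
    then have "int p dvd a i * x + a j * y + a k * z - (a i + a j + a k) * s"
      unfolding perm3_sum[OF perm] by (simp only: cong_iff_dvd_diff)
    \<comment> \<open>The point of \<open>A\<close> contributes nothing, so \<open>z - s\<close> is
      a negated ratio times \<open>y - s\<close> and lies in the group with it.\<close>
    moreover have "int p dvd a i * (x - s)"
      using xyz(1) by (simp add: A_def mod_eq_0_iff_dvd)
    ultimately have "int p dvd (a i * x + a j * y + a k * z - (a i + a j + a k) * s) - a i * (x - s)"
      by (rule dvd_diff)
    then have "int p dvd a j * (y - s) + a k * (z - s)"
      by (simp add: algebra_simps)
    moreover have "j < 3" "k < 3" "j \<noteq> k"
      using perm by (auto simp: perm3_cases)
    ultimately have "(z - s) mod int p \<in> ratio_group"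
      using ratio_group_closed xyz(2) unfolding B_def by blast
    then show False
      using xyz(3) by (simp add: C_def)
  qed
  ultimately show ?thesis
    using rainbow_solution_iff[OF b sub disj ne] by blast
qed

end

theorem corollary9:
  fixes p :: nat and a1 a2 a3 b :: int and R (structure)
  defines "R \<equiv> residue_ring (int p)"
  assumes "prime p"
    and "a1 \<in> carrier R" "a2 \<in> carrier R" "a3 \<in> carrier R" "b \<in> carrier R"
    and "a1 \<otimes> a2 \<otimes> a3 \<noteq> \<zero>"
    and "a1 \<noteq> a2 \<or> a1 \<noteq> a3 \<or> a2 \<noteq> a3"
  shows "(\<forall>P. three_coloring R P \<longrightarrow> (\<exists>S. is_solution R a1 a2 a3 b S \<and> rainbow P S)) \<longleftrightarrow>
    (a1 \<oplus> a2 \<oplus> a3 = \<zero> \<and> b \<noteq> \<zero>) \<or>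
    card (generate (mult_of R)
      {\<ominus> a3 \<otimes> inv a1, \<ominus> a2 \<otimes> inv a1, \<ominus> a1 \<otimes> inv a2,
       \<ominus> a3 \<otimes> inv a2, \<ominus> a1 \<otimes> inv a3, \<ominus> a2 \<otimes> inv a3}) = p - 1"
proof -
  define a where "a n = (if n = 0 then a1 else if n = 1 then a2 else a3)" for n :: nat
  have a: "a 0 = a1" "a 1 = a2" "a 2 = a3"
    by (simp_all add: a_def)
  interpret M: prime_modulus p
    by unfold_locales (rule \<open>prime p\<close>)
  interpret Z: residues_prime p R
    unfolding R_def by unfold_locales (rule \<open>prime p\<close>)
  have range: "a1 \<in> {0..<int p}" "a2 \<in> {0..<int p}" "a3 \<in> {0..<int p}" "b \<in> {0..<int p}"
    using assms(3-6) by (auto simp: Z.res_carrier_eq)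
  have "a1 \<noteq> 0" "a2 \<noteq> 0" "a3 \<noteq> 0"
    using assms(7) by (auto simp: Z.res_mult_eq Z.res_zero_eq)
  then have nz: "\<not> int p dvd a1" "\<not> int p dvd a2" "\<not> int p dvd a3"
    using range zdvd_not_zless by force+
  interpret L: linear_equation p a b
  proof unfold_locales
    fix i :: nat assume "i < 3"
    then show "\<not> int p dvd a i"
      using nz by (simp add: a_def)
  qed
  have dvd_iff: "int p dvd x - y \<longleftrightarrow> x = y" if "x \<in> {0..<int p}" "y \<in> {0..<int p}" for x y
    using that cong_less_imp_eq_int[of x "int p" y] by (auto simp: cong_iff_dvd_diff)
  have b: "b \<noteq> \<zero> \<longleftrightarrow> \<not> int p dvd b"
    using dvd_iff[of b 0] range(4) M.p_ge_2 by (simp add: Z.res_zero_eq)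
  have sum: "a1 \<oplus> a2 \<oplus> a3 = \<zero> \<longleftrightarrow> int p dvd a 0 + a 1 + a 2"
    unfolding a by (simp add: Z.res_add_eq Z.res_zero_eq mod_simps mod_eq_0_iff_dvd)
  have ratio: "\<ominus> a i \<otimes> inv a j = L.ratio i j" if "i < 3" "j < 3" for i j
    unfolding R_def using that range by (intro L.ratio_eq) (auto simp: a_def)
  have "L.ratios = {L.ratio 2 0, L.ratio 1 0, L.ratio 0 1, L.ratio 2 1, L.ratio 0 2, L.ratio 1 2}"
  proof -
    have "i < 3 \<and> j < 3 \<and> i \<noteq> j \<longleftrightarrow> (i, j) \<in> {(2, 0), (1, 0), (0, 1), (2, 1), (0, 2), (1, 2)}" for i j :: nat
      by auto
    then have "{(i, j). i < 3 \<and> j < 3 \<and> i \<noteq> j} = {(2, 0), (1, 0), (0, 1), (2, 1), (0, 2), (1, 2::nat)}"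
      by (simp only: case_prod_unfold prod.collapse Collect_mem_eq)
    moreover have "L.ratios = (\<lambda>(i, j). L.ratio i j) ` {(i, j). i < 3 \<and> j < 3 \<and> i \<noteq> j}"
      unfolding L.ratios_def by auto
    ultimately show ?thesis
      by simp
  qed
  then have gens: "{\<ominus> a3 \<otimes> inv a1, \<ominus> a2 \<otimes> inv a1, \<ominus> a1 \<otimes> inv a2,
      \<ominus> a3 \<otimes> inv a2, \<ominus> a1 \<otimes> inv a3, \<ominus> a2 \<otimes> inv a3} = L.ratios"
    unfolding a[symmetric] by (simp add: ratio)
  obtain i j where ij: "i < 3" "j < 3" "\<not> int p dvd a i - a j"
  proof -
    consider "a1 \<noteq> a2" | "a1 \<noteq> a3" | "a2 \<noteq> a3" using assms(8) by blast
    then show thesis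
    proof cases
      case 1 then show thesis using that[of 0 1] dvd_iff range a by simp
    next
      case 2 then show thesis using that[of 0 2] dvd_iff range a by simp
    next
      case 3 then show thesis using that[of 1 2] dvd_iff range a by simp
    qed
  qed
  show ?thesis
    unfolding gens b sum
    using L.rainbow_of_hypothesis[OF range(4) ij] L.coloring_without_rainbow[OF range(4)]
    unfolding a R_def by blast
qed

end
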